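(* Let $p\in[1,\infty)$. There exist a constant $C_p>0$ depending only on $p$, and quantities $C_p(r,w;N,m)>0$, defined for $r> 0$, $w\ge0$ and integers $N,m\ge1$ with $p<N+1$, such that $C_p(r,w;N,m)\to C_p$ as $N\to\infty$ with $r,w,m$ fixed and as $m\to\infty$ with $r,w,N$ fixed, and such that the following holds. Let $d\geq 2$, $e\ge1$, $T>0$, let $\mathbf X$ be a $p$-rough path on $[0,T]$ over $\mathbb R^d$ with control $\omega_p$, and let $m\ge1$. Then there exists a partition $\pi=\{0=t_0<\dots<t_m=T\}$ of $[0,T]$ with $m$ intervals (namely, one with $\omega_p(t_i,t_j)\le\frac{j-i}{m}\omega_p(0,T)$ for all $0\le i<j\le m$) such that for all $r>0$, all $A\in\mathcal L(\mathbb R^d,\mathcal L(\mathbb R^e,\mathbb R^e))$ with $|A|\le r$ and all integers $N\geq 1$ with $p<N+1$, $$\big|\Phi^A_{0,T}(\mathbf X)-\mathcal E^A_{N}(\mathbf X)_\pi\big|\le C_p\big(r,\omega_p(0,T);N,m\big)\,\exp\big(2r^p\omega_p(0,T)\big)\,\frac{\big(r\,\omega_p(0,T)^{1/p}\big)^{N+1}}{\big(\frac{N+1}{p}\big)!\;m^{\frac{N+1}{p}-1}} .$$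
   Context: Factorials of non-integers are $x!:=\Gamma(x+1)$. Tensor powers of $\mathbb R^d$ carry the Hilbert–Schmidt (Euclidean) norm; $|A|$ is the Euclidean (Frobenius) norm of $A$ as an array of $de^2$ coefficients; the norm on $\mathcal L(\mathbb R^e,\mathbb R^e)$ in the bound is the supremum over initial conditions in the Euclidean unit ball (operator norm). Let $\lfloor p\rfloor$ be the integer part of $p$ and $\mathcal G_{\lfloor p\rfloor}(\mathbb R^d)$ the step-$\lfloor p\rfloor$ free nilpotent group inside the truncated tensor algebra $\bigoplus_{k=0}^{\lfloor p\rfloor}(\mathbb R^d)^{\otimes k}$. Set $\beta_p:=p\big/\big(1-2^{1-\frac{\lfloor p\rfloor+1}{p}}\big)$ and, for $g=(1,g_1,\dots,g_{\lfloor p\rfloor})\in\mathcal G_{\lfloor p\rfloor}(\mathbb R^d)$, $|||g|||:=\max_{1\le i\le\lfloor p\rfloor}\big(\beta_p\,(i/p)!\,|g_i|\big)^{1/i}$. A $p$-rough path $\mathbf X$ on $[0,T]$ is a continuous map $(s,t)\mapsto\mathbf X_{s,t}\in\mathcal G_{\lfloor p\rfloor}(\mathbb R^d)$, $0\le s\le t\le T$, satisfying the Chen identity $\mathbf X_{s,u}\otimes\mathbf X_{u,t}=\mathbf X_{s,t}$, with $\omega_p(0,T)<\infty$, where $\omega_p(s,t):=\sup_{\pi}\sum_{[u,v]\in\pi}|||\mathbf X_{u,v}|||^p$, the supremum being over partitions of $[s,t]$. $\mathcal S^n(\mathbf X)_{s,t}\in(\mathbb R^d)^{\otimes n}$, $n\ge0$,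 denotes the signature of $\mathbf X$: the levels of the unique (Lyons) extension of $\mathbf X$ to a multiplicative functional (Chen identity) in the full tensor algebra of finite $p$-variation, with $\mathcal S^n(\mathbf X)=\mathbf X^n$ for $n\le\lfloor p\rfloor$. For $S\in(\mathbb R^d)^{\otimes n}$, $A^{\otimes n}yS$ is the linear extension in $S$ of $A^{\otimes n}y(x_1\otimes\cdots\otimes x_n)=A(x_n)\cdots A(x_1)y$. The solution map of the linear rough differential equation $\mathrm dY=A(\mathrm d\mathbf X)Y$ is $\Phi^A_{s,t}(\mathbf X)y=\sum_{n\ge0}A^{\otimes n}y\,\mathcal S^n(\mathbf X)_{s,t}$; the one-step Euler scheme is $\mathcal E^A_{N;s,t}(\mathbf X)y=\sum_{n=0}^NA^{\otimes n}y\,\mathcal S^n(\mathbf X)_{s,t}$, and $\mathcal E^A_N(\mathbf X)_\pi=\mathcal E^A_{N;t_{m-1},t_m}(\mathbf X)\cdots\mathcal E^A_{N;t_0,t_1}(\mathbf X)$. *)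

theory Defs
  imports "HOL-Analysis.Analysis" "Jordan_Normal_Form.Matrix"
begin

(* The dimensions d and e are natural numbers, since the constants of the theorem must not
   depend on them.  A tensor series over R^d is the family of its coefficients in the basis
   e_w = e_(w 0) \<otimes> ... \<otimes> e_(w (n-1)) indexed by words w over {0..<d}.
   Vectors in R^e and linear maps on R^e are the vectors and matrices of Jordan_Normal_Form. *)

definition gfact :: "real \<Rightarrow> real" where
  "gfact x = Gamma (x + 1)"

type_synonym tensor = "nat list \<Rightarrow> real"

definition words :: "nat \<Rightarrow> nat \<Rightarrow> nat list set" where
  "words d n = {w. length w = n \<and> set w \<subseteq> {..<d}}"

definition tensor_series :: "nat \<Rightarrow> tensor set" where
  "tensor_series d = {x. \<forall>w. x w \<noteq> 0 \<longrightarrow> set w \<subseteq> {..<d}}"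

(* Hilbert-Schmidt norm of the level-n component *)
definition level_norm :: "nat \<Rightarrow> nat \<Rightarrow> tensor \<Rightarrow> real" where
  "level_norm d n x = L2_set x (words d n)"

definition tensor_mult :: "tensor \<Rightarrow> tensor \<Rightarrow> tensor" where
  "tensor_mult x y = (\<lambda>w. \<Sum>k\<le>length w. x (take k w) * y (drop k w))"

definition tensor_one :: tensor where
  "tensor_one = (\<lambda>w. if w = [] then 1 else 0)"

definition tensor_truncate :: "nat \<Rightarrow> tensor \<Rightarrow> tensor" where
  "tensor_truncate n x = (\<lambda>w. if length w \<le> n then x w else 0)"

definition trunc_mult :: "nat \<Rightarrow> tensor \<Rightarrow> tensor \<Rightarrow> tensor" where
  "trunc_mult n x y = tensor_truncate n (tensor_mult x y)"

(* The Lie subalgebra generated by R^d in the step-n truncated tensor algebra *)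
inductive_set free_nilpotent_lie :: "nat \<Rightarrow> nat \<Rightarrow> tensor set" for d n where
  zero: "(\<lambda>w. 0) \<in> free_nilpotent_lie d n"
| letter: "i < d \<Longrightarrow> tensor_truncate n (\<lambda>w. if w = [i] then 1 else 0) \<in> free_nilpotent_lie d n"
| add: "x \<in> free_nilpotent_lie d n \<Longrightarrow> y \<in> free_nilpotent_lie d n \<Longrightarrow>
    (\<lambda>w. x w + y w) \<in> free_nilpotent_lie d n"
| scale: "x \<in> free_nilpotent_lie d n \<Longrightarrow> (\<lambda>w. c * x w) \<in> free_nilpotent_lie d n"
| bracket: "x \<in> free_nilpotent_lie d n \<Longrightarrow> y \<in> free_nilpotent_lie d n \<Longrightarrow>
    (\<lambda>w. trunc_mult n x y w - trunc_mult n y x w) \<in> free_nilpotent_lie d n"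

(* Stopping the sum at n loses nothing: elements of the Lie algebra have no constant term,
   so their powers beyond the n-th vanish in the truncated algebra. *)
definition trunc_exp :: "nat \<Rightarrow> tensor \<Rightarrow> tensor" where
  "trunc_exp n x = (\<lambda>w. \<Sum>k\<le>n. (trunc_mult n x ^^ k) tensor_one w / fact k)"

definition free_nilpotent_group :: "nat \<Rightarrow> nat \<Rightarrow> tensor set" where
  "free_nilpotent_group d n = trunc_exp n ` free_nilpotent_lie d n"

definition int_part :: "real \<Rightarrow> nat" where
  "int_part p = nat \<lfloor>p\<rfloor>"

definition beta_p :: "real \<Rightarrow> real" where
  "beta_p p = p / (1 - 2 powr (1 - (real (int_part p) + 1) / p))"

definition group_norm :: "nat \<Rightarrow> real \<Rightarrow> tensor \<Rightarrow> real" where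
  "group_norm d p g =
     Max ((\<lambda>i. (beta_p p * gfact (real i / p) * level_norm d i g) powr (1 / real i)) ` {1..int_part p})"

(* s = u 0 < ... < u k = t; values of u beyond k are irrelevant, and k = 0 iff s = t *)
definition is_partition :: "real \<Rightarrow> real \<Rightarrow> nat \<Rightarrow> (nat \<Rightarrow> real) \<Rightarrow> bool" where
  "is_partition s t k u \<longleftrightarrow> u 0 = s \<and> u k = t \<and> (\<forall>i<k. u i < u (Suc i))"

definition partition_sums :: "(real \<Rightarrow> real \<Rightarrow> real) \<Rightarrow> real \<Rightarrow> real \<Rightarrow> real set" where
  "partition_sums f s t = {\<Sum>i<k. f (u i) (u (Suc i)) | k u. is_partition s t k u}"

type_synonym tensor_path = "real \<Rightarrow> real \<Rightarrow> tensor"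

definition time_simplex :: "real \<Rightarrow> (real \<times> real) set" where
  "time_simplex T = {(s, t). 0 \<le> s \<and> s \<le> t \<and> t \<le> T}"

definition continuous_tensor_path :: "real \<Rightarrow> tensor_path \<Rightarrow> bool" where
  "continuous_tensor_path T X \<longleftrightarrow> (\<forall>w. continuous_on (time_simplex T) (\<lambda>(s, t). X s t w))"

(* The supremum is only meaningful for finite p-variation, which is part of rough_path. *)
definition omega_p :: "nat \<Rightarrow> real \<Rightarrow> tensor_path \<Rightarrow> real \<Rightarrow> real \<Rightarrow> real" where
  "omega_p d p X s t = Sup (partition_sums (\<lambda>u v. group_norm d p (X u v) powr p) s t)"

definition rough_path :: "nat \<Rightarrow> real \<Rightarrow> real \<Rightarrow> tensor_path \<Rightarrow> bool" where
  "rough_path d p T X \<longleftrightarrow>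
     (\<forall>(s, t) \<in> time_simplex T. X s t \<in> free_nilpotent_group d (int_part p)) \<and>
     continuous_tensor_path T X \<and>
     (\<forall>s u t. 0 \<le> s \<and> s \<le> u \<and> u \<le> t \<and> t \<le> T \<longrightarrow>
        trunc_mult (int_part p) (X s u) (X u t) = X s t) \<and>
     bdd_above (partition_sums (\<lambda>u v. group_norm d p (X u v) powr p) 0 T)"

(* Finite p-variation in the full tensor algebra is understood level by level, the n-th level
   having finite (p/n)-variation.  Continuity belongs to the notion of a multiplicative
   functional; without it the extension would not be unique.  The last clause only fixes the
   values at irrelevant pairs of times, so that the extension is unique as a function. *)
definition lyons_extension :: "nat \<Rightarrow> real \<Rightarrow> real \<Rightarrow> tensor_path \<Rightarrow> tensor_path \<Rightarrow> bool" where
  "lyons_extension d p T X S \<longleftrightarrow>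
     (\<forall>(s, t) \<in> time_simplex T. S s t \<in> tensor_series d) \<and>
     (\<forall>(s, t) \<in> time_simplex T. \<forall>w. length w \<le> int_part p \<longrightarrow> S s t w = X s t w) \<and>
     continuous_tensor_path T S \<and>
     (\<forall>s u t. 0 \<le> s \<and> s \<le> u \<and> u \<le> t \<and> t \<le> T \<longrightarrow> tensor_mult (S s u) (S u t) = S s t) \<and>
     (\<forall>n\<ge>1. bdd_above (partition_sums (\<lambda>u v. level_norm d n (S u v) powr (p / real n)) 0 T)) \<and>
     (\<forall>s t. (s, t) \<notin> time_simplex T \<longrightarrow> S s t = (\<lambda>w. 0))"

definition path_signature :: "nat \<Rightarrow> real \<Rightarrow> real \<Rightarrow> tensor_path \<Rightarrow> tensor_path" where
  "path_signature d p T X = (THE S. lyons_extension d p T X S)"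

definition euclid_norm :: "real vec \<Rightarrow> real" where
  "euclid_norm v = L2_set (vec_index v) {..<dim_vec v}"

(* A in L(R^d, L(R^e,R^e)) is given by the matrices A i = A(e_i), i < d. *)
definition linear_fields :: "nat \<Rightarrow> nat \<Rightarrow> (nat \<Rightarrow> real mat) set" where
  "linear_fields d e = {A. \<forall>i<d. A i \<in> carrier_mat e e}"

definition frobenius_norm :: "nat \<Rightarrow> nat \<Rightarrow> (nat \<Rightarrow> real mat) \<Rightarrow> real" where
  "frobenius_norm d e A = L2_set (\<lambda>(i, a, b). A i $$ (a, b)) ({..<d} \<times> {..<e} \<times> {..<e})"

(* A(x_n) ... A(x_1) y for the word w = [x_1, ..., x_n] *)
definition word_action :: "(nat \<Rightarrow> real mat) \<Rightarrow> nat list \<Rightarrow> real vec \<Rightarrow> real vec" where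
  "word_action A w y = fold (\<lambda>i v. mult_mat_vec (A i) v) w y"

(* A^{\<otimes>n} y S, where S enters through its level n only *)
definition tensor_action ::
  "nat \<Rightarrow> nat \<Rightarrow> (nat \<Rightarrow> real mat) \<Rightarrow> nat \<Rightarrow> real vec \<Rightarrow> tensor \<Rightarrow> real vec" where
  "tensor_action d e A n y S =
     Matrix.vec e (\<lambda>a. \<Sum>w\<in>words d n. S w * vec_index (word_action A w y) a)"

definition solution_map ::
  "nat \<Rightarrow> nat \<Rightarrow> real \<Rightarrow> real \<Rightarrow> tensor_path \<Rightarrow> (nat \<Rightarrow> real mat) \<Rightarrow> real \<Rightarrow> real \<Rightarrow> real vec \<Rightarrow> real vec" where
  "solution_map d e p T X A s t y =
     Matrix.vec e (\<lambda>a. \<Sum>n. vec_index (tensor_action d e A n y (path_signature d p T X s t)) a)"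

definition euler_step ::
  "nat \<Rightarrow> nat \<Rightarrow> real \<Rightarrow> real \<Rightarrow> tensor_path \<Rightarrow> (nat \<Rightarrow> real mat) \<Rightarrow> nat \<Rightarrow> real \<Rightarrow> real \<Rightarrow> real vec \<Rightarrow> real vec" where
  "euler_step d e p T X A N s t y =
     Matrix.vec e (\<lambda>a. \<Sum>n\<le>N. vec_index (tensor_action d e A n y (path_signature d p T X s t)) a)"

definition euler_scheme ::
  "nat \<Rightarrow> nat \<Rightarrow> real \<Rightarrow> real \<Rightarrow> tensor_path \<Rightarrow> (nat \<Rightarrow> real mat) \<Rightarrow> nat \<Rightarrow> nat \<Rightarrow> (nat \<Rightarrow> real) \<Rightarrow> real vec \<Rightarrow> real vec" where
  "euler_scheme d e p T X A N m u y =
     fold (\<lambda>i v. euler_step d e p T X A N (u i) (u (Suc i)) v) [0..<m] y"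

definition operator_norm :: "nat \<Rightarrow> (real vec \<Rightarrow> real vec) \<Rightarrow> real" where
  "operator_norm e L = (SUP y\<in>{y \<in> carrier_vec e. euclid_norm y \<le> 1}. euclid_norm (L y))"

end

theory Submission
  imports Defs "HOL-Library.Sublist"
begin

text \<open>
The theorem combines a factorial bound for the signature with a Gronwall argument for the scheme; write
\<open>\<omega>\<close> for the control \<open>omega_p d p X\<close> and \<open>S\<close> for the signature.

The function \<open>\<omega>\<close> is superadditive, and it is continuous in its endpoint because the group norm is
continuous along the path (\<open>continuous_var\<close>). So intervals can be split into parts with equal control, which
yields the partition of the theorem and bisections in the estimates.

On level \<open>n > int_part p\<close>, Chen's identity says that \<open>S\<close> is additive up to products of lower levels, and these
are of order \<open>\<omega>(s,t) powr (n / p)\<close> with \<open>n / p > 1\<close>. The sewing lemma therefore constructs the level from the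
lower ones; it is unique, since a continuous additive function of finite \<open>q\<close>-variation with \<open>q < 1\<close> vanishes.
The sharp bound comes from splitting \<open>[s, t]\<close> at a point that halves \<open>\<omega>\<close>: constants \<open>c n\<close> with
\<open>\<Sum>j=1..<n. c j * c (n - j) \<le> (2 powr (n / p) - 2) * c n\<close> are inherited from the lower levels
(\<open>bound_by_bisection\<close>, \<open>factorial_decay\<close>). The choice \<open>c n = 1 / (beta_p p * gfact (n / p))\<close> is usually
justified by the neo-classical inequality with its optimal constant \<open>p\<close>. With an additional weight \<open>1 / (2 + n / p)\<close>
(\<open>level_const\<close>) it is enough to estimate every summand by the central one, and log-convexity of the Gamma
function and the duplication formula suffice (\<open>level_const_convolution\<close>).

The solution map is a matrix-valued power series, and Chen's identity with the Cauchy product gives the flow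
property. By comparison with the exponential series its norm is at most \<open>M = growth_const p * exp (r powr p * \<omega>(0,T))\<close>
on every subinterval of \<open>[0, T]\<close>. On each interval of the partition, a step of the scheme differs from the
solution map by at most the tail \<open>l\<close> of the series at \<open>\<omega>(0,T) / m\<close>. Telescoping the difference of the
products, with the exact flow after and the scheme before each local error, gives the bound
\<open>M\<^sup>2 * (m * l) * exp (M * (m * l))\<close> (\<open>global_error\<close>), the scheme being controlled by a discrete Gronwall inequality.
The two factors \<open>M\<close> account for \<open>exp (2 * r powr p * \<omega>(0,T))\<close>. Finally, as \<open>p < N + 1\<close>, \<open>m * l\<close> tends to zero and the tail
is asymptotic to its first term both for \<open>N \<rightarrow> \<infinity>\<close> and for \<open>m \<rightarrow> \<infinity>\<close>, so the last exponential and the ratio of tail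
and first term tend to one.
\<close>

section \<open>Gamma function estimates and the signature constants\<close>

lemma Gamma_midpoint_le:
  fixes a b :: real
  assumes "a > 0" "b > 0"
  shows "(Gamma ((a + b) / 2))\<^sup>2 \<le> Gamma a * Gamma b"
proof -
  have "(ln \<circ> Gamma) ((1 - 1/2) *\<^sub>R a + (1/2) *\<^sub>R b) \<le> (1 - 1/2) * (ln \<circ> Gamma) a + 1/2 * (ln \<circ> Gamma) b"
    using convex_onD[OF log_convex_Gamma_real, of "1/2" a b] assms by simp
  hence "2 * ln (Gamma ((a + b) / 2)) \<le> ln (Gamma a) + ln (Gamma b)"
    by (simp add: field_simps)
  hence "ln ((Gamma ((a + b) / 2))\<^sup>2) \<le> ln (Gamma a * Gamma b)"
    using Gamma_real_pos[OF assms(1), THEN less_imp_neq] Gamma_real_pos[OF assms(2), THEN less_imp_neq]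
    by (simp add: ln_mult ln_realpow)
  thus ?thesis
  proof (subst (asm) ln_le_cancel_iff)
    show "0 < (Gamma ((a + b) / 2))\<^sup>2" using assms by (intro zero_less_power Gamma_real_pos) auto
  qed (use assms in auto)
qed

lemma Gamma_plus_one_real: "z > 0 \<Longrightarrow> Gamma (z + 1) = z * Gamma (z::real)"
  by (rule Gamma_plus1) (auto elim!: nonpos_Ints_cases)

lemma Gamma_mono_real:
  assumes "2 \<le> x" "x \<le> y"
  shows "Gamma x \<le> Gamma (y::real)"
  using Gamma_real_strict_mono[of x y] assms by (cases "x = y") auto

text \<open>The central binomial coefficient with real upper argument \<open>x\<close>, normalised by \<open>2 powr x\<close>. By Legendre's
duplication formula it equals \<open>Gamma ((x + 1) / 2) / (sqrt pi * Gamma (x / 2 + 1))\<close>, and log-convexity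
bounds this quotient.\<close>
lemma central_Gamma_ratio_le:
  fixes x :: real
  assumes x: "x > 0"
  shows "Gamma (x + 1) / (2 powr x * (Gamma (x / 2 + 1))\<^sup>2) \<le> sqrt (2 * (x + 2) / pi) / (x + 1)"
proof -
  define z where "z = (x + 1) / 2"
  have z: "z > 0" using x by (simp add: z_def)
  have dup: "Gamma z * Gamma (z + 1/2) = exp ((1 - 2*z) * ln 2) * sqrt pi * Gamma (2 * z)"
  proof -
    have "z \<notin> \<int>\<^sub>\<le>\<^sub>0" "z + 1/2 \<notin> \<int>\<^sub>\<le>\<^sub>0" using z by (auto elim!: nonpos_Ints_cases)
    hence "complex_of_real z \<notin> \<int>\<^sub>\<le>\<^sub>0" "complex_of_real (z + 1/2) \<notin> \<int>\<^sub>\<le>\<^sub>0"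
      by (simp_all only: of_real_in_nonpos_Ints_iff not_False_eq_True)
    hence "complex_of_real (Gamma z * Gamma (z + 1/2))
        = complex_of_real (exp ((1 - 2*z) * ln 2) * sqrt pi * Gamma (2 * z))"
      using Gamma_legendre_duplication[of "complex_of_real z"]
      by (simp add: Gamma_complex_of_real[symmetric] exp_of_real[symmetric])
    thus ?thesis by (simp only: of_real_eq_iff)
  qed
  have z2: "z + 1/2 = x / 2 + 1" "2 * z = x + 1" by (auto simp: z_def field_simps)
  have e: "exp ((1 - (x + 1)) * ln 2) = 1 / 2 powr x"
    by (simp add: powr_def exp_minus field_simps)
  have G: "Gamma (x / 2 + 1) > 0" using x by (intro Gamma_real_pos) auto
  have dup': "Gamma z * Gamma (x / 2 + 1) = Gamma (x + 1) * sqrt pi / 2 powr x"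
    using dup unfolding z2 e by simp
  hence eq: "Gamma (x + 1) / (2 powr x * (Gamma (x / 2 + 1))\<^sup>2) = Gamma z / (sqrt pi * Gamma (x / 2 + 1))"
    using G by (simp add: field_simps power2_eq_square)
  have "(Gamma (z + 1))\<^sup>2 \<le> Gamma (z + 1/2) * Gamma (z + 3/2)"
  proof -
    have "(z + 1/2 + (z + 3/2)) / 2 = z + 1" by (simp add: field_simps)
    thus ?thesis using Gamma_midpoint_le[of "z + 1/2" "z + 3/2"] z by (simp only: add_pos_pos zero_less_divide_1_iff zero_less_numeral zero_less_divide_iff)
  qed
  moreover have "Gamma (z + 3/2) = (z + 1/2) * Gamma (z + 1/2)"
    using Gamma_plus_one_real[of "z + 1/2"] z by (simp add: algebra_simps)
  moreover have "Gamma (z + 1) = z * Gamma z" using Gamma_plus_one_real z by blast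
  ultimately have "(z * Gamma z)\<^sup>2 \<le> (z + 1/2) * (Gamma (x / 2 + 1))\<^sup>2"
    unfolding z2 by (simp add: power2_eq_square mult_ac)
  hence "sqrt ((z * Gamma z)\<^sup>2) \<le> sqrt ((x / 2 + 1) * (Gamma (x / 2 + 1))\<^sup>2)"
    unfolding z2 by (rule real_sqrt_le_mono)
  hence "z * Gamma z \<le> sqrt (x / 2 + 1) * Gamma (x / 2 + 1)"
    using z G Gamma_real_pos[OF z] by (simp add: real_sqrt_mult)
  hence "Gamma z \<le> sqrt (x / 2 + 1) * Gamma (x / 2 + 1) / z"
    using z by (simp add: field_simps)
  hence "Gamma z / (sqrt pi * Gamma (x / 2 + 1)) \<le> sqrt (x / 2 + 1) * Gamma (x / 2 + 1) / z / (sqrt pi * Gamma (x / 2 + 1))"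
    using G by (intro divide_right_mono) auto
  also have "\<dots> = sqrt (x / 2 + 1) / (z * sqrt pi)" using G by (simp add: field_simps)
  also have "\<dots> = (2 * sqrt (x / 2 + 1)) / sqrt pi / (x + 1)"
    using x unfolding z_def by (simp add: field_simps)
  also have "2 * sqrt (x / 2 + 1) = sqrt (2 * (x + 2))"
  proof -
    have "2 * sqrt (x / 2 + 1) = sqrt 4 * sqrt (x / 2 + 1)" by simp
    also have "\<dots> = sqrt (4 * (x / 2 + 1))" by (rule real_sqrt_mult[symmetric])
    finally show ?thesis by (simp add: algebra_simps)
  qed
  finally show ?thesis unfolding eq by (simp add: real_sqrt_divide)
qed

text \<open>In a convolution of the constants \<open>level_const\<close> below, the central summand is the largest one.\<close>
lemma weighted_Gamma_product_ge:
  fixes x y :: real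
  assumes "0 \<le> y" "y \<le> x"
  shows "(2 + x / 2)\<^sup>2 * (Gamma (x / 2 + 1))\<^sup>2
      \<le> ((2 + y) * Gamma (y + 1)) * ((2 + (x - y)) * Gamma (x - y + 1))"
proof -
  define P where "P = y * (x - y)"
  have P: "0 \<le> P" "P \<le> (x / 2)\<^sup>2"
  proof -
    have "(x / 2)\<^sup>2 - P = (y - x / 2)\<^sup>2" by (simp add: P_def power2_eq_square algebra_simps)
    thus "P \<le> (x / 2)\<^sup>2" by (smt (verit) zero_le_power2)
  qed (use assms in \<open>simp add: P_def\<close>)
  have prod: "(1 + y) * (1 + (x - y)) = 1 + x + P" "(2 + y) * (2 + (x - y)) = 4 + 2 * x + P"
    by (auto simp: P_def algebra_simps)
  have x: "x \<ge> 0" using assms by simp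
  have "(Gamma (x / 2 + 2))\<^sup>2 \<le> Gamma (y + 2) * Gamma (x - y + 2)"
    using Gamma_midpoint_le[of "y + 2" "x - y + 2"] assms by (simp add: field_simps)
  moreover have "Gamma (x / 2 + 2) = (x / 2 + 1) * Gamma (x / 2 + 1)"
    "Gamma (y + 2) = (y + 1) * Gamma (y + 1)" "Gamma (x - y + 2) = (x - y + 1) * Gamma (x - y + 1)"
    using Gamma_plus_one_real[of "x / 2 + 1"] Gamma_plus_one_real[of "y + 1"]
      Gamma_plus_one_real[of "x - y + 1"] assms by (auto simp: add.commute add.left_commute)
  ultimately have 1: "(x / 2 + 1)\<^sup>2 * (Gamma (x / 2 + 1))\<^sup>2
      \<le> (1 + x + P) * (Gamma (y + 1) * Gamma (x - y + 1))"
    unfolding prod(1)[symmetric] by (simp add: power_mult_distrib mult_ac add_ac)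
  have "(1 + x + P) * (2 + x / 2)\<^sup>2 \<le> (4 + 2 * x + P) * (x / 2 + 1)\<^sup>2"
  proof -
    have "(4 + 2 * x + P) * (x / 2 + 1)\<^sup>2 - (1 + x + P) * (2 + x / 2)\<^sup>2 = (3 + x) * ((x / 2)\<^sup>2 - P)"
      by (simp add: power2_eq_square field_simps)
    also have "\<dots> \<ge> 0" using P x by simp
    finally show ?thesis by simp
  qed
  hence "(1 + x + P) * (2 + x / 2)\<^sup>2 * (Gamma (y + 1) * Gamma (x - y + 1))
      \<le> (4 + 2 * x + P) * (x / 2 + 1)\<^sup>2 * (Gamma (y + 1) * Gamma (x - y + 1))"
    using assms by (intro mult_right_mono mult_nonneg_nonneg Gamma_real_nonneg) auto
  moreover have "(2 + x / 2)\<^sup>2 * ((x / 2 + 1)\<^sup>2 * (Gamma (x / 2 + 1))\<^sup>2)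
      \<le> (2 + x / 2)\<^sup>2 * ((1 + x + P) * (Gamma (y + 1) * Gamma (x - y + 1)))"
    using 1 by (intro mult_left_mono) auto
  ultimately have "(x / 2 + 1)\<^sup>2 * ((2 + x / 2)\<^sup>2 * (Gamma (x / 2 + 1))\<^sup>2)
     \<le> (x / 2 + 1)\<^sup>2 * ((4 + 2 * x + P) * (Gamma (y + 1) * Gamma (x - y + 1)))"
    by (simp add: mult_ac)
  hence "(2 + x / 2)\<^sup>2 * (Gamma (x / 2 + 1))\<^sup>2 \<le> (4 + 2 * x + P) * (Gamma (y + 1) * Gamma (x - y + 1))"
    using x by (subst (asm) mult_le_cancel_left_pos) auto
  thus ?thesis unfolding prod(2)[symmetric] by (simp add: mult_ac)
qed

text \<open>The elementary inequality to which the stability of the constants reduces. It is rather tight for small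
\<open>k\<close>, so the cases \<open>k \<le> 3\<close> are treated separately, each by expanding the difference of the two sides in
powers of \<open>x - 1\<close>: all coefficients are nonnegative. Only \<open>3.14 \<le> pi\<close> is used.\<close>
lemma rational_bound_aux:
  fixes x a :: real and k :: nat
  assumes x: "1 < x" "x \<le> 1 + (real k + 1) * a" and a: "0 < a" "a \<le> 1"
  shows "288 * (x - a)\<^sup>2 * (x + 2) ^ 3 \<le> (2 - 1 / 2 ^ k)\<^sup>2 * pi * (x + 4) ^ 4 * (x + 1)\<^sup>2"
proof -
  define h where "h = x - 1"
  have h: "h > 0" "x = h + 1" using x by (auto simp: h_def)
  have pi: "pi \<ge> 3.14" using pi_approx by simp
  have xa: "x - a \<le> (real k * x + 1) / (real k + 1)"
    using x a by (simp add: field_simps)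
  have xa0: "x - a \<ge> 0" using x a by simp
  have *: ?thesis if c: "0 \<le> c" "c \<le> (2 - 1 / 2 ^ k)\<^sup>2"
     and u: "x - a \<le> u" and b: "288 * u\<^sup>2 * (x + 2) ^ 3 \<le> c * 3.14 * (x + 4) ^ 4 * (x + 1)\<^sup>2" for c u
  proof -
    have "288 * (x - a)\<^sup>2 * (x + 2) ^ 3 \<le> 288 * u\<^sup>2 * (x + 2) ^ 3"
      using u xa0 x by (intro mult_right_mono mult_left_mono power_mono) auto
    also note b
    also have "c * 3.14 * (x + 4) ^ 4 * (x + 1)\<^sup>2 \<le> (2 - 1 / 2 ^ k)\<^sup>2 * pi * (x + 4) ^ 4 * (x + 1)\<^sup>2"
      using c pi by (intro mult_right_mono mult_mono) auto
    finally show ?thesis .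
  qed
  consider "k = 0" | "k = 1" | "k = 2" | "k = 3" | "k \<ge> 4" by linarith
  thus ?thesis
  proof cases
    case 1
    have "1 * 3.14 * (x + 4) ^ 4 * (x + 1)\<^sup>2 - 288 * 1\<^sup>2 * (x + 2) ^ 3
        = 74 + 6354 * h + 15069 / 2 * h ^ 2 + 17086 / 5 * h ^ 3 + 18369 / 25 * h ^ 4 + 1884 / 25 * h ^ 5
          + 157 / 50 * h ^ 6"
      unfolding h(2) by (simp add: eval_nat_numeral field_simps)
    also have "\<dots> \<ge> 0" using h by (intro add_nonneg_nonneg) auto
    finally show ?thesis
      using 1 xa by (intro *[of 1 1]) auto
  next
    case 2
    have "9/4 * 3.14 * (x + 4) ^ 4 * (x + 1)\<^sup>2 - 288 * ((x + 1) / 2)\<^sup>2 * (x + 2) ^ 3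
        = 19773 / 2 + 32481 / 2 * h ^ 1 + 83781 / 8 * h ^ 2 + 35127 / 10 * h ^ 3 + 71721 / 100 * h ^ 4 + 2439 / 25 * h ^ 5 + 1413 / 200 * h ^ 6"
      unfolding h(2) by (simp add: eval_nat_numeral field_simps)
    also have "\<dots> \<ge> 0" using h by (intro add_nonneg_nonneg) auto
    finally show ?thesis
      using 2 xa by (intro *[of "9/4" "(x + 1) / 2"]) (auto simp: power2_eq_square)
  next
    case 3
    have "49/16 * 3.14 * (x + 4) ^ 4 * (x + 1)\<^sup>2 - 288 * ((2 * x + 1) / 3)\<^sup>2 * (x + 2) ^ 3
        = 130117 / 8 + 201033 / 8 * h ^ 1 + 467085 / 32 * h ^ 2 + 165887 / 40 * h ^ 3 + 285681 / 400 * h ^ 4 + 10279 / 100 * h ^ 5 + 7693 / 800 * h ^ 6"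
      unfolding h(2) by (simp add: eval_nat_numeral field_simps)
    also have "\<dots> \<ge> 0" using h by (intro add_nonneg_nonneg) auto
    finally show ?thesis
      using 3 xa by (intro *[of "49/16" "(2 * x + 1) / 3"]) (auto simp: power2_eq_square)
  next
    case 4
    have "225/64 * 3.14 * (x + 4) ^ 4 * (x + 1)\<^sup>2 - 288 * ((3 * x + 1) / 4)\<^sup>2 * (x + 2) ^ 3
        = 634293 / 32 + 967545 / 32 * h ^ 1 + 2172285 / 128 * h ^ 2 + 143235 / 32 * h ^ 3 + 44361 / 64 * h ^ 4 + 1647 / 16 * h ^ 5 + 1413 / 128 * h ^ 6"
      unfolding h(2) by (simp add: eval_nat_numeral field_simps)
    also have "\<dots> \<ge> 0" using h by (intro add_nonneg_nonneg) auto
    finally show ?thesis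
      using 4 xa by (intro *[of "225/64" "(3 * x + 1) / 4"]) (auto simp: power2_eq_square)
  next
    case 5
    have "(2 - 1 / 2 ^ k)\<^sup>2 \<ge> (2 - 1 / 2 ^ 4 :: real)\<^sup>2"
      using 5 by (intro power_mono diff_left_mono divide_left_mono power_increasing) auto
    hence c: "(961 / 256 :: real) \<le> (2 - 1 / 2 ^ k)\<^sup>2" by (simp add: power2_eq_square)
    \<comment> \<open>As \<open>x * (x + 2) \<le> (x + 1)\<^sup>2\<close>, a quartic inequality is enough; in \<open>y = x + 4\<close> the difference of its
  sides is a multiple of a square plus terms that are nonnegative for \<open>y \<ge> 5\<close>.\<close>
    have q: "288 * x * (x + 2)\<^sup>2 \<le> 961 / 256 * 3.14 * (x + 4) ^ 4"
    proof -
      define y where "y = x + 4"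
      have y: "y > 5" "x = y - 4" using x by (auto simp: y_def)
      have "0 \<le> (0.2023 * y\<^sup>2 - 2.4716 * y + 4.67)\<^sup>2" by simp
      moreover have "961 / 256 * 3.14 * (x + 4) ^ 4 - 288 * x * (x + 2)\<^sup>2
          = 288 * (0.2023 * y\<^sup>2 - 2.4716 * y + 4.67)\<^sup>2
            + (156421 / 200000000 * y ^ 4 + 1053 / 390625 * y ^ 3 + 192537 / 390625 * y ^ 2) + (13881348 / 15625 * y - 1045602 / 625)"
        unfolding y(2) by (simp add: eval_nat_numeral field_simps)
      moreover have "156421 / 200000000 * y ^ 4 + 1053 / 390625 * y ^ 3 + 192537 / 390625 * y ^ 2 \<ge> 0"
        using y by (intro add_nonneg_nonneg) auto
      moreover have "13881348 / 15625 * y - 1045602 / 625 \<ge> 0" using y by simp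
      ultimately show ?thesis by linarith
    qed
    have "288 * x\<^sup>2 * (x + 2) ^ 3 = (x * (x + 2)) * (288 * x * (x + 2)\<^sup>2)"
      by (simp add: power2_eq_square power3_eq_cube)
    also have "\<dots> \<le> (x + 1)\<^sup>2 * (961 / 256 * 3.14 * (x + 4) ^ 4)"
      using x by (intro mult_mono q) (auto simp: power2_eq_square algebra_simps)
    finally show ?thesis using c a by (intro *[of "961/256" x]) (auto simp: mult_ac)
  qed
qed


text \<open>The constant in the bound \<open>level_norm d n (S s t) \<le> level_const p n * omega_p d p X s t powr (n / p)\<close> for
the signature. It is at most \<open>3 / 2\<close> times \<open>1 / (beta_p p * gfact (n / p))\<close>, and on the levels up to
\<open>int_part p\<close> it is at least that quantity. The weight \<open>1 / (2 + n / p)\<close> decays so slowly that it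
costs only a constant factor on these levels, while it makes the convolution of the constants much smaller
at high levels.\<close>
definition level_const :: "real \<Rightarrow> nat \<Rightarrow> real" where
  "level_const p n = 3 / beta_p p / ((2 + real n / p) * gfact (real n / p))"

lemma gfact_pos: "x > -1 \<Longrightarrow> gfact x > 0"
  unfolding gfact_def by (rule Gamma_real_pos) auto

lemma int_part_bounds:
  assumes "1 \<le> p"
  shows "real (int_part p) \<le> p" "p < real (int_part p) + 1" "int_part p \<ge> 1"
  using assms unfolding int_part_def by (auto simp: nat_le_iff le_nat_iff le_floor_iff)

lemma beta_p_pos:
  assumes p: "1 \<le> p"
  shows "beta_p p > 0"
proof -
  have "2 powr (1 - (real (int_part p) + 1) / p) < 2 powr 0"
    using int_part_bounds[OF p] p by (intro powr_less_mono) (auto simp: field_simps)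
  thus ?thesis unfolding beta_p_def using p by simp
qed

lemma level_const_pos:
  assumes p: "1 \<le> p"
  shows "level_const p n > 0"
  unfolding level_const_def using beta_p_pos[OF p] p gfact_pos[of "real n / p"]
  by (intro divide_pos_pos mult_pos_pos add_pos_nonneg) (auto simp: add_pos_nonneg less_le_trans[of "-1" 0])

text \<open>A lower bound for the ratio \<open>(1 - 2 powr (1 - x)) / (1 - 2 powr (- d))\<close> with \<open>x = 1 + d + k * a\<close>: it
dominates the geometric sum of the powers of \<open>1 / 2\<close> up to exponent \<open>k\<close>.\<close>
lemma geometric_gap_ge:
  fixes a d :: real
  assumes "0 < d" "d \<le> a" "a \<le> 1"
  shows "(1 - 2 powr (- d)) * (2 - 1 / 2 ^ k) \<le> 1 - 2 powr (- (d + real k * a))"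
proof (induction k)
  case (Suc k)
  have half: "1 / 2 ^ Suc k \<le> 2 powr (- (d + real k * a))"
  proof -
    have "(d + real k * a) \<le> 1 + real k * 1"
      using assms by (intro add_mono mult_left_mono) auto
    hence "2 powr (- real (Suc k)) \<le> 2 powr (- (d + real k * a))"
      by (intro powr_mono) auto
    moreover have "2 powr (- real (Suc k)) = 1 / 2 ^ Suc k"
      by (simp only: powr_minus powr_realpow[of 2] zero_less_numeral inverse_eq_divide)
    ultimately show ?thesis by linarith
  qed
  have "2 powr (- a) \<le> 2 powr (- d)" "2 powr (- d) \<le> 1"
    using assms powr_mono[of "- d" 0 2] by (auto intro: powr_mono)
  hence gap: "0 \<le> 1 - 2 powr (- d)" "1 - 2 powr (- d) \<le> 1 - 2 powr (- a)" "0 \<le> 1 - 2 powr (- a)"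
    by linarith+
  have "(1 - 2 powr (- d)) * (2 - 1 / 2 ^ Suc k)
      = (1 - 2 powr (- d)) * (2 - 1 / 2 ^ k) + (1 - 2 powr (- d)) * (1 / 2 ^ Suc k)"
    by (simp add: field_simps)
  also have "\<dots> \<le> (1 - 2 powr (- (d + real k * a))) + (1 - 2 powr (- a)) * 2 powr (- (d + real k * a))"
    using gap half by (intro add_mono Suc.IH mult_mono) auto
  also have "\<dots> = 1 - 2 powr (- a) * 2 powr (- (d + real k * a))" by (simp add: algebra_simps)
  also have "2 powr (- a) * 2 powr (- (d + real k * a)) = 2 powr (- (d + real (Suc k) * a))"
    by (simp add: powr_add[symmetric] algebra_simps)
  finally show ?case .
qed simp

text \<open>The constants reproduce themselves when an interval is split into two halves with respect to the
control: this replaces the neo-classical inequality, of which it is a crude form at the midpoint only. Each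
of the \<open>n - 1\<close> summands is estimated by the central one. The factor \<open>1 - 2 powr (1 - (int_part p + 1) / p)\<close>
contained in \<open>1 / beta_p p\<close> compensates for the small gap \<open>2 powr x - 2\<close> at the first level above \<open>int_part p\<close>.\<close>
lemma level_const_convolution:
  assumes p: "1 \<le> p" and n: "n > int_part p"
  shows "(\<Sum>j=1..<n. level_const p j * level_const p (n - j))
       \<le> (2 powr (real n / p) - 2) * level_const p n"
proof -
  define a d k x where "a = 1 / p" and "d = (real (int_part p) + 1) / p - 1"
    and "k = n - (int_part p + 1)" and "x = real n / p"
  note ip = int_part_bounds[OF p]
  have a: "0 < a" "a \<le> 1" using p by (auto simp: a_def)
  have d: "0 < d" "d \<le> a" using p ip by (auto simp: d_def a_def field_simps)
  have xk: "x = 1 + d + real k * a"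
    using n p by (simp add: x_def d_def k_def a_def of_nat_diff field_simps)
  have x1: "1 < x" using n p ip by (simp add: x_def field_simps)
  have x2: "x \<le> 1 + (real k + 1) * a" using d xk by (simp add: algebra_simps)
  define K where "K = 1 / beta_p p"
  have K: "K = a * (1 - 2 powr (- d))"
    unfolding K_def beta_p_def a_def d_def by (simp add: field_simps)
  have Kpos: "K > 0" using beta_p_pos[OF p] by (simp add: K_def)
  have lc: "level_const p j = 3 * K / ((2 + real j / p) * Gamma (real j / p + 1))" for j
    unfolding level_const_def gfact_def K_def by simp
  define G where "G = (2 + x / 2)\<^sup>2 * (Gamma (x / 2 + 1))\<^sup>2"
  have Gpos: "Gamma (x / 2 + 1) > 0" "Gamma (x + 1) > 0" using x1 by auto
  hence G: "G > 0" unfolding G_def using x1 by (intro mult_pos_pos zero_less_power) auto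
  have na: "real (n - 1) * a = x - a"
    using n by (simp add: a_def x_def of_nat_diff diff_divide_distrib)
  have "(\<Sum>j=1..<n. level_const p j * level_const p (n - j)) \<le> (\<Sum>j=1..<n. 9 * K\<^sup>2 / G)"
  proof (rule sum_mono)
    fix j assume j: "j \<in> {1..<n}"
    define y where "y = real j / p"
    have y: "0 \<le> y" "y \<le> x" "real (n - j) / p = x - y"
      using j p by (auto simp: y_def x_def of_nat_diff diff_divide_distrib divide_right_mono)
    have "level_const p j * level_const p (n - j)
        = 9 * K\<^sup>2 / (((2 + y) * Gamma (y + 1)) * ((2 + (x - y)) * Gamma (x - y + 1)))"
      unfolding lc y y_def[symmetric] by (simp add: power2_eq_square)
    also have "\<dots> \<le> 9 * K\<^sup>2 / G"
      using weighted_Gamma_product_ge[OF y(1,2)] G unfolding G_def[symmetric]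
      by (intro divide_left_mono) auto
    finally show "level_const p j * level_const p (n - j) \<le> 9 * K\<^sup>2 / G" .
  qed
  also have "\<dots> = 9 * K * ((real (n - 1) * a) * (1 - 2 powr (- d))) / G"
    using n by (simp add: K power2_eq_square mult_ac)
  also have "\<dots> = 9 * K * ((x - a) * (1 - 2 powr (- d))) / G" unfolding na ..
  finally have 1: "(\<Sum>j=1..<n. level_const p j * level_const p (n - j))
      \<le> 9 * K * ((x - a) * (1 - 2 powr (- d))) / G" .
  define m where "m = Gamma (x + 1) / (2 powr x * (Gamma (x / 2 + 1))\<^sup>2)"
  have m: "m \<le> sqrt (2 * (x + 2) / pi) / (x + 1)" "m > 0"
    unfolding m_def using central_Gamma_ratio_le[of x] x1
    by (auto intro!: divide_pos_pos mult_pos_pos zero_less_power Gpos simp del: zero_less_power_eq_numeral power_eq_0_iff)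
  have xa: "x - a \<ge> 0" using x1 a by simp
  define A where "A = (x - a) * (12 * (x + 2) / (x + 4)\<^sup>2)"
  have A0: "A \<ge> 0" using xa x1 by (auto simp: A_def)
  have "A * m \<le> 2 - 1 / 2 ^ k"
  proof (rule power2_le_imp_le)
    have "(A * m)\<^sup>2 \<le> (A * (sqrt (2 * (x + 2) / pi) / (x + 1)))\<^sup>2"
      using m A0 by (intro power_mono mult_left_mono mult_nonneg_nonneg) auto
    also have "\<dots> = A\<^sup>2 * (2 * (x + 2) / pi) / (x + 1)\<^sup>2"
      using x1 by (simp add: power_mult_distrib power_divide)
    also have "A\<^sup>2 = 144 * (x - a)\<^sup>2 * (x + 2)\<^sup>2 / (x + 4) ^ 4"
      by (simp add: A_def power2_eq_square power4_eq_xxxx algebra_simps)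
    also have "144 * (x - a)\<^sup>2 * (x + 2)\<^sup>2 / (x + 4) ^ 4 * (2 * (x + 2) / pi) / (x + 1)\<^sup>2
        = (288 * (x - a)\<^sup>2 * (x + 2) ^ 3) / (pi * (x + 4) ^ 4 * (x + 1)\<^sup>2)"
    proof -
      have "144 * b\<^sup>2 * v\<^sup>2 / c * (2 * v / pi) / D = (288 * b\<^sup>2 * v ^ 3) / (pi * c * D)" for b v c D :: real
        by (simp add: power2_eq_square power3_eq_cube mult_ac)
      thus ?thesis .
    qed
    also have "\<dots> \<le> (2 - 1 / 2 ^ k)\<^sup>2"
      using rational_bound_aux[OF x1 x2 a] x1 by (simp add: divide_le_eq mult_ac)
    finally show "(A * m)\<^sup>2 \<le> (2 - 1 / 2 ^ k)\<^sup>2" .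
    have "1 / 2 ^ k \<le> (1 :: real)" by simp
    thus "(0 :: real) \<le> 2 - 1 / 2 ^ k" by linarith
  qed
  hence "A * m * (1 - 2 powr (- d)) \<le> (2 - 1 / 2 ^ k) * (1 - 2 powr (- d))"
    using d by (intro mult_right_mono) (auto simp: powr_minus inverse_le_1_iff intro: ge_one_powr_ge_zero)
  also have "\<dots> \<le> 1 - 2 powr (- (d + real k * a))"
    using geometric_gap_ge[OF d a(2), of k] by (simp add: mult_ac)
  also have "- (d + real k * a) = 1 - x" using xk by simp
  finally have 2: "A * m * (1 - 2 powr (- d)) \<le> 1 - 2 powr (1 - x)" .
  have "9 * K * ((x - a) * (1 - 2 powr (- d))) / G
      = (2 powr x * level_const p n) * (A * m * (1 - 2 powr (- d)))"
  proof -
    have L: "level_const p n = 3 * K / ((x + 2) * Gamma (x + 1))" by (simp add: lc x_def add.commute)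
    have W: "(2 + x / 2)\<^sup>2 = (x + 4)\<^sup>2 / 4" by (simp add: power2_eq_square field_simps)
    have alg: "9 * K * (b * c) / ((w / 4) * g2\<^sup>2)
        = (P * (3 * K / (v * g))) * (b * (12 * v / w) * (g / (P * g2\<^sup>2)) * c)"
      if "v \<noteq> 0" "w \<noteq> 0" "g \<noteq> 0" "g2 \<noteq> 0" "P \<noteq> 0" for b c g g2 P v w :: real
      using that by (simp add: divide_simps mult_ac)
    show ?thesis unfolding G_def A_def m_def L W
    proof (rule alg)
      show "Gamma (x + 1) \<noteq> 0" "Gamma (x / 2 + 1) \<noteq> 0" using Gpos by linarith+
    qed (use x1 in auto)
  qed
  also have "\<dots> \<le> (2 powr x * level_const p n) * (1 - 2 powr (1 - x))"
    using level_const_pos[OF p, of n] by (intro mult_left_mono 2) auto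
  also have "\<dots> = (2 powr x - 2) * level_const p n"
    by (simp add: algebra_simps powr_diff)
  finally show ?thesis using 1 unfolding x_def by linarith
qed

lemma inverse_gfact_le_level_const:
  assumes p: "1 \<le> p" and i: "i \<le> int_part p"
  shows "1 / (beta_p p * gfact (real i / p)) \<le> level_const p i"
proof -
  have "real i / p \<le> 1" using i int_part_bounds[OF p] p by (simp add: divide_le_eq)
  moreover have "gfact (real i / p) > 0" using p by (intro gfact_pos) (auto simp: less_le_trans[of _ 0])
  ultimately have "3 / beta_p p / (3 * gfact (real i / p))
      \<le> 3 / beta_p p / ((2 + real i / p) * gfact (real i / p))"
    using beta_p_pos[OF p] p
    by (intro divide_left_mono mult_right_mono mult_pos_pos) (auto simp: add_pos_nonneg)
  thus ?thesis by (simp add: level_const_def)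
qed

lemma level_const_le_inverse_gfact:
  assumes p: "1 \<le> p"
  shows "level_const p n \<le> 3 / (2 * beta_p p) / gfact (real n / p)"
proof -
  have g: "gfact (real n / p) > 0" using p by (intro gfact_pos) (auto simp: less_le_trans[of _ 0])
  have "3 / beta_p p / ((2 + real n / p) * gfact (real n / p)) \<le> 3 / beta_p p / (2 * gfact (real n / p))"
    using beta_p_pos[OF p] p g by (intro divide_left_mono mult_right_mono mult_pos_pos) (auto simp: add_pos_nonneg)
  thus ?thesis by (simp add: level_const_def)
qed

section \<open>Variation of a continuous two-parameter function\<close>

lemma is_partition_less:
  assumes "is_partition s t k u" "i < j" "j \<le> k"
  shows "u i < u j"
  using assms(2,3)
proof (induction j)
  case (Suc j)
  hence "u j < u (Suc j)" using assms(1) by (auto simp: is_partition_def)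
  thus ?case using Suc by (cases "i = j") auto
qed simp

lemma is_partition_le:
  assumes "is_partition s t k u" "i \<le> j" "j \<le> k"
  shows "u i \<le> u j"
  using is_partition_less[OF assms(1), of i j] assms by (cases "i = j") auto

lemma is_partition_range:
  assumes "is_partition s t k u" "i \<le> k"
  shows "s \<le> u i" "u i \<le> t"
  using is_partition_le[OF assms(1), of 0 i] is_partition_le[OF assms(1), of i k] assms
  by (auto simp: is_partition_def)

lemma is_partition_sub:
  assumes "is_partition s t k u" "i \<le> j" "j \<le> k"
  shows "is_partition (u i) (u j) (j - i) (\<lambda>l. u (i + l))"
  using assms by (auto simp: is_partition_def)

lemma partition_sumsI: "is_partition s t k u \<Longrightarrow> (\<Sum>i<k. f (u i) (u (Suc i))) \<in> partition_sums f s t"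
  unfolding partition_sums_def by blast

lemma partition_sumsE:
  assumes "x \<in> partition_sums f s t"
  obtains k u where "is_partition s t k u" "x = (\<Sum>i<k. f (u i) (u (Suc i)))"
  using assms unfolding partition_sums_def by blast

lemma partition_sums_add:
  assumes "x \<in> partition_sums f s u" "y \<in> partition_sums f u t"
  shows "x + y \<in> partition_sums f s t"
proof -
  obtain k v where v: "is_partition s u k v" "x = (\<Sum>i<k. f (v i) (v (Suc i)))"
    using assms(1) by (rule partition_sumsE)
  obtain l w where w: "is_partition u t l w" "y = (\<Sum>i<l. f (w i) (w (Suc i)))"
    using assms(2) by (rule partition_sumsE)
  define z where "z = (\<lambda>i. if i \<le> k then v i else w (i - k))"
  have zw: "z (k + i) = w i" for i
    using v w by (cases "i = 0") (auto simp: z_def is_partition_def)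
  have "z i < z (Suc i)" if "i < k + l" for i
  proof (cases "i < k")
    case True
    thus ?thesis using v by (auto simp: z_def is_partition_def)
  next
    case False
    then obtain j where j: "i = k + j" by (metis le_add_diff_inverse not_less)
    have "w j < w (Suc j)" using w that j by (auto simp: is_partition_def)
    thus ?thesis using zw[of j] zw[of "Suc j"] by (simp add: j)
  qed
  hence p: "is_partition s t (k + l) z"
    using v w zw[of l] by (auto simp: is_partition_def z_def)
  have "(\<Sum>i<k + l. f (z i) (z (Suc i))) = (\<Sum>i<k. f (z i) (z (Suc i))) + (\<Sum>i<l. f (z (k + i)) (z (k + Suc i)))"
    by (induction l) (auto simp: add_ac)
  also have "(\<Sum>i<k. f (z i) (z (Suc i))) = x" unfolding v by (intro sum.cong) (auto simp: z_def)
  also have "(\<Sum>i<l. f (z (k + i)) (z (k + Suc i))) = y" unfolding w zw ..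
  finally show ?thesis using partition_sumsI[OF p, of f] by simp
qed

lemma partition_sums_single: "s < t \<Longrightarrow> f s t \<in> partition_sums f s t"
  using partition_sumsI[of s t 1 "\<lambda>i. if i = 0 then s else t" f] by (auto simp: is_partition_def)

lemma partition_sums_trivial: "partition_sums f s s = {0}"
proof -
  have "k = 0" if "is_partition s s k u" for k u
    using is_partition_less[OF that, of 0 k] that by (auto simp: is_partition_def)
  moreover have "is_partition s s 0 (\<lambda>_. s)" by (auto simp: is_partition_def)
  ultimately show ?thesis unfolding partition_sums_def by fastforce
qed

lemma partition_sums_nonempty: "s \<le> t \<Longrightarrow> partition_sums f s t \<noteq> {}"
  using partition_sums_single[of s t f] by (cases "s = t") (auto simp: partition_sums_trivial)

lemma compact_time_simplex: "compact (time_simplex T)"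
proof -
  have "time_simplex T = ({0..T} \<times> {0..T}) \<inter> {z. fst z \<le> snd z}"
    by (auto simp: time_simplex_def)
  moreover have "closed {z :: real \<times> real. fst z \<le> snd z}"
    by (intro closed_Collect_le continuous_intros)
  ultimately show ?thesis by (auto intro!: compact_Int_closed compact_Times)
qed

text \<open>A nonnegative continuous function \<open>f\<close> on the simplex, zero on the diagonal, with bounded partition sums;
\<open>f\<close> need not be superadditive, nor satisfy any triangle inequality. It will be the \<open>p\<close>-th power of
\<open>group_norm\<close> along a rough path.\<close>
locale variation =
  fixes f :: "real \<Rightarrow> real \<Rightarrow> real" and T :: real
  assumes nonneg: "\<And>s t. 0 \<le> s \<Longrightarrow> s \<le> t \<Longrightarrow> t \<le> T \<Longrightarrow> 0 \<le> f s t"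
    and diag: "\<And>t. 0 \<le> t \<Longrightarrow> t \<le> T \<Longrightarrow> f t t = 0"
    and cont: "continuous_on (time_simplex T) (\<lambda>(s, t). f s t)"
    and bdd: "bdd_above (partition_sums f 0 T)"
begin

definition var :: "real \<Rightarrow> real \<Rightarrow> real" where
  "var s t = Sup (partition_sums f s t)"

lemma partition_sums_nonneg:
  assumes "0 \<le> s" "t \<le> T" "x \<in> partition_sums f s t"
  shows "0 \<le> x"
proof -
  obtain k u where u: "is_partition s t k u" "x = (\<Sum>i<k. f (u i) (u (Suc i)))"
    using assms(3) by (rule partition_sumsE)
  show ?thesis unfolding u
  proof (intro sum_nonneg nonneg)
    fix i assume "i \<in> {..<k}"
    hence i: "Suc i \<le> k" by simp
    show "0 \<le> u i" "u i \<le> u (Suc i)" "u (Suc i) \<le> T"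
      using is_partition_range[OF u(1), of i] is_partition_range[OF u(1) i] is_partition_le[OF u(1) _ i, of i] i assms
      by auto
  qed
qed

lemma bdd_partition_sums:
  assumes "0 \<le> s" "s \<le> t" "t \<le> T"
  shows "bdd_above (partition_sums f s t)"
proof -
  obtain M where M: "\<And>x. x \<in> partition_sums f 0 T \<Longrightarrow> x \<le> M" using bdd by (auto simp: bdd_above_def)
  obtain a b where ab: "a \<in> partition_sums f 0 s" "b \<in> partition_sums f t T"
    using partition_sums_nonempty[of 0 s f] partition_sums_nonempty[of t T f] assms by blast
  have "x \<le> M" if "x \<in> partition_sums f s t" for x
  proof -
    have "a + x + b \<in> partition_sums f 0 T"
      using ab that by (auto intro: partition_sums_add)
    moreover have "0 \<le> a" "0 \<le> b" using partition_sums_nonneg[OF _ _ ab(1)] partition_sums_nonneg[OF _ _ ab(2)] assms by auto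
    ultimately show ?thesis using M by fastforce
  qed
  thus ?thesis by (auto simp: bdd_above_def)
qed

lemma le_var:
  assumes "0 \<le> s" "s \<le> t" "t \<le> T" "x \<in> partition_sums f s t"
  shows "x \<le> var s t"
  unfolding var_def using assms bdd_partition_sums by (intro cSup_upper)

lemma var_refl: "var s s = 0"
  by (simp add: var_def partition_sums_trivial)

lemma f_le_var:
  assumes "0 \<le> s" "s \<le> t" "t \<le> T"
  shows "f s t \<le> var s t"
  using le_var[OF assms partition_sums_single] assms diag by (cases "s = t") (auto simp: var_refl)

lemma var_nonneg:
  assumes "0 \<le> s" "s \<le> t" "t \<le> T"
  shows "0 \<le> var s t"
  using f_le_var[OF assms] nonneg[OF assms] by linarith

lemma var_superadditive:
  assumes "0 \<le> s" "s \<le> u" "u \<le> t" "t \<le> T"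
  shows "var s u + var u t \<le> var s t"
proof -
  have "var s u \<le> var s t - y" if y: "y \<in> partition_sums f u t" for y
    unfolding var_def[of s u]
  proof (rule cSup_least)
    fix x assume "x \<in> partition_sums f s u"
    from partition_sums_add[OF this y] show "x \<le> var s t - y"
      using le_var[of s t "x + y"] assms by simp
  qed (use assms partition_sums_nonempty in auto)
  hence "var u t \<le> var s t - var s u"
    unfolding var_def[of u t] using assms partition_sums_nonempty
    by (intro cSup_least) (auto simp: algebra_simps)
  thus ?thesis by simp
qed

lemma var_mono:
  assumes "0 \<le> s" "s \<le> s'" "s' \<le> t'" "t' \<le> t" "t \<le> T"
  shows "var s' t' \<le> var s t"
  using var_superadditive[of s s' t'] var_superadditive[of s t' t] var_nonneg[of s s'] var_nonneg[of t' t] assms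
  by linarith

lemma near_optimal_partition:
  assumes "0 \<le> s" "s < t" "t \<le> T" "e > 0"
  obtains k u where "is_partition s t k u" "k > 0" "var s t - e < (\<Sum>i<k. f (u i) (u (Suc i)))"
proof -
  have "\<exists>x\<in>partition_sums f s t. var s t - e < x"
    unfolding var_def using assms partition_sums_nonempty[of s t f] by (intro less_cSupD) auto
  then obtain k u where u: "is_partition s t k u" "var s t - e < (\<Sum>i<k. f (u i) (u (Suc i)))"
    by (auto elim: partition_sumsE)
  moreover have "k > 0" using u(1) assms by (cases k) (auto simp: is_partition_def)
  ultimately show ?thesis using that by blast
qed

lemma uniform:
  assumes "e > 0"
  shows "\<exists>d>0. \<forall>s t s' t'. (s, t) \<in> time_simplex T \<longrightarrow> (s', t') \<in> time_simplex T \<longrightarrow>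
    dist (s, t) (s', t') < d \<longrightarrow> \<bar>f s t - f s' t'\<bar> < e"
proof -
  obtain d where d: "d > 0" "\<forall>x\<in>time_simplex T. \<forall>y\<in>time_simplex T. dist y x < d \<longrightarrow>
      dist (case y of (s, t) \<Rightarrow> f s t) (case x of (s, t) \<Rightarrow> f s t) < e"
    using compact_uniformly_continuous[OF cont compact_time_simplex] assms
    unfolding uniformly_continuous_on_def by blast
  have "\<bar>f s t - f s' t'\<bar> < e"
    if "(s, t) \<in> time_simplex T" "(s', t') \<in> time_simplex T" "dist (s, t) (s', t') < d" for s t s' t'
    using bspec[OF bspec[OF d(2) that(2)] that(1)] that(3) by (simp add: dist_real_def)
  thus ?thesis using d(1) by blast
qed

text \<open>Left continuity in the endpoint: move the last point of a nearly optimal partition.\<close>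
lemma var_left_continuous:
  assumes "0 \<le> s" "s < t" "t \<le> T" "e > 0"
  obtains d where "d > 0" "\<And>t'. s \<le> t' \<Longrightarrow> t' \<le> t \<Longrightarrow> t - t' < d \<Longrightarrow> var s t - var s t' < e"
proof -
  obtain k u where u: "is_partition s t k u" "k > 0" "var s t - e / 2 < (\<Sum>i<k. f (u i) (u (Suc i)))"
    using near_optimal_partition[OF assms(1-3), of "e / 2"] assms(4) by auto
  have "e / 2 > 0" using assms(4) by simp
  then obtain d where d: "d > 0" "\<forall>s t s' t'. (s, t) \<in> time_simplex T \<longrightarrow> (s', t') \<in> time_simplex T \<longrightarrow>
    dist (s, t) (s', t') < d \<longrightarrow> \<bar>f s t - f s' t'\<bar> < e / 2"
    using uniform by blast
  obtain l where l: "k = Suc l" using u(2) by (cases k) auto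
  have ul: "u l < t" "s \<le> u l" using u(1) is_partition_range[OF u(1), of l] by (auto simp: is_partition_def l)
  show ?thesis
  proof (rule that[of "min d (t - u l)"])
    fix t' assume t': "s \<le> t'" "t' \<le> t" "t - t' < min d (t - u l)"
    have "(\<Sum>i<l. f (u i) (u (Suc i))) \<le> var s (u l)"
      using is_partition_sub[OF u(1), of 0 l] u(1) ul assms l
      by (intro le_var partition_sumsI) (auto simp: is_partition_def)
    moreover have "f (u l) t' \<le> var (u l) t'" using t' ul assms by (intro f_le_var) auto
    moreover have "var s (u l) + var (u l) t' \<le> var s t'"
      using t' ul assms by (intro var_superadditive) auto
    moreover have "\<bar>f (u l) t - f (u l) t'\<bar> < e / 2"
      using t' ul assms by (intro d(2)[rule_format]) (auto simp: time_simplex_def dist_Pair_Pair dist_real_def)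
    moreover have "u (Suc l) = t" using u(1) by (simp add: is_partition_def l)
    ultimately show "var s t - var s t' < e" using u(3) unfolding l by (simp add: abs_if split: if_splits)
  qed (use d ul in auto)
qed

text \<open>Moving the first point of a nearly optimal partition of \<open>[t, T]\<close> shows that \<open>var t' T\<close> is close to
\<open>var t T\<close>; superadditivity turns this into smallness of \<open>var t t'\<close>.\<close>
lemma var_vanishes_right:
  assumes "0 \<le> t" "t < T" "e > 0"
  obtains d where "d > 0" "\<And>t'. t \<le> t' \<Longrightarrow> t' \<le> T \<Longrightarrow> t' - t < d \<Longrightarrow> var t t' < e"
proof -
  obtain k u where u: "is_partition t T k u" "k > 0" "var t T - e / 2 < (\<Sum>i<k. f (u i) (u (Suc i)))"
    using near_optimal_partition[OF assms(1,2), of "e / 2"] assms(3) by auto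
  have "e / 2 > 0" using assms(3) by simp
  then obtain d where d: "d > 0" "\<forall>s t s' t'. (s, t) \<in> time_simplex T \<longrightarrow> (s', t') \<in> time_simplex T \<longrightarrow>
    dist (s, t) (s', t') < d \<longrightarrow> \<bar>f s t - f s' t'\<bar> < e / 2"
    using uniform by blast
  obtain l where l: "k = Suc l" using u(2) by (cases k) auto
  have u1: "t < u 1" "u 1 \<le> T" using u(1,2) is_partition_range[OF u(1), of 1] by (auto simp: is_partition_def)
  show ?thesis
  proof (rule that[of "min d (u 1 - t)"])
    fix t' assume t': "t \<le> t'" "t' \<le> T" "t' - t < min d (u 1 - t)"
    have "(\<Sum>i<l. f (u (1 + i)) (u (1 + Suc i))) \<le> var (u 1) T"
      using is_partition_sub[OF u(1), of 1 k] u u1 assms l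
      by (intro le_var partition_sumsI[where u = "\<lambda>i. u (1 + i)"]) (auto simp: is_partition_def)
    moreover have "f t' (u 1) \<le> var t' (u 1)" using t' u1 assms by (intro f_le_var) auto
    moreover have "var t' (u 1) + var (u 1) T \<le> var t' T"
      using t' u1 assms by (intro var_superadditive) auto
    moreover have "\<bar>f t (u 1) - f t' (u 1)\<bar> < e / 2"
      using t' u1 assms by (intro d(2)[rule_format]) (auto simp: time_simplex_def dist_Pair_Pair dist_real_def)
    moreover have "u 0 = t" using u(1) by (simp add: is_partition_def)
    moreover have "var t t' + var t' T \<le> var t T"
      using t' assms by (intro var_superadditive) auto
    ultimately show "var t t' < e" using u(3) unfolding l sum.lessThan_Suc_shift
      by (simp add: abs_if split: if_splits)
  qed (use d u1 in auto)
qed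

text \<open>In a partition of \<open>[s, t']\<close> the one interval that straddles \<open>t\<close> can be cut at \<open>t\<close>, at a cost that is
uniformly small by uniform continuity of \<open>f\<close>; the part behind \<open>t\<close> is small by the previous lemma.\<close>
lemma var_right_continuous:
  assumes "0 \<le> s" "s \<le> t" "t < T" "e > 0"
  obtains d where "d > 0" "\<And>t'. t \<le> t' \<Longrightarrow> t' \<le> T \<Longrightarrow> t' - t < d \<Longrightarrow> var s t' - var s t < e"
proof -
  obtain d1 where d1: "d1 > 0" "\<And>t'. t \<le> t' \<Longrightarrow> t' \<le> T \<Longrightarrow> t' - t < d1 \<Longrightarrow> var t t' < e / 4"
    using var_vanishes_right[of t "e / 4"] assms by auto
  have "e / 4 > 0" using assms(4) by simp
  then obtain d2 where d2: "d2 > 0" "\<forall>s t s' t'. (s, t) \<in> time_simplex T \<longrightarrow> (s', t') \<in> time_simplex T \<longrightarrow>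
    dist (s, t) (s', t') < d2 \<longrightarrow> \<bar>f s t - f s' t'\<bar> < e / 4"
    using uniform by blast
  show ?thesis
  proof (rule that[of "min d1 d2"])
    fix t' assume t': "t \<le> t'" "t' \<le> T" "t' - t < min d1 d2"
    have "var s t' \<le> var s t + e / 2"
      unfolding var_def[of s t']
    proof (rule cSup_least)
      fix x assume "x \<in> partition_sums f s t'"
      then obtain k u where u: "is_partition s t' k u" "x = (\<Sum>i<k. f (u i) (u (Suc i)))"
        by (rule partition_sumsE)
      show "x \<le> var s t + e / 2"
      proof (cases "t < t'")
        case False
        hence "t' = t" using t' by simp
        thus ?thesis using \<open>x \<in> _\<close> le_var[of s t x] assms by auto
      next
        case True
        \<comment> \<open>the interval \<open>[u j, u (Suc j)]\<close> straddles \<open>t\<close>\<close>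
        define j where "j = Max {i. i \<le> k \<and> u i \<le> t}"
        have fin: "finite {i. i \<le> k \<and> u i \<le> t}" by simp
        have "0 \<in> {i. i \<le> k \<and> u i \<le> t}" using u(1) assms by (auto simp: is_partition_def)
        hence "j \<in> {i. i \<le> k \<and> u i \<le> t}" using Max_in[OF fin] unfolding j_def by blast
        hence j: "j \<le> k" "u j \<le> t" by auto
        have jk: "j < k" using j u(1) True by (cases "j = k") (auto simp: is_partition_def)
        have uj: "t < u (Suc j)"
        proof (rule ccontr)
          assume "\<not> t < u (Suc j)"
          hence "Suc j \<le> j" using jk fin unfolding j_def by (intro Max_ge) auto
          thus False by simp
        qed
        have r: "s \<le> u j" "u (Suc j) \<le> t'" using is_partition_range[OF u(1)] jk by auto
        have "(\<Sum>i<k. f (u i) (u (Suc i))) = (\<Sum>i<j. f (u i) (u (Suc i))) + f (u j) (u (Suc j))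
            + (\<Sum>i<k - Suc j. f (u (Suc j + i)) (u (Suc j + Suc i)))"
        proof -
          define l where "l = k - Suc j"
          have "k = Suc j + l" using jk by (simp add: l_def)
          moreover have "(\<Sum>i<Suc j + l. f (u i) (u (Suc i))) = (\<Sum>i<Suc j. f (u i) (u (Suc i)))
             + (\<Sum>i<l. f (u (Suc j + i)) (u (Suc j + Suc i)))"
            by (induction l) (auto simp: add_ac)
          ultimately show ?thesis by (simp add: l_def)
        qed
        moreover have "(\<Sum>i<j. f (u i) (u (Suc i))) \<le> var s (u j)"
          using is_partition_sub[OF u(1), of 0 j] u(1) jk r assms j t'
          by (intro le_var partition_sumsI) (auto simp: is_partition_def)
        moreover have "(\<Sum>i<k - Suc j. f (u (Suc j + i)) (u (Suc j + Suc i))) \<le> var (u (Suc j)) t'"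
          using is_partition_sub[OF u(1), of "Suc j" k] u(1) jk r uj assms t'
          by (intro le_var partition_sumsI[where u = "\<lambda>i. u (Suc j + i)"]) (auto simp: is_partition_def)
        moreover have "\<bar>f (u j) (u (Suc j)) - f (u j) t\<bar> < e / 4"
          using t' j uj r assms by (intro d2(2)[rule_format]) (auto simp: time_simplex_def dist_Pair_Pair dist_real_def)
        moreover have "f (u j) t \<le> var (u j) t" using j r assms by (intro f_le_var) auto
        moreover have "var s (u j) + var (u j) t \<le> var s t"
          using j r assms by (intro var_superadditive) auto
        moreover have "var (u (Suc j)) t' \<le> var t t'"
          using t' uj r assms by (intro var_mono) auto
        moreover have "var t t' < e / 4" using t' d1 by auto
        ultimately show ?thesis using u(2) by (simp add: abs_if split: if_splits)
      qed
    qed (use assms t' partition_sums_nonempty in auto)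
    thus "var s t' - var s t < e" using assms(4) by simp
  qed (use d1 d2 in auto)
qed

lemma continuous_var:
  assumes s: "0 \<le> s"
  shows "continuous_on {s..T} (var s)"
  unfolding continuous_on_iff
proof (intro ballI allI impI)
  fix t e :: real assume t: "t \<in> {s..T}" and e: "e > 0"
  obtain d1 where d1: "d1 > 0" "\<And>t'. s \<le> t' \<Longrightarrow> t' \<le> t \<Longrightarrow> t - t' < d1 \<Longrightarrow> var s t - var s t' < e"
  proof (cases "s < t")
    case True
    thus ?thesis using var_left_continuous[of s t e] that t e s by auto
  qed (use t e in \<open>auto intro: that[of 1]\<close>)
  obtain d2 where d2: "d2 > 0" "\<And>t'. t \<le> t' \<Longrightarrow> t' \<le> T \<Longrightarrow> t' - t < d2 \<Longrightarrow> var s t' - var s t < e"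
  proof (cases "t < T")
    case True
    thus ?thesis using var_right_continuous[of s t e] that t e s by auto
  qed (use t e in \<open>auto intro: that[of 1]\<close>)
  show "\<exists>d>0. \<forall>t'\<in>{s..T}. dist t' t < d \<longrightarrow> dist (var s t') (var s t) < e"
  proof (intro exI[of _ "min d1 d2"] conjI ballI impI)
    fix t' assume t': "t' \<in> {s..T}" "dist t' t < min d1 d2"
    show "dist (var s t') (var s t) < e"
    proof (cases "t' \<le> t")
      case True
      hence "var s t' \<le> var s t" using t t' s by (intro var_mono) auto
      thus ?thesis using d1(2)[of t'] True t' by (auto simp: dist_real_def)
    next
      case False
      hence "var s t \<le> var s t'" using t t' s by (intro var_mono) auto
      thus ?thesis using d2(2)[of t'] False t' by (auto simp: dist_real_def)
    qed
  qed (use d1 d2 in auto)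
qed

end

section \<open>Controls and the sewing lemma\<close>

text \<open>The sum of \<open>A\<close> over the consecutive points \<open>s, x\<^sub>1, ..., x\<^sub>k, t\<close>, where the list contains the interior
points only; points may be repeated.\<close>
fun psum :: "(real \<Rightarrow> real \<Rightarrow> real) \<Rightarrow> real \<Rightarrow> real list \<Rightarrow> real \<Rightarrow> real" where
  "psum A s [] t = A s t"
| "psum A s (x # xs) t = A s x + psum A x xs t"

lemma psum_append: "psum A s (xs @ x # ys) t = psum A s xs x + psum A x ys t"
  by (induction xs arbitrary: s) auto

lemma sorted_common_refinement:
  fixes xs ys :: "real list"
  assumes "sorted xs" "sorted ys"
  shows "\<exists>zs. sorted zs \<and> set zs = set xs \<union> set ys \<and> subseq xs zs \<and> subseq ys zs"
  using assms
proof (induction "length xs + length ys" arbitrary: xs ys rule: less_induct)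
  case less
  show ?case
  proof (cases "xs = [] \<or> ys = []")
    case True
    thus ?thesis using less.prems by auto
  next
    case False
    then obtain x xs' y ys' where xy: "xs = x # xs'" "ys = y # ys'" by (meson neq_Nil_conv)
    show ?thesis
    proof (cases "x \<le> y")
      case True
      obtain zs where zs: "sorted zs" "set zs = set xs' \<union> set ys" "subseq xs' zs" "subseq ys zs"
        using less.hyps[of xs' ys] less.prems xy by fastforce
      have "subseq xs (x # zs)" "subseq ys (x # zs)" using zs xy(1) by (auto intro: list_emb_Cons)
      moreover have "sorted (x # zs)" "set (x # zs) = set xs \<union> set ys"
        using zs less.prems xy True by auto
      ultimately show ?thesis by blast
    next
      case False
      obtain zs where zs: "sorted zs" "set zs = set xs \<union> set ys'" "subseq xs zs" "subseq ys' zs"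
        using less.hyps[of xs ys'] less.prems xy by fastforce
      have "subseq xs (y # zs)" "subseq ys (y # zs)" using zs xy(2) by (auto intro: list_emb_Cons)
      moreover have "sorted (y # zs)" "set (y # zs) = set xs \<union> set ys"
        using zs less.prems xy False by auto
      ultimately show ?thesis by blast
    qed
  qed
qed

text \<open>Controls: superadditive functions on the simplex that vanish on the diagonal and are continuous in the
right endpoint.\<close>
locale control =
  fixes w :: "real \<Rightarrow> real \<Rightarrow> real" and T :: real
  assumes nonneg: "\<And>s t. 0 \<le> s \<Longrightarrow> s \<le> t \<Longrightarrow> t \<le> T \<Longrightarrow> 0 \<le> w s t"
    and diag: "\<And>s. w s s = 0"
    and superadditive: "\<And>s u t. 0 \<le> s \<Longrightarrow> s \<le> u \<Longrightarrow> u \<le> t \<Longrightarrow> t \<le> T \<Longrightarrow> w s u + w u t \<le> w s t"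
    and cont: "\<And>s. 0 \<le> s \<Longrightarrow> continuous_on {s..T} (w s)"
begin

lemma mono:
  assumes "0 \<le> s" "s \<le> s'" "s' \<le> t'" "t' \<le> t" "t \<le> T"
  shows "w s' t' \<le> w s t"
  using superadditive[of s s' t'] superadditive[of s t' t] nonneg[of s s'] nonneg[of t' t] assms
  by linarith

lemma intermediate:
  assumes "0 \<le> s" "s \<le> t" "t \<le> T" "0 \<le> c" "c \<le> 1"
  obtains u where "s \<le> u" "u \<le> t" "w s u = c * w s t"
proof -
  have "continuous_on {s..t} (w s)"
    using cont[OF assms(1)] by (rule continuous_on_subset) (use assms in auto)
  moreover have "w s s \<le> c * w s t" "c * w s t \<le> w s t"
    using nonneg[of s t] assms diag[of s] by (auto simp: mult_left_le_one_le)
  ultimately obtain u where "s \<le> u" "u \<le> t" "w s u = c * w s t"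
    using IVT'[of "w s" s "c * w s t" t] assms(2) by blast
  thus ?thesis by (rule that)
qed

lemma midpoint:
  assumes "0 \<le> s" "s \<le> t" "t \<le> T"
  obtains u where "s \<le> u" "u \<le> t" "w s u \<le> w s t / 2" "w u t \<le> w s t / 2"
proof -
  obtain u where u: "s \<le> u" "u \<le> t" "w s u = 1 / 2 * w s t"
    by (rule intermediate[of s t "1 / 2"]) (use assms in auto)
  moreover have "w s u + w u t \<le> w s t" using u assms by (intro superadditive)
  ultimately show ?thesis using assms by (intro that[of u]) auto
qed

text \<open>By the intermediate value theorem there are points with \<open>w s (u i) = i / m * w s t\<close>; superadditivity
gives the rest. If \<open>w s t = 0\<close> this does not produce distinct points, but then any partition will do.\<close>
lemma equipartition:
  assumes s: "0 \<le> s" "s < t" "t \<le> T" and m: "m \<ge> 1"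
  obtains u where "is_partition s t m u"
    "\<And>i j. i < j \<Longrightarrow> j \<le> m \<Longrightarrow> w (u i) (u j) \<le> real (j - i) / real m * w s t"
proof (cases "w s t = 0")
  case True
  define u where "u = (\<lambda>i. s + (t - s) * real i / real m)"
  have p: "is_partition s t m u"
    using s m by (auto simp: is_partition_def u_def divide_strict_right_mono)
  show ?thesis
  proof (rule that[OF p])
    fix i j assume "i < j" "j \<le> m"
    hence "w (u i) (u j) \<le> w s t"
      using is_partition_range[OF p, of i] is_partition_range[OF p, of j] is_partition_le[OF p, of i j] s
      by (intro mono) auto
    thus "w (u i) (u j) \<le> real (j - i) / real m * w s t" using True by simp
  qed
next
  case False
  hence W: "w s t > 0" using nonneg[of s t] s by auto
  have "\<exists>u. s \<le> u \<and> u \<le> t \<and> w s u = real i / real m * w s t" if "i \<le> m" for i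
  proof -
    have "0 \<le> real i / real m" "real i / real m \<le> 1" using m that by (auto simp: divide_le_eq_1)
    then obtain u where "s \<le> u" "u \<le> t" "w s u = real i / real m * w s t"
      by (rule intermediate[of s t, rotated 3]) (use s in auto)
    thus ?thesis by blast
  qed
  then obtain v where v: "\<And>i. i \<le> m \<Longrightarrow> s \<le> v i \<and> v i \<le> t \<and> w s (v i) = real i / real m * w s t"
    by metis
  define u where "u = (\<lambda>i. if i = 0 then s else if i = m then t else v i)"
  have u: "s \<le> u i" "u i \<le> t" "w s (u i) = real i / real m * w s t" if "i \<le> m" for i
    using v[OF that] s m by (auto simp: u_def diag)
  have mono_u: "u i < u j" if "i < j" "j \<le> m" for i j
  proof (rule ccontr)
    assume "\<not> u i < u j"
    hence "w s (u j) \<le> w s (u i)" using u[of i] u[of j] that s by (intro mono) auto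
    hence "real j / real m * w s t \<le> real i / real m * w s t" using u[of i] u[of j] that by simp
    thus False using W that m by (simp add: divide_right_mono field_simps)
  qed
  have p: "is_partition s t m u" using mono_u m by (auto simp: is_partition_def u_def)
  show ?thesis
  proof (rule that[OF p])
    fix i j assume ij: "i < j" "j \<le> m"
    have "w s (u i) + w (u i) (u j) \<le> w s (u j)"
      using u[of i] u[of j] mono_u[OF ij] ij s by (intro superadditive) auto
    thus "w (u i) (u j) \<le> real (j - i) / real m * w s t"
      using u[of i] u[of j] ij by (simp add: of_nat_diff diff_divide_distrib left_diff_distrib)
  qed
qed

lemma halves_powr_le:
  assumes "0 \<le> s" "s \<le> u" "u \<le> t" "t \<le> T" "w s u \<le> w s t / 2" "w u t \<le> w s t / 2" "\<theta> > 0"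
  shows "w s u powr \<theta> \<le> 2 powr (- \<theta>) * w s t powr \<theta>" "w u t powr \<theta> \<le> 2 powr (- \<theta>) * w s t powr \<theta>"
proof -
  have eq: "(w s t / 2) powr \<theta> = 2 powr (- \<theta>) * w s t powr \<theta>"
    using nonneg[of s t] assms by (simp add: powr_divide powr_minus field_simps)
  have "w s u powr \<theta> \<le> (w s t / 2) powr \<theta>" "w u t powr \<theta> \<le> (w s t / 2) powr \<theta>"
    using nonneg[of s u] nonneg[of u t] assms by (auto intro: powr_mono2)
  thus "w s u powr \<theta> \<le> 2 powr (- \<theta>) * w s t powr \<theta>" "w u t powr \<theta> \<le> 2 powr (- \<theta>) * w s t powr \<theta>"
    unfolding eq by auto
qed

text \<open>If \<open>N\<close> is subadditive up to an error \<open>D * w s t powr \<theta>\<close> when an interval is halved with respect to \<open>w\<close>,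
any bound \<open>B * w s t powr \<theta>\<close> improves to one with a constant \<open>c\<close> that \<open>B \<mapsto> 2 powr (1 - \<theta>) * B + D\<close>
does not increase.\<close>
lemma bound_by_bisection:
  assumes \<theta>: "\<theta> > 1" and c: "D \<le> (1 - 2 powr (1 - \<theta>)) * c" and B: "0 \<le> B" "0 \<le> c"
    and apriori: "\<And>s t. 0 \<le> s \<Longrightarrow> s \<le> t \<Longrightarrow> t \<le> T \<Longrightarrow> N s t \<le> B * w s t powr \<theta>"
    and step: "\<And>s u t. 0 \<le> s \<Longrightarrow> s \<le> u \<Longrightarrow> u \<le> t \<Longrightarrow> t \<le> T \<Longrightarrow> w s u \<le> w s t / 2 \<Longrightarrow> w u t \<le> w s t / 2 \<Longrightarrow>
        N s t \<le> N s u + N u t + D * w s t powr \<theta>"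
    and st: "0 \<le> s" "s \<le> t" "t \<le> T"
  shows "N s t \<le> c * w s t powr \<theta>"
proof -
  define \<rho> where "\<rho> = 2 powr (1 - \<theta>)"
  have \<rho>: "0 < \<rho>" "\<rho> < 1" using \<theta> by (auto simp: \<rho>_def powr_less_one)
  have \<rho>2: "2 powr (- \<theta>) = \<rho> / 2" by (simp add: \<rho>_def powr_diff powr_minus field_simps)
  have iter: "N s t \<le> (c + \<rho> ^ n * B) * w s t powr \<theta>" if "0 \<le> s" "s \<le> t" "t \<le> T" for n s t
    using that
  proof (induction n arbitrary: s t)
    case 0
    have "N s t \<le> B * w s t powr \<theta>" using apriori 0 by simp
    also have "\<dots> \<le> (c + B) * w s t powr \<theta>" using B by (intro mult_right_mono) auto
    finally show ?case by simp
  next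
    case (Suc n)
    obtain u where u: "s \<le> u" "u \<le> t" "w s u \<le> w s t / 2" "w u t \<le> w s t / 2"
      using midpoint[OF Suc.prems] .
    have c0: "c + \<rho> ^ n * B \<ge> 0" using B \<rho> by simp
    have "N s t \<le> N s u + N u t + D * w s t powr \<theta>" using u Suc.prems by (intro step) auto
    also have "N s u \<le> (c + \<rho> ^ n * B) * w s u powr \<theta>" using u Suc.prems by (intro Suc.IH) auto
    also have "\<dots> \<le> (c + \<rho> ^ n * B) * (\<rho> / 2 * w s t powr \<theta>)"
      using halves_powr_le(1)[of s u t \<theta>] u Suc.prems \<theta> c0 unfolding \<rho>2 by (intro mult_left_mono) auto
    also have "N u t \<le> (c + \<rho> ^ n * B) * w u t powr \<theta>" using u Suc.prems by (intro Suc.IH) auto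
    also have "\<dots> \<le> (c + \<rho> ^ n * B) * (\<rho> / 2 * w s t powr \<theta>)"
      using halves_powr_le(2)[of s u t \<theta>] u Suc.prems \<theta> c0 unfolding \<rho>2 by (intro mult_left_mono) auto
    also have "D * w s t powr \<theta> \<le> (1 - \<rho>) * c * w s t powr \<theta>"
      using c unfolding \<rho>_def by (intro mult_right_mono) auto
    finally show ?case by (simp add: algebra_simps)
  qed
  have "(\<lambda>n. (c + \<rho> ^ n * B) * w s t powr \<theta>) \<longlonglongrightarrow> (c + 0 * B) * w s t powr \<theta>"
    using \<rho> by (intro tendsto_mult tendsto_add tendsto_const LIMSEQ_realpow_zero) auto
  thus ?thesis using iter[OF st] by (intro LIMSEQ_le_const) auto
qed

text \<open>The list \<open>xs\<close> consists of interior points, in increasing order, of a subdivision of \<open>[s, t]\<close>.\<close>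
definition admissible :: "real \<Rightarrow> real \<Rightarrow> real list \<Rightarrow> bool" where
  "admissible s t xs \<longleftrightarrow> 0 \<le> s \<and> t \<le> T \<and> sorted (s # xs @ [t])"

lemma admissible_appendD:
  assumes "admissible s t (xs @ x # ys)"
  shows "admissible s x xs" "admissible x t ys" "s \<le> x" "x \<le> t"
  using assms by (auto simp: admissible_def sorted_append)

lemma admissible_appendI:
  assumes "admissible s x xs" "admissible x t ys"
  shows "admissible s t (xs @ x # ys)"
  using assms by (auto simp: admissible_def sorted_append intro: order_trans)

context
  fixes A :: "real \<Rightarrow> real \<Rightarrow> real" and D \<theta> C :: real
  assumes \<theta>: "\<theta> > 1" and D: "0 \<le> D"
    and almost_additive: "\<And>s u t. 0 \<le> s \<Longrightarrow> s \<le> u \<Longrightarrow> u \<le> t \<Longrightarrow> t \<le> T \<Longrightarrow>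
      \<bar>A s t - A s u - A u t\<bar> \<le> D * w s t powr \<theta>"
    and C_eq: "C = 2 * D / (1 - 2 powr (1 - \<theta>))"
begin

text \<open>In the remainder of this context \<open>E\<close> is the power \<open>w powr \<theta>\<close>, \<open>A\<close> is additive up to \<open>D * w s t powr \<theta>\<close>, and
\<open>C\<close> is the constant of the sewing lemma.\<close>
abbreviation (input) E where "E \<equiv> (\<lambda>s t. w s t powr \<theta>)"

lemma C_props: "0 \<le> C" "C * 2 powr (- \<theta>) + C * 2 powr (- \<theta>) + 2 * D = C" "C * 2 powr (- \<theta>) + D \<le> C"
proof -
  have \<rho>: "2 powr (1 - \<theta>) < 1" using \<theta> by (simp add: powr_less_one)
  thus C: "0 \<le> C" using D by (simp add: C_eq)
  have "C * (1 - 2 powr (1 - \<theta>)) = 2 * D" using \<rho> \<theta> by (simp add: C_eq)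
  moreover have "2 powr (1 - \<theta>) = 2 powr (- \<theta>) + 2 powr (- \<theta>)"
    by (simp add: powr_diff powr_minus field_simps)
  ultimately show *: "C * 2 powr (- \<theta>) + C * 2 powr (- \<theta>) + 2 * D = C" by (simp add: algebra_simps)
  have "0 \<le> C * 2 powr (- \<theta>)" using C by simp
  thus "C * 2 powr (- \<theta>) + D \<le> C" using * D by linarith
qed

text \<open>Bisection of the list at the first point \<open>x\<close> with \<open>w s x > w s t / 2\<close>: the part before the predecessor
of \<open>x\<close> and the part behind \<open>x\<close> both have control at most \<open>w s t / 2\<close>.\<close>
lemma psum_bound:
  assumes "admissible s t xs"
  shows "\<bar>psum A s xs t - A s t\<bar> \<le> C * E s t"
  using assms
proof (induction "length xs" arbitrary: xs s t rule: less_induct)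
  case less
  have st: "0 \<le> s" "s \<le> t" "t \<le> T" using less.prems by (auto simp: admissible_def sorted_append)
  define W where "W = E s t"
  have W: "W \<ge> 0" by (simp add: W_def)
  have part: "C * E a b \<le> C * 2 powr (- \<theta>) * W" if "0 \<le> a" "a \<le> b" "b \<le> T" "w a b \<le> w s t / 2" for a b
  proof -
    have "E a b \<le> (w s t / 2) powr \<theta>" using that \<theta> nonneg[of a b] by (intro powr_mono2) auto
    also have "\<dots> = 2 powr (- \<theta>) * W"
      using nonneg[of s t] st by (simp add: W_def powr_divide powr_minus field_simps)
    finally show ?thesis using C_props(1) by (simp add: mult_left_mono mult.assoc)
  qed
  have left: "\<bar>psum A s ys x - A s x\<bar> \<le> C * 2 powr (- \<theta>) * W + D * W"
    if ys: "admissible s x ys" "x \<le> t" "length ys \<le> length xs" "\<forall>y\<in>set ys. w s y \<le> w s t / 2" for ys x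
  proof (cases ys rule: rev_cases)
    case Nil
    have "0 \<le> C * 2 powr (- \<theta>) * W + D * W" using C_props(1) D W by (intro add_nonneg_nonneg mult_nonneg_nonneg) auto
    thus ?thesis by (simp add: Nil)
  next
    case (snoc ys' y)
    have a: "admissible s y ys'" "s \<le> y" "y \<le> x" using admissible_appendD[of s x ys' y "[]"] ys snoc by auto
    have "\<bar>psum A s ys' y - A s y\<bar> \<le> C * E s y" using less.hyps[of ys' s y] a ys snoc by auto
    also have "\<dots> \<le> C * 2 powr (- \<theta>) * W" using a ys snoc st by (intro part) auto
    finally have 1: "\<bar>psum A s ys' y - A s y\<bar> \<le> C * 2 powr (- \<theta>) * W" .
    have "\<bar>A s x - A s y - A y x\<bar> \<le> D * E s x" using a ys st by (intro almost_additive) auto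
    also have "\<dots> \<le> D * W"
      unfolding W_def using a ys st D nonneg[of s x] \<theta>
      by (intro mult_left_mono powr_mono2 mono) auto
    finally show ?thesis using 1 by (simp add: snoc psum_append abs_if split: if_splits)
  qed
  have "\<bar>psum A s xs t - A s t\<bar> \<le> C * W"
  proof (cases "\<exists>x\<in>set xs. w s x > w s t / 2")
    case False
    have "\<bar>psum A s xs t - A s t\<bar> \<le> (C * 2 powr (- \<theta>) + D) * W"
      using left[of t xs] less.prems False by (auto simp: algebra_simps not_less)
    also have "\<dots> \<le> C * W" using C_props(3) W by (intro mult_right_mono)
    finally show ?thesis .
  next
    case True
    then obtain ys x zs where x: "xs = ys @ x # zs" "w s x > w s t / 2" "\<forall>y\<in>set ys. \<not> w s y > w s t / 2"
      using split_list_first_prop[of xs "\<lambda>x. w s x > w s t / 2"] by blast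
    have a: "admissible s x ys" "admissible x t zs" "s \<le> x" "x \<le> t"
      using admissible_appendD[of s t ys x zs] less.prems x(1) by auto
    have "w s x + w x t \<le> w s t" using a st by (intro superadditive) auto
    hence wx: "w x t \<le> w s t / 2" using x by simp
    have 1: "\<bar>psum A s ys x - A s x\<bar> \<le> C * 2 powr (- \<theta>) * W + D * W"
      using left[of x ys] a x by (auto simp: not_less)
    have "\<bar>psum A x zs t - A x t\<bar> \<le> C * E x t" using less.hyps[of zs x t] a x by simp
    also have "\<dots> \<le> C * 2 powr (- \<theta>) * W" using a st wx by (intro part) auto
    finally have 2: "\<bar>psum A x zs t - A x t\<bar> \<le> C * 2 powr (- \<theta>) * W" .
    have 3: "\<bar>A s t - A s x - A x t\<bar> \<le> D * W" unfolding W_def using a st by (intro almost_additive) auto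
    have "\<bar>psum A s xs t - A s t\<bar> \<le> (C * 2 powr (- \<theta>) + C * 2 powr (- \<theta>) + 2 * D) * W"
      using 1 2 3 by (simp add: x psum_append algebra_simps abs_if split: if_splits)
    thus ?thesis unfolding C_props(2) .
  qed
  thus ?case by (simp add: W_def)
qed

text \<open>Refining a subdivision changes the sum by at most \<open>C\<close> times the sum of \<open>w powr \<theta>\<close> over the coarser one.\<close>
lemma psum_refinement:
  assumes "subseq xs zs" "admissible s t zs"
  shows "\<bar>psum A s zs t - psum A s xs t\<bar> \<le> C * psum E s xs t"
  using assms
proof (induction xs arbitrary: s zs)
  case Nil
  thus ?case using psum_bound by simp
next
  case (Cons x xs)
  then obtain us vs where z: "zs = us @ x # vs" "subseq xs vs"
    using list_emb_ConsD[OF Cons.prems(1)] by auto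
  have a: "admissible s x us" "admissible x t vs" using admissible_appendD[of s t us x vs] Cons.prems z(1) by auto
  show ?case using psum_bound[OF a(1)] Cons.IH[OF z(2) a(2)]
    by (simp add: z psum_append algebra_simps abs_if split: if_splits)
qed

lemma psum_compare:
  assumes "admissible s t xs" "admissible s t ys"
  shows "psum A s xs t - C * psum E s xs t \<le> psum A s ys t + C * psum E s ys t"
proof -
  obtain zs where zs: "sorted zs" "set zs = set xs \<union> set ys" "subseq xs zs" "subseq ys zs"
    using sorted_common_refinement[of xs ys] assms by (auto simp: admissible_def sorted_append)
  have "admissible s t zs" using zs assms by (auto simp: admissible_def sorted_append)
  from psum_refinement[OF zs(3) this] psum_refinement[OF zs(4) this] show ?thesis by linarith
qed

text \<open>Any two of the intervals with centre \<open>psum A s xs t\<close> and radius \<open>C * psum E s xs t\<close> intersect, by passing to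
a common refinement. Hence the supremum of their left endpoints lies in all of them, and no limit along
partitions has to be formed.\<close>
definition sewn :: "real \<Rightarrow> real \<Rightarrow> real" where
  "sewn s t = (SUP xs\<in>{xs. admissible s t xs}. psum A s xs t - C * psum E s xs t)"

lemma psum_sewn:
  assumes "admissible s t xs"
  shows "\<bar>psum A s xs t - sewn s t\<bar> \<le> C * psum E s xs t"
proof -
  have "psum A s xs t - C * psum E s xs t \<le> sewn s t" unfolding sewn_def
    using assms psum_compare[OF _ assms] by (intro cSUP_upper bdd_aboveI2) auto
  moreover have "sewn s t \<le> psum A s xs t + C * psum E s xs t" unfolding sewn_def
    using assms psum_compare[OF _ assms] by (intro cSUP_least) auto
  ultimately show ?thesis by linarith
qed

lemma fine_partition:
  assumes "0 \<le> s" "s \<le> t" "t \<le> T"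
  shows "\<exists>xs. admissible s t xs \<and> psum E s xs t \<le> (2 powr (1 - \<theta>)) ^ n * E s t"
  using assms
proof (induction n arbitrary: s t)
  case 0
  show ?case using 0 by (intro exI[of _ "[]"]) (auto simp: admissible_def)
next
  case (Suc n)
  obtain u where u: "s \<le> u" "u \<le> t" "w s u \<le> w s t / 2" "w u t \<le> w s t / 2"
    using midpoint[OF Suc.prems] .
  define r where "r = (2 powr (1 - \<theta>)) ^ n"
  have r: "r \<ge> 0" by (simp add: r_def)
  obtain xs ys where xs: "admissible s u xs" "psum E s xs u \<le> r * E s u"
    and ys: "admissible u t ys" "psum E u ys t \<le> r * E u t"
    using Suc.IH[of s u] Suc.IH[of u t] u Suc.prems unfolding r_def by fastforce
  have "psum E s (xs @ u # ys) t \<le> r * E s u + r * E u t" using xs ys by (simp add: psum_append)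
  also have "\<dots> \<le> r * (2 powr (- \<theta>) * E s t) + r * (2 powr (- \<theta>) * E s t)"
    using halves_powr_le[of s u t \<theta>] u Suc.prems \<theta> r by (intro add_mono mult_left_mono) auto
  also have "\<dots> = (2 powr (1 - \<theta>)) ^ Suc n * E s t"
    unfolding r_def[symmetric] power_Suc by (simp add: powr_diff powr_minus field_simps)
  finally show ?case using admissible_appendI xs ys by blast
qed

lemma fine_partition_small:
  assumes "0 \<le> s" "s \<le> t" "t \<le> T" "e > 0"
  obtains xs where "admissible s t xs" "C * psum E s xs t < e"
proof -
  have "(\<lambda>n. C * ((2 powr (1 - \<theta>)) ^ n * E s t)) \<longlonglongrightarrow> C * (0 * E s t)"
    using \<theta> by (intro tendsto_mult tendsto_const LIMSEQ_realpow_zero) (auto simp: powr_less_one)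
  hence "eventually (\<lambda>n. C * ((2 powr (1 - \<theta>)) ^ n * E s t) < e) sequentially"
    using assms(4) by (intro order_tendstoD) auto
  then obtain n where n: "C * ((2 powr (1 - \<theta>)) ^ n * E s t) < e"
    by (auto simp: eventually_sequentially)
  obtain xs where xs: "admissible s t xs" "psum E s xs t \<le> (2 powr (1 - \<theta>)) ^ n * E s t"
    using fine_partition[OF assms(1-3)] by blast
  thus ?thesis using that[OF xs(1)] mult_left_mono[OF xs(2) C_props(1)] n by linarith
qed

lemma sewn_additive:
  assumes "0 \<le> s" "s \<le> u" "u \<le> t" "t \<le> T"
  shows "sewn s t = sewn s u + sewn u t"
proof -
  have small: "\<bar>sewn s t - (sewn s u + sewn u t)\<bar> \<le> e" if e: "e > 0" for e
  proof -
    obtain xs where xs: "admissible s u xs" "C * psum E s xs u < e / 4"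
      using fine_partition_small[of s u "e / 4"] e assms by auto
    obtain ys where ys: "admissible u t ys" "C * psum E u ys t < e / 4"
      using fine_partition_small[of u t "e / 4"] e assms by auto
    show ?thesis
      using psum_sewn[OF xs(1)] psum_sewn[OF ys(1)] psum_sewn[OF admissible_appendI[OF xs(1) ys(1)]] xs(2) ys(2)
      unfolding psum_append distrib_left by (simp add: abs_if split: if_splits)
  qed
  have "\<bar>sewn s t - (sewn s u + sewn u t)\<bar> \<le> 0"
  proof (rule field_le_epsilon)
    fix e :: real assume "0 < e"
    from small[OF this] show "\<bar>sewn s t - (sewn s u + sewn u t)\<bar> \<le> 0 + e" by simp
  qed
  thus ?thesis by simp
qed

lemma sewn_close:
  assumes "0 \<le> s" "s \<le> t" "t \<le> T"
  shows "\<bar>sewn s t - A s t\<bar> \<le> C * E s t"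
  using psum_sewn[of s t "[]"] assms by (simp add: admissible_def abs_minus_commute)

end

theorem sewing:
  fixes A :: "real \<Rightarrow> real \<Rightarrow> real"
  assumes "\<theta> > 1" "0 \<le> D"
    and "\<And>s u t. 0 \<le> s \<Longrightarrow> s \<le> u \<Longrightarrow> u \<le> t \<Longrightarrow> t \<le> T \<Longrightarrow> \<bar>A s t - A s u - A u t\<bar> \<le> D * w s t powr \<theta>"
  obtains I C where "0 \<le> C"
    "\<And>s u t. 0 \<le> s \<Longrightarrow> s \<le> u \<Longrightarrow> u \<le> t \<Longrightarrow> t \<le> T \<Longrightarrow> I s t = I s u + I u t"
    "\<And>s t. 0 \<le> s \<Longrightarrow> s \<le> t \<Longrightarrow> t \<le> T \<Longrightarrow> \<bar>I s t - A s t\<bar> \<le> C * w s t powr \<theta>"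
  using that[OF C_props(1)[OF assms refl] sewn_additive[OF assms refl] sewn_close[OF assms refl]] by blast

end

lemma (in variation) control_var: "control var T"
  by unfold_locales (auto simp: var_nonneg var_refl var_superadditive continuous_var)

section \<open>Extension of a multiplicative functional\<close>

text \<open>The part of the tensor product in which both factors have positive degree. On words of length \<open>n\<close> it
involves only levels below \<open>n\<close>.\<close>
definition inner_mult :: "tensor \<Rightarrow> tensor \<Rightarrow> tensor" where
  "inner_mult x y = (\<lambda>v. \<Sum>k=1..<length v. x (take k v) * y (drop k v))"

lemma tensor_mult_Nil: "tensor_mult x y [] = x [] * y []"
  by (simp add: tensor_mult_def)

lemma tensor_mult_Cons: "tensor_mult x y (a # v) = x [] * y (a # v) + tensor_mult (\<lambda>u. x (a # u)) y v"
  by (simp add: tensor_mult_def sum.atMost_Suc_shift del: sum.atMost_Suc)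

lemma tensor_mult_linear_left:
  "tensor_mult (\<lambda>v. c * f v + g v) z v = c * tensor_mult f z v + tensor_mult g z v"
  by (simp add: tensor_mult_def sum.distrib sum_distrib_left algebra_simps)

lemma tensor_mult_assoc: "tensor_mult (tensor_mult x y) z v = tensor_mult x (tensor_mult y z) v"
proof (induction v arbitrary: x)
  case (Cons a v)
  have "tensor_mult (\<lambda>u. tensor_mult x y (a # u)) z v
      = x [] * tensor_mult (\<lambda>u. y (a # u)) z v + tensor_mult (tensor_mult (\<lambda>u. x (a # u)) y) z v"
    unfolding tensor_mult_Cons by (rule tensor_mult_linear_left)
  thus ?case unfolding Cons.IH
    by (simp add: tensor_mult_Cons[of _ z] tensor_mult_Cons[of x "tensor_mult y z"] tensor_mult_Nil algebra_simps)
qed (simp add: tensor_mult_Nil)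

lemma tensor_mult_split:
  assumes "v \<noteq> []"
  shows "tensor_mult x y v = x [] * y v + x v * y [] + inner_mult x y v"
proof -
  have "{..length v} = insert 0 (insert (length v) {1..<length v})" using assms by auto
  thus ?thesis using assms by (simp add: tensor_mult_def inner_mult_def)
qed

lemma inner_mult_cong:
  assumes "\<And>u. length u < length v \<Longrightarrow> x u = x' u" "\<And>u. length u < length v \<Longrightarrow> y u = y' u"
  shows "inner_mult x y v = inner_mult x' y' v"
  unfolding inner_mult_def using assms by (intro sum.cong arg_cong2[where f = times]) auto

lemma tensor_mult_cong:
  assumes "\<And>u. length u \<le> length v \<Longrightarrow> x u = x' u" "\<And>u. length u \<le> length v \<Longrightarrow> y u = y' u"
  shows "tensor_mult x y v = tensor_mult x' y' v"
  unfolding tensor_mult_def using assms by (intro sum.cong arg_cong2[where f = times]) auto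

text \<open>Associativity of the tensor product, freed of the terms of top degree.\<close>
lemma inner_mult_cocycle:
  assumes "x [] = 1" "y [] = 1" "z [] = 1" "v \<noteq> []"
  shows "inner_mult x y v + inner_mult (tensor_mult x y) z v
       = inner_mult y z v + inner_mult x (tensor_mult y z) v"
  using tensor_mult_assoc[of x y z v] assms
  by (simp add: tensor_mult_split[OF assms(4)] tensor_mult_Nil)

lemma tensor_mult_in_tensor_series:
  assumes "x \<in> tensor_series d" "y \<in> tensor_series d"
  shows "tensor_mult x y \<in> tensor_series d"
  unfolding tensor_series_def
proof (intro CollectI allI impI)
  fix v assume "tensor_mult x y v \<noteq> 0"
  then obtain k where "x (take k v) * y (drop k v) \<noteq> 0"
    unfolding tensor_mult_def by (metis (no_types, lifting) sum.neutral)
  hence "set (take k v) \<subseteq> {..<d}" "set (drop k v) \<subseteq> {..<d}"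
    using assms by (auto simp: tensor_series_def)
  moreover have "set v = set (take k v) \<union> set (drop k v)" by (metis append_take_drop_id set_append)
  ultimately show "set v \<subseteq> {..<d}" by simp
qed

lemma finite_words [simp]: "finite (words d n)"
  using finite_lists_length_eq[of "{..<d}" n] by (simp add: words_def conj_commute)

lemma level_norm_nonneg [simp]: "0 \<le> level_norm d n x"
  by (simp add: level_norm_def L2_set_nonneg)

lemma abs_le_level_norm:
  assumes "v \<in> words d n"
  shows "\<bar>x v\<bar> \<le> level_norm d n x"
proof -
  have "L2_set x {v} \<le> L2_set x (words d n)"
    unfolding L2_set_def using assms by (intro real_sqrt_le_mono sum_mono2) auto
  thus ?thesis by (simp add: level_norm_def)
qed

lemma level_norm_product:
  assumes "k \<le> n"
  shows "level_norm d n (\<lambda>v. x (take k v) * y (drop k v)) = level_norm d k x * level_norm d (n - k) y"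
proof -
  have "(\<Sum>v\<in>words d n. (x (take k v) * y (drop k v))\<^sup>2)
      = (\<Sum>(u, v)\<in>words d k \<times> words d (n - k). (x u)\<^sup>2 * (y v)\<^sup>2)"
  proof (rule sum.reindex_bij_witness[of _ "\<lambda>(u, v). u @ v" "\<lambda>v. (take k v, drop k v)"])
    fix v assume v: "v \<in> words d n"
    show "(take k v, drop k v) \<in> words d k \<times> words d (n - k)"
      using v assms set_take_subset[of k v] set_drop_subset[of k v] by (auto simp: words_def)
  qed (use assms in \<open>auto simp: words_def power_mult_distrib\<close>)
  also have "\<dots> = (\<Sum>u\<in>words d k. (x u)\<^sup>2) * (\<Sum>v\<in>words d (n - k). (y v)\<^sup>2)"
    by (simp add: sum_product sum.cartesian_product)
  finally show ?thesis by (simp add: level_norm_def L2_set_def real_sqrt_mult)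
qed

lemma level_norm_sum_le:
  assumes "finite I"
  shows "level_norm d n (\<lambda>v. \<Sum>i\<in>I. f i v) \<le> (\<Sum>i\<in>I. level_norm d n (f i))"
  using assms
proof (induction I rule: finite_induct)
  case (insert i I)
  have "level_norm d n (\<lambda>v. \<Sum>j\<in>insert i I. f j v) = L2_set (\<lambda>v. f i v + (\<Sum>j\<in>I. f j v)) (words d n)"
    using insert.hyps by (simp add: level_norm_def)
  also have "\<dots> \<le> level_norm d n (f i) + level_norm d n (\<lambda>v. \<Sum>j\<in>I. f j v)"
    unfolding level_norm_def by (rule L2_set_triangle_ineq)
  finally show ?case using insert by simp
qed (simp add: level_norm_def L2_set_def)

lemma level_norm_cong:
  assumes "\<And>v. v \<in> words d n \<Longrightarrow> x v = y v"
  shows "level_norm d n x = level_norm d n y"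
  using assms unfolding level_norm_def by (intro L2_set_cong) auto

lemma level_norm_inner_mult_le:
  "level_norm d n (inner_mult x y) \<le> (\<Sum>k=1..<n. level_norm d k x * level_norm d (n - k) y)"
proof -
  have "level_norm d n (inner_mult x y) = level_norm d n (\<lambda>v. \<Sum>k=1..<n. x (take k v) * y (drop k v))"
    by (intro level_norm_cong) (auto simp: inner_mult_def words_def)
  also have "\<dots> \<le> (\<Sum>k=1..<n. level_norm d n (\<lambda>v. x (take k v) * y (drop k v)))"
    by (intro level_norm_sum_le) auto
  also have "\<dots> = (\<Sum>k=1..<n. level_norm d k x * level_norm d (n - k) y)"
    by (intro sum.cong level_norm_product) auto
  finally show ?thesis .
qed

lemma level_norm_tensor_mult_le:
  assumes "x [] = 1" "y [] = 1" "n \<ge> 1"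
  shows "level_norm d n (tensor_mult x y)
    \<le> level_norm d n x + level_norm d n y + level_norm d n (inner_mult x y)"
proof -
  have "level_norm d n (tensor_mult x y) = level_norm d n (\<lambda>v. (x v + y v) + inner_mult x y v)"
  proof (intro level_norm_cong)
    fix v assume "v \<in> words d n"
    hence "v \<noteq> []" using assms(3) by (auto simp: words_def)
    thus "tensor_mult x y v = (x v + y v) + inner_mult x y v" using assms by (simp add: tensor_mult_split)
  qed
  also have "\<dots> \<le> level_norm d n (\<lambda>v. x v + y v) + level_norm d n (inner_mult x y)"
    unfolding level_norm_def by (rule L2_set_triangle_ineq)
  also have "level_norm d n (\<lambda>v. x v + y v) \<le> level_norm d n x + level_norm d n y"
    unfolding level_norm_def by (rule L2_set_triangle_ineq)
  finally show ?thesis by simp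
qed

text \<open>A rough path stripped of its group structure: only the support, the unit constant term, Chen's identity on
the levels up to \<open>int_part p\<close>, continuity, and the bound by a control are kept. The bound is stated with \<open>level_const\<close>.\<close>
locale lyons_setup = control w T for w :: "real \<Rightarrow> real \<Rightarrow> real" and T :: real +
  fixes d :: nat and p :: real and X :: tensor_path
  assumes p: "1 \<le> p" and T: "0 \<le> T"
    and X_Nil: "\<And>s t. (s, t) \<in> time_simplex T \<Longrightarrow> X s t [] = 1"
    and X_series: "\<And>s t. (s, t) \<in> time_simplex T \<Longrightarrow> X s t \<in> tensor_series d"
    and X_cont: "continuous_tensor_path T X"
    and X_chen: "\<And>s u t v. 0 \<le> s \<Longrightarrow> s \<le> u \<Longrightarrow> u \<le> t \<Longrightarrow> t \<le> T \<Longrightarrow> length v \<le> int_part p \<Longrightarrow>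
      tensor_mult (X s u) (X u t) v = X s t v"
    and X_bound: "\<And>s t n. (s, t) \<in> time_simplex T \<Longrightarrow> 1 \<le> n \<Longrightarrow> n \<le> int_part p \<Longrightarrow>
      level_norm d n (X s t) \<le> level_const p n * w s t powr (real n / p)"
begin

text \<open>\<open>S\<close> agrees with \<open>X\<close> on the levels up to \<open>int_part p\<close>, and continuity, Chen's
identity and some bound by the control hold on the levels up to \<open>m\<close>.
Of still higher levels only the
support is restricted.\<close>
definition multiplicative_upto :: "nat \<Rightarrow> tensor_path \<Rightarrow> bool" where
  "multiplicative_upto m S \<longleftrightarrow>
    (\<forall>s t. (s, t) \<in> time_simplex T \<longrightarrow> S s t \<in> tensor_series d \<and> S s t [] = 1) \<and>
    (\<forall>s t v. (s, t) \<in> time_simplex T \<longrightarrow> length v \<le> int_part p \<longrightarrow> S s t v = X s t v) \<and>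
    (\<forall>v. length v \<le> m \<longrightarrow> continuous_on (time_simplex T) (\<lambda>(s, t). S s t v)) \<and>
    (\<forall>s u t v. 0 \<le> s \<longrightarrow> s \<le> u \<longrightarrow> u \<le> t \<longrightarrow> t \<le> T \<longrightarrow> length v \<le> m \<longrightarrow>
       tensor_mult (S s u) (S u t) v = S s t v) \<and>
    (\<forall>n. 1 \<le> n \<longrightarrow> n \<le> m \<longrightarrow> (\<exists>B\<ge>0. \<forall>s t. (s, t) \<in> time_simplex T \<longrightarrow>
       level_norm d n (S s t) \<le> B * w s t powr (real n / p)))"

lemma multiplicative_uptoD:
  assumes "multiplicative_upto m S"
  shows "\<And>s t. (s, t) \<in> time_simplex T \<Longrightarrow> S s t \<in> tensor_series d"
    "\<And>s t. (s, t) \<in> time_simplex T \<Longrightarrow> S s t [] = 1"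
    "\<And>s t v. (s, t) \<in> time_simplex T \<Longrightarrow> length v \<le> int_part p \<Longrightarrow> S s t v = X s t v"
    "\<And>v. length v \<le> m \<Longrightarrow> continuous_on (time_simplex T) (\<lambda>(s, t). S s t v)"
    "\<And>s u t v. 0 \<le> s \<Longrightarrow> s \<le> u \<Longrightarrow> u \<le> t \<Longrightarrow> t \<le> T \<Longrightarrow> length v \<le> m \<Longrightarrow>
       tensor_mult (S s u) (S u t) v = S s t v"
    "\<And>n. 1 \<le> n \<Longrightarrow> n \<le> m \<Longrightarrow> \<exists>B\<ge>0. \<forall>s t. (s, t) \<in> time_simplex T \<longrightarrow>
       level_norm d n (S s t) \<le> B * w s t powr (real n / p)"
  using assms unfolding multiplicative_upto_def by blast+

lemma inner_mult_bound:
  assumes n: "1 \<le> n" and su: "0 \<le> s" "s \<le> u" "u \<le> t" "t \<le> T"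
    and b: "\<And>k. k \<in> {1..<n} \<Longrightarrow> 0 \<le> b k"
    and x: "\<And>k. k \<in> {1..<n} \<Longrightarrow> level_norm d k x \<le> b k * w s u powr (real k / p)"
    and y: "\<And>k. k \<in> {1..<n} \<Longrightarrow> level_norm d k y \<le> b k * w u t powr (real k / p)"
    and W: "w s u \<le> W" "w u t \<le> W"
  shows "level_norm d n (inner_mult x y) \<le> (\<Sum>k=1..<n. b k * b (n - k)) * W powr (real n / p)"
proof -
  have "level_norm d k x * level_norm d (n - k) y \<le> b k * b (n - k) * W powr (real n / p)"
    if k: "k \<in> {1..<n}" for k
  proof -
    have k': "n - k \<in> {1..<n}" using k by auto
    have "level_norm d k x \<le> b k * W powr (real k / p)"
      using order_trans[OF x[OF k] mult_left_mono[OF powr_mono2 b[OF k]]] nonneg[of s u] W su p by simp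
    moreover have "level_norm d (n - k) y \<le> b (n - k) * W powr (real (n - k) / p)"
      using order_trans[OF y[OF k'] mult_left_mono[OF powr_mono2 b[OF k']]] nonneg[of u t] W su p by simp
    ultimately have "level_norm d k x * level_norm d (n - k) y
        \<le> (b k * W powr (real k / p)) * (b (n - k) * W powr (real (n - k) / p))"
      using b[OF k] by (intro mult_mono) auto
    also have "\<dots> = b k * b (n - k) * (W powr (real k / p) * W powr (real (n - k) / p))" by (simp add: mult_ac)
    also have "W powr (real k / p) * W powr (real (n - k) / p) = W powr (real n / p)"
      using k by (simp add: powr_add[symmetric] add_divide_distrib[symmetric] of_nat_diff)
    finally show ?thesis .
  qed
  hence "(\<Sum>k=1..<n. level_norm d k x * level_norm d (n - k) y)
      \<le> (\<Sum>k=1..<n. b k * b (n - k) * W powr (real n / p))" by (intro sum_mono)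
  thus ?thesis using level_norm_inner_mult_le[of d n x y] unfolding sum_distrib_right by linarith
qed

lemma simplexI: "0 \<le> s \<Longrightarrow> s \<le> t \<Longrightarrow> t \<le> T \<Longrightarrow> (s, t) \<in> time_simplex T"
  by (simp add: time_simplex_def)

lemma simplexD: "(s, t) \<in> time_simplex T \<Longrightarrow> 0 \<le> s \<and> s \<le> t \<and> t \<le> T"
  by (simp add: time_simplex_def)

text \<open>An additive function close to a continuous germ is continuous.\<close>
lemma additive_continuous:
  fixes I A :: "real \<Rightarrow> real \<Rightarrow> real"
  assumes add: "\<And>s u t. 0 \<le> s \<Longrightarrow> s \<le> u \<Longrightarrow> u \<le> t \<Longrightarrow> t \<le> T \<Longrightarrow> I s t = I s u + I u t"
    and close: "\<And>s t. 0 \<le> s \<Longrightarrow> s \<le> t \<Longrightarrow> t \<le> T \<Longrightarrow> \<bar>I s t - A s t\<bar> \<le> C * w s t powr \<theta>"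
    and C: "0 \<le> C" and \<theta>: "\<theta> > 0"
    and A: "continuous_on (time_simplex T) (\<lambda>(s, t). A s t)" and A0: "\<And>t. 0 \<le> t \<Longrightarrow> t \<le> T \<Longrightarrow> A t t = 0"
  shows "continuous_on (time_simplex T) (\<lambda>(s, t). I s t)"
proof -
  define h where "h = (\<lambda>s t. \<bar>A s t\<bar> + C * (w 0 t - w 0 s) powr \<theta>)"
  have I_h: "\<bar>I s t\<bar> \<le> h s t" if "0 \<le> s" "s \<le> t" "t \<le> T" for s t
  proof -
    have "w s t powr \<theta> \<le> (w 0 t - w 0 s) powr \<theta>"
      using superadditive[of 0 s t] nonneg[of s t] that \<theta> by (intro powr_mono2) auto
    hence "C * w s t powr \<theta> \<le> C * (w 0 t - w 0 s) powr \<theta>" using C by (rule mult_left_mono)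
    thus ?thesis using close[OF that] unfolding h_def by linarith
  qed
  have F: "continuous_on {0..T} (w 0)" using cont[of 0] by simp
  have Y: "continuous_on {0..T} (I 0)"
    unfolding continuous_on_iff
  proof (intro ballI allI impI)
    fix t e :: real assume t: "t \<in> {0..T}" and e: "e > 0"
    define g where "g = (\<lambda>r. h (min t r) (max t r))"
    have "continuous_on {0..T} (\<lambda>r. (\<lambda>(s, t). A s t) (min t r, max t r))"
      by (rule continuous_on_compose2[OF A]) (use t in \<open>auto intro!: continuous_intros simp: time_simplex_def\<close>)
    moreover have "continuous_on {0..T} (\<lambda>r. w 0 (max t r))" "continuous_on {0..T} (\<lambda>r. w 0 (min t r))"
      by (rule continuous_on_compose2[OF F]; use t in \<open>auto intro!: continuous_intros\<close>)+
    moreover have "w 0 (max t r) - w 0 (min t r) \<ge> 0" if "r \<in> {0..T}" for r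
      using mono[of 0 0 "min t r" "max t r"] that t by auto
    ultimately have "continuous_on {0..T} g"
      unfolding g_def h_def using \<theta> by (intro continuous_intros continuous_on_powr') auto
    then obtain \<delta> where \<delta>: "\<delta> > 0" "\<forall>r\<in>{0..T}. dist r t < \<delta> \<longrightarrow> dist (g r) (g t) < e"
      using t e unfolding continuous_on_iff by blast
    have g0: "g t = 0" using A0 t by (simp add: g_def h_def)
    show "\<exists>\<delta>>0. \<forall>r\<in>{0..T}. dist r t < \<delta> \<longrightarrow> dist (I 0 r) (I 0 t) < e"
    proof (intro exI[of _ \<delta>] conjI ballI impI)
      fix r assume r: "r \<in> {0..T}" "dist r t < \<delta>"
      have "dist (I 0 r) (I 0 t) \<le> g r"
      proof (cases "t \<le> r")
        case True
        thus ?thesis using add[of 0 t r] I_h[of t r] t r by (simp add: g_def dist_real_def)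
      next
        case False
        thus ?thesis using add[of 0 r t] I_h[of r t] t r by (simp add: g_def dist_real_def)
      qed
      also have "g r < e" using \<delta> r g0 by (auto simp: dist_real_def)
      finally show "dist (I 0 r) (I 0 t) < e" .
    qed (use \<delta> in auto)
  qed
  have "continuous_on (time_simplex T) (\<lambda>x. I 0 (snd x) - I 0 (fst x))"
    by (intro continuous_on_diff continuous_on_compose2[OF Y] continuous_intros)
       (auto simp: time_simplex_def)
  thus ?thesis
  proof (rule continuous_on_eq)
    fix x assume "x \<in> time_simplex T"
    thus "I 0 (snd x) - I 0 (fst x) = (\<lambda>(s, t). I s t) x"
      using add[of 0 "fst x" "snd x"] by (auto simp: time_simplex_def)
  qed
qed

text \<open>For a word \<open>v\<close> of length \<open>n = m + 1\<close> the germ \<open>A v s t = inner_mult (S 0 s) (S s t) v\<close> fails to be additive by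
\<open>- inner_mult (S s u) (S u t) v\<close>, which is of order \<open>w s t powr (n / p)\<close> with \<open>n / p > 1\<close>. If \<open>I v\<close> is the
additive function sewn from it, \<open>I v s t - A v s t\<close> satisfies Chen's identity on level \<open>n\<close>.\<close>
lemma extension_step:
  assumes S: "multiplicative_upto m S" and m: "m \<ge> int_part p"
  shows "\<exists>S'. multiplicative_upto (Suc m) S' \<and> (\<forall>s t v. length v \<le> m \<longrightarrow> S' s t v = S s t v)"
proof -
  note S = multiplicative_uptoD[OF S]
  define n where "n = Suc m"
  define \<theta> where "\<theta> = real n / p"
  have \<theta>: "\<theta> > 1" using m int_part_bounds[OF p] p by (simp add: \<theta>_def n_def)
  define A where "A = (\<lambda>v s t. inner_mult (S 0 s) (S s t) v)"
  obtain b where b: "\<And>k. 1 \<le> k \<Longrightarrow> k \<le> m \<Longrightarrow> 0 \<le> b k \<and> (\<forall>s t. (s, t) \<in> time_simplex T \<longrightarrow>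
       level_norm d k (S s t) \<le> b k * w s t powr (real k / p))"
    using S(6) by metis
  define D where "D = (\<Sum>k=1..<n. b k * b (n - k))"
  have D: "0 \<le> D" unfolding D_def using b by (intro sum_nonneg mult_nonneg_nonneg) (auto simp: n_def)
  have wn: "length v = n" "v \<noteq> []" if "v \<in> words d n" for v using that by (auto simp: words_def n_def)
  have defect: "A v s t - A v s u - A v u t = - inner_mult (S s u) (S u t) v"
    if v: "v \<in> words d n" and su: "0 \<le> s" "s \<le> u" "u \<le> t" "t \<le> T" for v s u t
  proof -
    have "inner_mult (tensor_mult (S 0 s) (S s u)) (S u t) v = A v u t"
      unfolding A_def using wn[OF v] su by (intro inner_mult_cong S(5)) (auto simp: n_def)
    moreover have "inner_mult (S 0 s) (tensor_mult (S s u) (S u t)) v = A v s t"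
      unfolding A_def using wn[OF v] su by (intro inner_mult_cong S(5)) (auto simp: n_def)
    moreover have "inner_mult (S 0 s) (S s u) v = A v s u" by (simp add: A_def)
    ultimately show ?thesis
      using inner_mult_cocycle[of "S 0 s" "S s u" "S u t" v] S(2) wn[OF v] su by (simp add: time_simplex_def)
  qed
  have "\<exists>I C. 0 \<le> C \<and> (\<forall>s u t. 0 \<le> s \<longrightarrow> s \<le> u \<longrightarrow> u \<le> t \<longrightarrow> t \<le> T \<longrightarrow> I s t = I s u + I u t) \<and>
      (\<forall>s t. 0 \<le> s \<longrightarrow> s \<le> t \<longrightarrow> t \<le> T \<longrightarrow> \<bar>I s t - A v s t\<bar> \<le> C * w s t powr \<theta>)"
    if v: "v \<in> words d n" for v
  proof -
    have "\<bar>A v s t - A v s u - A v u t\<bar> \<le> D * w s t powr \<theta>"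
      if su: "0 \<le> s" "s \<le> u" "u \<le> t" "t \<le> T" for s u t
    proof -
      have "\<bar>inner_mult (S s u) (S u t) v\<bar> \<le> level_norm d n (inner_mult (S s u) (S u t))"
        using v by (rule abs_le_level_norm)
      also have "\<dots> \<le> D * w s t powr \<theta>"
        unfolding D_def \<theta>_def using su b mono[of s s u t] mono[of s u t t]
        by (intro inner_mult_bound[where s = s and u = u and t = t]) (auto simp: n_def time_simplex_def)
      finally show ?thesis unfolding defect[OF v su] by simp
    qed
    note ineq = this
    show ?thesis
    proof (rule sewing[OF \<theta> D ineq])
      fix I C
      assume 1: "0 \<le> C"
        and 2: "\<And>s u t. 0 \<le> s \<Longrightarrow> s \<le> u \<Longrightarrow> u \<le> t \<Longrightarrow> t \<le> T \<Longrightarrow> I s t = I s u + I u t"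
        and 3: "\<And>s t. 0 \<le> s \<Longrightarrow> s \<le> t \<Longrightarrow> t \<le> T \<Longrightarrow> \<bar>I s t - A v s t\<bar> \<le> C * w s t powr \<theta>"
      show ?thesis
    proof (intro exI[of _ I] exI[of _ C] conjI allI impI)
      show "0 \<le> C" by (rule 1)
      show "I s t = I s u + I u t" if "0 \<le> s" "s \<le> u" "u \<le> t" "t \<le> T" for s u t
        by (rule 2[OF that])
      show "\<bar>I s t - A v s t\<bar> \<le> C * w s t powr \<theta>" if "0 \<le> s" "s \<le> t" "t \<le> T" for s t
        by (rule 3[OF that])
    qed
  qed
  qed
  then obtain I C where IC: "\<And>v. v \<in> words d n \<Longrightarrow> 0 \<le> C v \<and>
      (\<forall>s u t. 0 \<le> s \<longrightarrow> s \<le> u \<longrightarrow> u \<le> t \<longrightarrow> t \<le> T \<longrightarrow> I v s t = I v s u + I v u t) \<and>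
      (\<forall>s t. 0 \<le> s \<longrightarrow> s \<le> t \<longrightarrow> t \<le> T \<longrightarrow> \<bar>I v s t - A v s t\<bar> \<le> C v * w s t powr \<theta>)"
    by metis
  define S' where "S' = (\<lambda>s t v. if v \<in> words d n then I v s t - A v s t else S s t v)"
  have low: "S' s t v = S s t v" if "length v \<le> m" for s t v
    using that by (auto simp: S'_def words_def n_def)
  have series: "S' s t \<in> tensor_series d" if "(s, t) \<in> time_simplex T" for s t
    using S(1)[OF that] by (auto simp: tensor_series_def S'_def words_def)
  have "multiplicative_upto (Suc m) S'"
    unfolding multiplicative_upto_def
  proof (intro conjI allI impI)
    fix s t assume st: "(s, t) \<in> time_simplex T"
    show "S' s t \<in> tensor_series d" using series st .
    show "S' s t [] = 1" using S(2)[OF st] low by simp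
    fix v :: "nat list" assume "length v \<le> int_part p"
    thus "S' s t v = X s t v" using S(3)[OF st] low m by simp
  next
    fix v :: "nat list" assume v: "length v \<le> Suc m"
    show "continuous_on (time_simplex T) (\<lambda>(s, t). S' s t v)"
    proof (cases "v \<in> words d n")
      case False
      show ?thesis
      proof (cases "length v \<le> m")
        case True
        thus ?thesis using S(4)[of v] low by simp
      next
        case f: False
        hence "\<not> set v \<subseteq> {..<d}" using False v by (auto simp: words_def n_def)
        hence "S' s t v = 0" if "(s, t) \<in> time_simplex T" for s t
          using series[OF that] by (auto simp: tensor_series_def)
        thus ?thesis by (intro continuous_on_eq[OF continuous_on_const[of _ 0]]) auto
      qed
    next
      case True
      note IC = IC[OF True]
      have A_cont: "continuous_on (time_simplex T) (\<lambda>(s, t). A v s t)"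
      proof -
        have "continuous_on (time_simplex T) (\<lambda>x. (\<lambda>(s, t). S s t (take k v)) (0, fst x))" if "k \<in> {1..<length v}" for k
          by (rule continuous_on_compose2[OF S(4)[of "take k v"]])
             (use that v in \<open>auto intro!: continuous_intros simp: time_simplex_def\<close>)
        moreover have "continuous_on (time_simplex T) (\<lambda>(s, t). S s t (drop k v))" if "k \<in> {1..<length v}" for k
          using S(4)[of "drop k v"] that v by auto
        ultimately have "continuous_on (time_simplex T)
            (\<lambda>x. \<Sum>k=1..<length v. (\<lambda>(s, t). S s t (take k v)) (0, fst x) * (\<lambda>(s, t). S s t (drop k v)) x)"
          by (intro continuous_on_sum continuous_on_mult) auto
        thus ?thesis by (simp add: A_def inner_mult_def case_prod_unfold)
      qed
      have A0: "A v t t = 0" if t: "0 \<le> t" "t \<le> T" for t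
      proof -
        have "S t t (drop k v) = 0" if k: "k \<in> {1..<length v}" for k
        proof -
          define j where "j = length (drop k v)"
          have j: "1 \<le> j" "j \<le> m" using k v by (auto simp: j_def)
          have "drop k v \<in> words d j" using True set_drop_subset[of k v] by (auto simp: words_def j_def)
          hence "\<bar>S t t (drop k v)\<bar> \<le> level_norm d j (S t t)" by (rule abs_le_level_norm)
          also have "\<dots> \<le> b j * w t t powr (real j / p)" using b[OF j] t by (auto simp: time_simplex_def)
          finally show ?thesis by (simp add: diag)
        qed
        thus ?thesis by (simp add: A_def inner_mult_def)
      qed
      have "continuous_on (time_simplex T) (\<lambda>(s, t). I v s t)"
      proof (rule additive_continuous[of "I v" "A v" "C v" \<theta>])
        show "I v s t = I v s u + I v u t" if "0 \<le> s" "s \<le> u" "u \<le> t" "t \<le> T" for s u t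
          using IC that by blast
        show "\<bar>I v s t - A v s t\<bar> \<le> C v * w s t powr \<theta>" if "0 \<le> s" "s \<le> t" "t \<le> T" for s t
          using IC that by blast
        show "0 \<le> C v" using IC by blast
        show "A v t t = 0" if "0 \<le> t" "t \<le> T" for t by (rule A0[OF that])
      qed (use A_cont \<theta> in simp_all)
      from continuous_on_diff[OF this A_cont] show ?thesis
        using True by (simp add: S'_def case_prod_unfold)
    qed
  next
    fix s u t and v :: "nat list"
    assume su: "0 \<le> s" "s \<le> u" "u \<le> t" "t \<le> T" and v: "length v \<le> Suc m"
    show "tensor_mult (S' s u) (S' u t) v = S' s t v"
    proof (cases "v \<in> words d n")
      case False
      show ?thesis
      proof (cases "length v \<le> m")
        case True
        have "tensor_mult (S' s u) (S' u t) v = tensor_mult (S s u) (S u t) v"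
          using True low by (intro tensor_mult_cong) auto
        thus ?thesis using S(5)[OF su True] low[OF True] by simp
      next
        case f: False
        hence nv: "\<not> set v \<subseteq> {..<d}" using False v by (auto simp: words_def n_def)
        have "tensor_mult (S' s u) (S' u t) \<in> tensor_series d" "S' s t \<in> tensor_series d"
          using su by (auto intro!: tensor_mult_in_tensor_series series simp: time_simplex_def)
        hence "tensor_mult (S' s u) (S' u t) v = 0" "S' s t v = 0"
          using nv unfolding tensor_series_def by blast+
        thus ?thesis by simp
      qed
    next
      case True
      have "inner_mult (S' s u) (S' u t) v = inner_mult (S s u) (S u t) v"
        using wn[OF True] by (intro inner_mult_cong low) (auto simp: n_def)
      moreover have "S' s u [] = 1" "S' u t [] = 1" using S(2) low su by (auto simp: time_simplex_def)
      ultimately have "tensor_mult (S' s u) (S' u t) v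
          = (I v s u - A v s u) + (I v u t - A v u t) + inner_mult (S s u) (S u t) v"
        using True wn[OF True] by (simp add: tensor_mult_split S'_def)
      also have "\<dots> = (I v s u + I v u t) - A v s t" using defect[OF True su] by simp
      also have "I v s u + I v u t = I v s t" using IC[OF True] su by metis
      finally show ?thesis using True by (simp add: S'_def)
    qed
  next
    fix k assume k: "1 \<le> k" "k \<le> Suc m"
    show "\<exists>B\<ge>0. \<forall>s t. (s, t) \<in> time_simplex T \<longrightarrow> level_norm d k (S' s t) \<le> B * w s t powr (real k / p)"
    proof (cases "k \<le> m")
      case True
      have "level_norm d k (S' s t) = level_norm d k (S s t)" for s t
        using True by (intro level_norm_cong low) (auto simp: words_def)
      thus ?thesis using S(6)[OF k(1) True] by simp
    next
      case False
      hence kn: "k = n" using k by (simp add: n_def)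
      show ?thesis
      proof (intro exI[of _ "\<Sum>v\<in>words d n. C v"] conjI allI impI)
        show "0 \<le> (\<Sum>v\<in>words d n. C v)" using IC by (intro sum_nonneg) auto
        fix s t assume st: "(s, t) \<in> time_simplex T"
        have "level_norm d k (S' s t) \<le> (\<Sum>v\<in>words d n. \<bar>S' s t v\<bar>)"
          unfolding level_norm_def kn by (rule L2_set_le_sum_abs)
        also have "\<dots> \<le> (\<Sum>v\<in>words d n. C v * w s t powr (real k / p))"
          using IC simplexD[OF st] by (intro sum_mono) (auto simp: S'_def kn \<theta>_def)
        finally show "level_norm d k (S' s t) \<le> (\<Sum>v\<in>words d n. C v) * w s t powr (real k / p)"
          by (simp add: sum_distrib_right)
      qed
    qed
  qed
  thus ?thesis using low by blast
qed

lemma extension_base: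
  "multiplicative_upto (int_part p) (\<lambda>s t v. if length v \<le> int_part p then X s t v else 0)"
proof -
  define S where "S = (\<lambda>s t v. if length v \<le> int_part p then X s t v else 0)"
  have low: "S s t v = X s t v" if "length v \<le> int_part p" for s t v using that by (simp add: S_def)
  have "multiplicative_upto (int_part p) S"
    unfolding multiplicative_upto_def
  proof (intro conjI allI impI)
    fix s t assume st: "(s, t) \<in> time_simplex T"
    show "S s t \<in> tensor_series d" using X_series[OF st] by (auto simp: tensor_series_def S_def)
    show "S s t [] = 1" using X_Nil[OF st] by (simp add: S_def)
  next
    fix v :: "nat list" assume "length v \<le> int_part p"
    thus "continuous_on (time_simplex T) (\<lambda>(s, t). S s t v)"
      using X_cont by (simp add: continuous_tensor_path_def S_def)
  next
    fix s u t and v :: "nat list"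
    assume su: "0 \<le> s" "s \<le> u" "u \<le> t" "t \<le> T" and v: "length v \<le> int_part p"
    have "tensor_mult (S s u) (S u t) v = tensor_mult (X s u) (X u t) v"
      using v low by (intro tensor_mult_cong) auto
    thus "tensor_mult (S s u) (S u t) v = S s t v" using X_chen[OF su v] low[OF v] by simp
  next
    fix n assume n: "1 \<le> n" "n \<le> int_part p"
    have "level_norm d n (S s t) = level_norm d n (X s t)" for s t
      using n by (intro level_norm_cong low) (auto simp: words_def)
    thus "\<exists>B\<ge>0. \<forall>s t. (s, t) \<in> time_simplex T \<longrightarrow> level_norm d n (S s t) \<le> B * w s t powr (real n / p)"
      using X_bound n level_const_pos[OF p, of n] by (intro exI[of _ "level_const p n"]) auto
  qed (use low in auto)
  thus ?thesis by (simp add: S_def)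
qed

theorem multiplicative_extension:
  "\<exists>S. (\<forall>m. multiplicative_upto m S) \<and> (\<forall>s t. (s, t) \<notin> time_simplex T \<longrightarrow> S s t = (\<lambda>v. 0))"
proof -
  define q where "q = int_part p"
  have "\<exists>f. \<forall>n. multiplicative_upto (q + n) (f n) \<and> (\<forall>s t v. length v \<le> q + n \<longrightarrow> f (Suc n) s t v = f n s t v)"
  proof (rule dependent_nat_choice)
    show "\<exists>S. multiplicative_upto (q + 0) S" using extension_base by (auto simp: q_def)
    fix S n assume "multiplicative_upto (q + n) S"
    thus "\<exists>S'. multiplicative_upto (q + Suc n) S' \<and> (\<forall>s t v. length v \<le> q + n \<longrightarrow> S' s t v = S s t v)"
      using extension_step[of "q + n" S] by (simp add: q_def)
  qed
  then obtain f where f: "\<And>n. multiplicative_upto (q + n) (f n)"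
    "\<And>n s t v. length v \<le> q + n \<Longrightarrow> f (Suc n) s t v = f n s t v" by blast
  have agree: "f (n + k) s t v = f n s t v" if "length v \<le> q + n" for n k s t v
    using that by (induction k) (auto simp: f(2))
  define S where "S = (\<lambda>s t v. if (s, t) \<in> time_simplex T then f (length v) s t v else 0)"
  have S_f: "S s t v = f n s t v" if "(s, t) \<in> time_simplex T" "length v \<le> n" for s t v n
    using agree[of v "length v" "n - length v" s t] that by (simp add: S_def)
  have "multiplicative_upto m S" for m
  proof -
    note F = multiplicative_uptoD[OF f(1)[of m]]
    show ?thesis unfolding multiplicative_upto_def
    proof (intro conjI allI impI)
      fix s t assume st: "(s, t) \<in> time_simplex T"
      show "S s t \<in> tensor_series d"
        unfolding tensor_series_def
      proof (intro CollectI allI impI)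
        fix v assume "S s t v \<noteq> 0"
        hence "f (length v) s t v \<noteq> 0" by (auto simp: S_def split: if_splits)
        thus "set v \<subseteq> {..<d}" using multiplicative_uptoD(1)[OF f(1) st, of "length v"] by (auto simp: tensor_series_def)
      qed
      show "S s t [] = 1" using F(2)[OF st] S_f[OF st, of "[]" m] by simp
      fix v :: "nat list" assume "length v \<le> int_part p"
      thus "S s t v = X s t v"
        using multiplicative_uptoD(3)[OF f(1) st, of v "length v"] st by (simp add: S_def)
    next
      fix v :: "nat list" assume v: "length v \<le> m"
      hence "continuous_on (time_simplex T) (\<lambda>(s, t). f m s t v)" by (intro F(4)) simp
      thus "continuous_on (time_simplex T) (\<lambda>(s, t). S s t v)"
        by (rule continuous_on_eq) (use S_f v in auto)
    next
      fix s u t and v :: "nat list"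
      assume su: "0 \<le> s" "s \<le> u" "u \<le> t" "t \<le> T" and v: "length v \<le> m"
      have st: "(s, u) \<in> time_simplex T" "(u, t) \<in> time_simplex T" "(s, t) \<in> time_simplex T"
        using su by (auto simp: time_simplex_def)
      have "tensor_mult (S s u) (S u t) v = tensor_mult (f m s u) (f m u t) v"
        using v by (intro tensor_mult_cong S_f st) auto
      also have "\<dots> = f m s t v" using su v by (intro F(5)) auto
      finally show "tensor_mult (S s u) (S u t) v = S s t v" using S_f[OF st(3) v] by simp
    next
      fix n assume n: "1 \<le> n" "n \<le> m"
      have "level_norm d n (S s t) = level_norm d n (f m s t)" if "(s, t) \<in> time_simplex T" for s t
        using n by (intro level_norm_cong S_f[OF that]) (auto simp: words_def)
      thus "\<exists>B\<ge>0. \<forall>s t. (s, t) \<in> time_simplex T \<longrightarrow> level_norm d n (S s t) \<le> B * w s t powr (real n / p)"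
        using F(6)[of n] n by auto
    qed
  qed
  thus ?thesis by (intro exI[of _ S]) (auto simp: S_def)
qed

text \<open>The a priori bound, whose constant may depend on \<open>X\<close>, is improved by bisection to the constant
\<open>level_const p n\<close>, level by level.\<close>
theorem factorial_decay:
  assumes S: "\<And>m. multiplicative_upto m S" and n: "1 \<le> n" and st: "(s, t) \<in> time_simplex T"
  shows "level_norm d n (S s t) \<le> level_const p n * w s t powr (real n / p)"
  using n st
proof (induction n arbitrary: s t rule: less_induct)
  case (less n)
  note S = multiplicative_uptoD[OF S[of n]]
  show ?case
  proof (cases "n \<le> int_part p")
    case True
    have "level_norm d n (S s t) = level_norm d n (X s t)"
      using True S(3)[OF less.prems(2)] by (intro level_norm_cong) (auto simp: words_def)
    thus ?thesis using X_bound less.prems True by simp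
  next
    case False
    define \<theta> where "\<theta> = real n / p"
    have \<theta>: "\<theta> > 1" using False int_part_bounds[OF p] p by (simp add: \<theta>_def)
    define D where "D = (\<Sum>j=1..<n. level_const p j * level_const p (n - j))"
    have "D \<le> (2 powr \<theta> - 2) * level_const p n"
      unfolding D_def \<theta>_def using False by (intro level_const_convolution p) auto
    hence "2 powr (- \<theta>) * D \<le> 2 powr (- \<theta>) * ((2 powr \<theta> - 2) * level_const p n)"
      by (intro mult_left_mono) auto
    also have "\<dots> = (2 powr (- \<theta>) * 2 powr \<theta> - 2 powr (- \<theta>) * 2 powr 1) * level_const p n"
      by (simp add: algebra_simps)
    also have "2 powr (- \<theta>) * 2 powr \<theta> - 2 powr (- \<theta>) * 2 powr 1 = 1 - 2 powr (1 - \<theta>)"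
      unfolding powr_add[symmetric] by simp
    finally have D: "2 powr (- \<theta>) * D \<le> (1 - 2 powr (1 - \<theta>)) * level_const p n" .
    obtain B where B: "B \<ge> 0" "\<And>s t. (s, t) \<in> time_simplex T \<Longrightarrow> level_norm d n (S s t) \<le> B * w s t powr \<theta>"
      using S(6)[of n] less.prems unfolding \<theta>_def by auto
    have "level_norm d n (S s t) \<le> level_const p n * w s t powr \<theta>"
    proof (rule bound_by_bisection[OF \<theta> D B(1)])
      show "0 \<le> level_const p n" using level_const_pos[OF p, of n] by simp
      show "level_norm d n (S s t) \<le> B * w s t powr \<theta>" if "0 \<le> s" "s \<le> t" "t \<le> T" for s t
        using B(2)[OF simplexI[OF that]] .
      show "level_norm d n (S s t) \<le> level_norm d n (S s u) + level_norm d n (S u t) + 2 powr (- \<theta>) * D * w s t powr \<theta>"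
        if su: "0 \<le> s" "s \<le> u" "u \<le> t" "t \<le> T" and h: "w s u \<le> w s t / 2" "w u t \<le> w s t / 2" for s u t
      proof -
        have st: "(s, u) \<in> time_simplex T" "(u, t) \<in> time_simplex T" using su by (auto simp: time_simplex_def)
        have "level_norm d n (S s t) = level_norm d n (tensor_mult (S s u) (S u t))"
          using S(5)[OF su] by (intro level_norm_cong) (auto simp: words_def)
        also have "\<dots> \<le> level_norm d n (S s u) + level_norm d n (S u t) + level_norm d n (inner_mult (S s u) (S u t))"
          using S(2) st less.prems by (intro level_norm_tensor_mult_le) auto
        also have "level_norm d n (inner_mult (S s u) (S u t)) \<le> D * (w s t / 2) powr (real n / p)"
          unfolding D_def using less.IH st level_const_pos[OF p] less.prems su h
          by (intro inner_mult_bound[where s = s and u = u and t = t]) (auto simp: less_imp_le)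
        also have "(w s t / 2) powr (real n / p) = 2 powr (- \<theta>) * w s t powr \<theta>"
          using nonneg[of s t] su by (simp add: \<theta>_def powr_divide powr_minus field_simps)
        finally show ?thesis by (simp add: mult_ac)
      qed
    qed (use simplexD[OF less.prems(2)] in auto)
    thus ?thesis by (simp add: \<theta>_def)
  qed
qed

end

section \<open>The signature of a rough path\<close>

lemma partition_sums_le_of_nonneg:
  assumes f: "\<And>a b. 0 \<le> f a b" and M: "\<And>x. x \<in> partition_sums f 0 T \<Longrightarrow> x \<le> M"
    and st: "0 \<le> s" "s \<le> t" "t \<le> T" and x: "x \<in> partition_sums f s t"
  shows "x \<le> M"
proof -
  obtain a where a: "a \<in> partition_sums f 0 s" using partition_sums_nonempty[of 0 s f] st by auto
  obtain b where b: "b \<in> partition_sums f t T" using partition_sums_nonempty[of t T f] st by auto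
  have "a \<ge> 0" using a f by (auto elim!: partition_sumsE intro: sum_nonneg)
  moreover have "b \<ge> 0" using b f by (auto elim!: partition_sumsE intro: sum_nonneg)
  moreover have "a + x + b \<le> M" using a x b by (intro M partition_sums_add)
  ultimately show ?thesis by linarith
qed

lemma additive_telescope:
  fixes D :: "real \<Rightarrow> real \<Rightarrow> real"
  assumes add: "\<And>s u t. 0 \<le> s \<Longrightarrow> s \<le> u \<Longrightarrow> u \<le> t \<Longrightarrow> t \<le> T \<Longrightarrow> D s t = D s u + D u t"
    and u: "is_partition s t k u" and st: "0 \<le> s" "t \<le> T" and j: "j \<le> k"
  shows "D s (u j) = (\<Sum>i<j. D (u i) (u (Suc i)))"
  using j
proof (induction j)
  case 0
  have us: "u 0 = s" "s \<le> T" using u is_partition_range[OF u, of 0] st by (auto simp: is_partition_def)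
  hence "D s s = D s s + D s s" using st by (intro add) auto
  thus ?case using us by simp
next
  case (Suc j)
  have "D s (u (Suc j)) = D s (u j) + D (u j) (u (Suc j))"
    using is_partition_range[OF u, of j] is_partition_range[OF u, of "Suc j"]
      is_partition_le[OF u, of j "Suc j"] Suc.prems st by (intro add) auto
  thus ?case using Suc by simp
qed

text \<open>A continuous additive function \<open>D\<close> of finite \<open>q\<close>-variation with \<open>q < 1\<close> vanishes: along a fine partition
\<open>\<bar>D s t\<bar>\<close> is at most the sum of the increments, each increment \<open>x\<close> being at most \<open>e powr (1 - q) * x powr q\<close>
for a small \<open>e\<close>. The difference of two extensions is of this kind on the first level where they differ.\<close>
lemma additive_low_variation_zero:
  fixes D :: "real \<Rightarrow> real \<Rightarrow> real"
  assumes add: "\<And>s u t. 0 \<le> s \<Longrightarrow> s \<le> u \<Longrightarrow> u \<le> t \<Longrightarrow> t \<le> T \<Longrightarrow> D s t = D s u + D u t"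
    and cont: "continuous_on (time_simplex T) (\<lambda>(s, t). D s t)"
    and q: "0 < q" "q < 1"
    and V: "\<And>s t k u. 0 \<le> s \<Longrightarrow> t \<le> T \<Longrightarrow> is_partition s t k u \<Longrightarrow> (\<Sum>i<k. \<bar>D (u i) (u (Suc i))\<bar> powr q) \<le> V"
    and st: "0 \<le> s" "s \<le> t" "t \<le> T"
  shows "D s t = 0"
proof (cases "s = t")
  case True
  thus ?thesis using add[of s s s] st by simp
next
  case False
  have V0: "V \<ge> 0" using V[of s s 0 "\<lambda>_. s"] st by (simp add: is_partition_def)
  have "\<bar>D s t\<bar> \<le> \<eta>" if \<eta>: "\<eta> > 0" for \<eta>
  proof -
    \<comment> \<open>chosen such that \<open>e powr (1 - q) * V \<le> \<eta>\<close>\<close>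
    define e where "e = (\<eta> / (V + 1)) powr (1 / (1 - q))"
    have e: "e > 0" "e powr (1 - q) = \<eta> / (V + 1)" using \<eta> V0 q by (auto simp: e_def powr_powr)
    obtain \<delta> where \<delta>: "\<delta> > 0" "\<forall>x\<in>time_simplex T. \<forall>y\<in>time_simplex T. dist y x < \<delta> \<longrightarrow>
        dist (case y of (s, t) \<Rightarrow> D s t) (case x of (s, t) \<Rightarrow> D s t) < e"
      using compact_uniformly_continuous[OF cont compact_time_simplex] e(1)
      unfolding uniformly_continuous_on_def by blast
    have small: "\<bar>D a b\<bar> \<le> e" if "0 \<le> a" "a \<le> b" "b \<le> T" "b - a < \<delta>" for a b
    proof -
      have "D a a = D a a + D a a" using that by (intro add) auto
      moreover have "(a, a) \<in> time_simplex T" "(a, b) \<in> time_simplex T" using that by (auto simp: time_simplex_def)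
      moreover have "dist (a, b) (a, a) < \<delta>" using that by (simp add: dist_Pair_Pair dist_real_def)
      ultimately show ?thesis using bspec[OF bspec[OF \<delta>(2), of "(a, a)"], of "(a, b)"] by (simp add: dist_real_def)
    qed
    obtain k :: nat where k: "real k > (t - s) / \<delta>" using reals_Archimedean2 by blast
    have k0: "k > 0" using k st False \<delta>(1) by (cases k) (auto simp: divide_less_0_iff)
    define u where "u = (\<lambda>i. s + (t - s) * real i / real k)"
    have u: "is_partition s t k u" using st False k0 by (auto simp: is_partition_def u_def divide_strict_right_mono)
    have step: "u (Suc i) - u i < \<delta>" for i
    proof -
      have "u (Suc i) - u i = (t - s) / real k" using k0 by (simp add: u_def field_simps)
      also have "\<dots> < \<delta>" using k k0 \<delta>(1) by (simp add: field_simps)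
      finally show ?thesis .
    qed
    have "D s t = (\<Sum>i<k. D (u i) (u (Suc i)))"
      using additive_telescope[where D = D and T = T, OF add u st(1) st(3) order_refl] u
      by (simp add: is_partition_def)
    hence "\<bar>D s t\<bar> \<le> (\<Sum>i<k. \<bar>D (u i) (u (Suc i))\<bar>)" by (simp add: sum_abs)
    also have "\<dots> \<le> (\<Sum>i<k. e powr (1 - q) * \<bar>D (u i) (u (Suc i))\<bar> powr q)"
    proof (rule sum_mono)
      fix i assume i: "i \<in> {..<k}"
      define x where "x = \<bar>D (u i) (u (Suc i))\<bar>"
      have "x \<le> e" unfolding x_def
        using is_partition_range[OF u, of i] is_partition_range[OF u, of "Suc i"]
          is_partition_le[OF u, of i "Suc i"] i st step by (intro small) auto
      hence "x powr (1 - q) * x powr q \<le> e powr (1 - q) * x powr q"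
        using q by (intro mult_right_mono powr_mono2) (auto simp: x_def)
      moreover have "x powr (1 - q) * x powr q = x" by (simp add: powr_add[symmetric] x_def)
      ultimately show "x \<le> e powr (1 - q) * x powr q" by simp
    qed
    also have "\<dots> = e powr (1 - q) * (\<Sum>i<k. \<bar>D (u i) (u (Suc i))\<bar> powr q)" by (simp add: sum_distrib_left)
    also have "\<dots> \<le> e powr (1 - q) * V" using V[OF st(1) st(3) u] by (intro mult_left_mono) auto
    also have "\<dots> = \<eta> * (V / (V + 1))" by (simp add: e)
    also have "\<dots> \<le> \<eta> * 1" using \<eta> V0 by (intro mult_left_mono) auto
    finally show ?thesis by simp
  qed
  from this[of "\<bar>D s t\<bar> / 2"] have "\<not> 0 < \<bar>D s t\<bar>" by auto
  thus ?thesis by simp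
qed

lemma powr_add_le_double:
  assumes "0 \<le> a" "0 \<le> b" "0 < q" "q < (1::real)"
  shows "(a + b) powr q \<le> 2 * (a powr q + b powr q)"
proof -
  have "(a + b) powr q \<le> (2 * max a b) powr q" using assms by (intro powr_mono2) auto
  also have "\<dots> = 2 powr q * max a b powr q" using assms by (intro powr_mult)
  also have "\<dots> \<le> 2 * (a powr q + b powr q)"
  proof (intro mult_mono)
    show "2 powr q \<le> 2" using powr_mono[of q 1 2] assms by simp
  qed (auto simp: max_def)
  finally show ?thesis .
qed

text \<open>On the first level \<open>n\<close> where two extensions could differ, \<open>inner_mult\<close> is the same for both; hence Chen's
identity makes their difference on that level additive, and it has finite \<open>p / n\<close>-variation with \<open>p / n < 1\<close>.\<close>
lemma lyons_extension_unique:
  assumes p: "1 \<le> p" and S: "lyons_extension d p T X S" and S': "lyons_extension d p T X S'"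
    and X: "\<And>s t. (s, t) \<in> time_simplex T \<Longrightarrow> X s t [] = 1"
  shows "S = S'"
proof -
  have nil: "R s t [] = 1" if "lyons_extension d p T X R" "(s, t) \<in> time_simplex T" for R s t
    using that X[OF that(2)] unfolding lyons_extension_def by fastforce
  have chen: "tensor_mult (R s u) (R u t) = R s t"
    if "lyons_extension d p T X R" "0 \<le> s" "s \<le> u" "u \<le> t" "t \<le> T" for R s u t
    using that unfolding lyons_extension_def by blast
  have low: "R s t v = X s t v"
    if "lyons_extension d p T X R" "(s, t) \<in> time_simplex T" "length v \<le> int_part p" for R s t v
    using that unfolding lyons_extension_def by fast
  have series: "R s t \<in> tensor_series d" if "lyons_extension d p T X R" "(s, t) \<in> time_simplex T" for R s t
    using that unfolding lyons_extension_def by fast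
  have var: "\<exists>M. \<forall>s t k u. 0 \<le> s \<longrightarrow> t \<le> T \<longrightarrow> is_partition s t k u \<longrightarrow>
      (\<Sum>i<k. level_norm d n (R (u i) (u (Suc i))) powr (p / real n)) \<le> M"
    if R: "lyons_extension d p T X R" and n: "n \<ge> 1" for R n
  proof -
    have "bdd_above (partition_sums (\<lambda>u v. level_norm d n (R u v) powr (p / real n)) 0 T)"
      using R n unfolding lyons_extension_def by simp
    then obtain M where M: "\<And>x. x \<in> partition_sums (\<lambda>u v. level_norm d n (R u v) powr (p / real n)) 0 T \<Longrightarrow> x \<le> M"
      by (auto simp: bdd_above_def)
    show ?thesis
    proof (intro exI[of _ M] allI impI)
      fix s t k u assume s: "0 \<le> s" "t \<le> T" and u: "is_partition s t k u"
      have "s \<le> t" using is_partition_le[OF u, of 0 k] u by (simp add: is_partition_def)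
      from partition_sums_le_of_nonneg[OF _ M s(1) this s(2)
          partition_sumsI[OF u, of "\<lambda>u v. level_norm d n (R u v) powr (p / real n)"]]
      show "(\<Sum>i<k. level_norm d n (R (u i) (u (Suc i))) powr (p / real n)) \<le> M" by simp
    qed
  qed
  have on: "S s t v = S' s t v" if "(s, t) \<in> time_simplex T" for s t v
    using that
  proof (induction "length v" arbitrary: v s t rule: less_induct)
    case less
    define n where "n = length v"
    show ?case
    proof (cases "n \<le> int_part p \<or> \<not> set v \<subseteq> {..<d}")
      case True
      thus ?thesis
      proof
        assume "n \<le> int_part p"
        thus ?thesis using low[OF S less.prems, of v] low[OF S' less.prems, of v] by (simp add: n_def)
      next
        assume "\<not> set v \<subseteq> {..<d}"
        hence "S s t v = 0" "S' s t v = 0"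
          using series[OF S less.prems] series[OF S' less.prems] unfolding tensor_series_def by blast+
        thus ?thesis by simp
      qed
    next
      case False
      hence v: "v \<in> words d n" "n > int_part p" by (auto simp: words_def n_def)
      have n: "n \<ge> 1" "v \<noteq> []" "p < real n" using v int_part_bounds[OF p] by (auto simp: n_def words_def)
      define q where "q = p / real n"
      have q: "0 < q" "q < 1" using n p by (auto simp: q_def)
      define D where "D = (\<lambda>s t. S s t v - S' s t v)"
      obtain M where M: "\<And>s t k u. 0 \<le> s \<Longrightarrow> t \<le> T \<Longrightarrow> is_partition s t k u \<Longrightarrow>
          (\<Sum>i<k. level_norm d n (S (u i) (u (Suc i))) powr q) \<le> M"
        using var[OF S n(1)] unfolding q_def by blast
      obtain M' where M': "\<And>s t k u. 0 \<le> s \<Longrightarrow> t \<le> T \<Longrightarrow> is_partition s t k u \<Longrightarrow>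
          (\<Sum>i<k. level_norm d n (S' (u i) (u (Suc i))) powr q) \<le> M'"
        using var[OF S' n(1)] unfolding q_def by blast
      have "D s t = 0"
      proof (rule additive_low_variation_zero[where D = D and T = T and q = q and V = "2 * (M + M')"])
        fix s u t assume su: "0 \<le> s" "s \<le> u" "u \<le> t" "t \<le> T"
        have st: "(s, u) \<in> time_simplex T" "(u, t) \<in> time_simplex T" using su by (auto simp: time_simplex_def)
        have "inner_mult (S s u) (S u t) v = inner_mult (S' s u) (S' u t) v"
          by (intro inner_mult_cong less.hyps st)
        moreover have "R s t v = R s u v + R u t v + inner_mult (R s u) (R u t) v"
          if "lyons_extension d p T X R" for R
          using tensor_mult_split[OF n(2), of "R s u" "R u t"] chen[OF that su] nil[OF that st(1)] nil[OF that st(2)]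
          by simp
        from this[OF S] this[OF S'] calculation show "D s t = D s u + D u t" unfolding D_def by linarith
      next
        have "continuous_on (time_simplex T) (\<lambda>(s, t). S s t v)" "continuous_on (time_simplex T) (\<lambda>(s, t). S' s t v)"
          using S S' unfolding lyons_extension_def continuous_tensor_path_def by blast+
        from continuous_on_diff[OF this] show "continuous_on (time_simplex T) (\<lambda>(s, t). D s t)"
          by (simp add: D_def case_prod_unfold)
      next
        fix s t k u assume s: "0 \<le> s" "t \<le> T" and u: "is_partition s t k u"
        have "(\<Sum>i<k. \<bar>D (u i) (u (Suc i))\<bar> powr q)
            \<le> (\<Sum>i<k. 2 * (level_norm d n (S (u i) (u (Suc i))) powr q + level_norm d n (S' (u i) (u (Suc i))) powr q))"
        proof (rule sum_mono)
          fix i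
          define a b where "a = level_norm d n (S (u i) (u (Suc i)))" and "b = level_norm d n (S' (u i) (u (Suc i)))"
          have "\<bar>D (u i) (u (Suc i))\<bar> \<le> a + b"
            using abs_le_level_norm[OF v(1), of "S (u i) (u (Suc i))"] abs_le_level_norm[OF v(1), of "S' (u i) (u (Suc i))"]
            unfolding D_def a_def b_def by linarith
          hence "\<bar>D (u i) (u (Suc i))\<bar> powr q \<le> (a + b) powr q" using q by (intro powr_mono2) auto
          also have "\<dots> \<le> 2 * (a powr q + b powr q)" using q by (intro powr_add_le_double) (auto simp: a_def b_def)
          finally show "\<bar>D (u i) (u (Suc i))\<bar> powr q \<le> 2 * (a powr q + b powr q)" .
        qed
        also have "\<dots> \<le> 2 * (M + M')"
          using M[OF s u] M'[OF s u] by (simp add: sum_distrib_left[symmetric] sum.distrib)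
        finally show "(\<Sum>i<k. \<bar>D (u i) (u (Suc i))\<bar> powr q) \<le> 2 * (M + M')" .
      qed (use q less.prems in \<open>auto simp: time_simplex_def\<close>)
      thus ?thesis by (simp add: D_def)
    qed
  qed
  have off: "R s t = (\<lambda>v. 0)" if "lyons_extension d p T X R" "(s, t) \<notin> time_simplex T" for R s t
    using that unfolding lyons_extension_def by blast
  show ?thesis
  proof (intro ext)
    fix s t v show "S s t v = S' s t v"
      using on[of s t v] off[OF S, of s t] off[OF S', of s t] by (cases "(s, t) \<in> time_simplex T") simp_all
  qed
qed

lemma tensor_truncate_in_tensor_series:
  "x \<in> tensor_series d \<Longrightarrow> tensor_truncate n x \<in> tensor_series d"
  by (auto simp: tensor_series_def tensor_truncate_def)

lemma trunc_mult_in_tensor_series: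
  "x \<in> tensor_series d \<Longrightarrow> y \<in> tensor_series d \<Longrightarrow> trunc_mult n x y \<in> tensor_series d"
  unfolding trunc_mult_def by (intro tensor_truncate_in_tensor_series tensor_mult_in_tensor_series)

lemma trunc_mult_Nil: "trunc_mult n x y [] = x [] * y []"
  by (simp add: trunc_mult_def tensor_truncate_def tensor_mult_Nil)

text \<open>Of the group structure only the support and the constant term matter.\<close>
lemma free_nilpotent_lie_props:
  assumes "x \<in> free_nilpotent_lie d n"
  shows "x \<in> tensor_series d \<and> x [] = 0"
  using assms
proof induction
  case (letter i)
  thus ?case by (auto simp: tensor_series_def tensor_truncate_def)
next
  case (add x y)
  have "set v \<subseteq> {..<d}" if "x v + y v \<noteq> 0" for v
  proof -
    have "x v \<noteq> 0 \<or> y v \<noteq> 0" using that by auto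
    thus ?thesis using add.IH by (auto simp: tensor_series_def)
  qed
  thus ?case using add.IH by (simp add: tensor_series_def)
next
  case (bracket x y)
  have t: "trunc_mult n x y \<in> tensor_series d" "trunc_mult n y x \<in> tensor_series d"
    using bracket.IH by (auto intro: trunc_mult_in_tensor_series)
  have "set v \<subseteq> {..<d}" if "trunc_mult n x y v - trunc_mult n y x v \<noteq> 0" for v
  proof -
    have "trunc_mult n x y v \<noteq> 0 \<or> trunc_mult n y x v \<noteq> 0" using that by auto
    thus ?thesis using t by (auto simp: tensor_series_def)
  qed
  thus ?case using bracket.IH by (simp add: tensor_series_def trunc_mult_Nil)
qed (auto simp: tensor_series_def)

lemma free_nilpotent_group_props:
  assumes "g \<in> free_nilpotent_group d n"
  shows "g \<in> tensor_series d" "g [] = 1"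
proof -
  obtain x where x: "x \<in> free_nilpotent_lie d n" "g = trunc_exp n x"
    using assms by (auto simp: free_nilpotent_group_def)
  note xp = free_nilpotent_lie_props[OF x(1)]
  define P where "P = (\<lambda>k. (trunc_mult n x ^^ k) tensor_one)"
  have P: "P k \<in> tensor_series d" "P k [] = (if k = 0 then 1 else 0)" for k
  proof (induction k)
    case 0
    { case 1 show ?case by (auto simp: P_def tensor_one_def tensor_series_def) }
    { case 2 show ?case by (simp add: P_def tensor_one_def) }
  next
    case (Suc k)
    have eq: "P (Suc k) = trunc_mult n x (P k)" by (simp add: P_def)
    { case 1 show ?case unfolding eq using xp Suc.IH(1) by (intro trunc_mult_in_tensor_series) auto }
    { case 2 show ?case unfolding eq using xp by (simp add: trunc_mult_Nil) }
  qed
  have g: "g v = (\<Sum>k\<le>n. P k v / fact k)" for v by (simp add: x trunc_exp_def P_def)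
  show "g \<in> tensor_series d"
    unfolding tensor_series_def
  proof (intro CollectI allI impI)
    fix v assume "g v \<noteq> 0"
    then obtain k where "P k v / fact k \<noteq> 0" unfolding g by (metis (no_types, lifting) sum.neutral)
    thus "set v \<subseteq> {..<d}" using P(1)[of k] by (auto simp: tensor_series_def)
  qed
  have "g [] = (\<Sum>k\<le>n. if k = 0 then 1 else 0)" unfolding g by (intro sum.cong) (auto simp: P)
  thus "g [] = 1" by simp
qed

lemma continuous_on_Max_family:
  fixes f :: "'i \<Rightarrow> 'a::topological_space \<Rightarrow> real"
  assumes "finite I" "I \<noteq> {}" "\<And>i. i \<in> I \<Longrightarrow> continuous_on A (f i)"
  shows "continuous_on A (\<lambda>x. Max ((\<lambda>i. f i x) ` I))"
  using assms
proof (induction I rule: finite_ne_induct)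
  case (insert i I)
  have "continuous_on A (\<lambda>x. max (f i x) (Max ((\<lambda>i. f i x) ` I)))"
    using insert by (intro continuous_on_max) auto
  thus ?case using insert.hyps by simp
qed simp

lemma group_norm_nonneg:
  assumes "1 \<le> p"
  shows "0 \<le> group_norm d p g"
proof -
  have "0 \<le> (beta_p p * gfact (real 1 / p) * level_norm d 1 g) powr (1 / real 1)" by simp
  also have "\<dots> \<le> group_norm d p g"
    unfolding group_norm_def using int_part_bounds(3)[OF assms] by (intro Max_ge image_eqI[where x = 1]) auto
  finally show ?thesis .
qed

lemma level_norm_le_group_norm:
  assumes p: "1 \<le> p" and i: "1 \<le> i" "i \<le> int_part p"
  shows "level_norm d i g \<le> level_const p i * (group_norm d p g powr p) powr (real i / p)"
proof -
  define c where "c = beta_p p * gfact (real i / p)"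
  have "gfact (real i / p) > 0" using p by (intro gfact_pos) (auto simp: less_le_trans[of _ 0])
  hence c: "c > 0" using beta_p_pos[OF p] by (simp add: c_def)
  have "(c * level_norm d i g) powr (1 / real i) \<le> group_norm d p g"
    unfolding group_norm_def c_def using i by (intro Max_ge image_eqI[where x = i]) auto
  hence "((c * level_norm d i g) powr (1 / real i)) powr real i \<le> group_norm d p g powr real i"
    by (intro powr_mono2) auto
  hence "c * level_norm d i g \<le> group_norm d p g powr real i"
    using i c by (simp add: powr_powr)
  also have "group_norm d p g powr real i = (group_norm d p g powr p) powr (real i / p)"
    using p by (simp add: powr_powr)
  finally have "level_norm d i g \<le> 1 / c * (group_norm d p g powr p) powr (real i / p)"
    using c by (simp add: field_simps)
  also have "\<dots> \<le> level_const p i * (group_norm d p g powr p) powr (real i / p)"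
    using inverse_gfact_le_level_const[OF p i(2)] unfolding c_def by (intro mult_right_mono) auto
  finally show ?thesis .
qed

lemma rough_path_refl:
  assumes X: "rough_path d p T X" and t: "0 \<le> t" "t \<le> T" and v: "v \<noteq> []" "length v \<le> int_part p"
  shows "X t t v = 0"
  using v
proof (induction "length v" arbitrary: v rule: less_induct)
  case less
  have tt: "(t, t) \<in> time_simplex T" using t by (simp add: time_simplex_def)
  hence "X t t \<in> free_nilpotent_group d (int_part p)" using X unfolding rough_path_def by fast
  hence nil: "X t t [] = 1" by (rule free_nilpotent_group_props)
  have "trunc_mult (int_part p) (X t t) (X t t) = X t t" using X t unfolding rough_path_def by blast
  hence "tensor_mult (X t t) (X t t) v = X t t v"
    using less.prems by (metis trunc_mult_def tensor_truncate_def)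
  moreover have "inner_mult (X t t) (X t t) v = 0"
    unfolding inner_mult_def
  proof (rule sum.neutral, rule ballI)
    fix k assume k: "k \<in> {1..<length v}"
    hence "X t t (take k v) = 0" using less.prems by (intro less.hyps) auto
    thus "X t t (take k v) * X t t (drop k v) = 0" by simp
  qed
  ultimately show ?case using less.prems nil by (simp add: tensor_mult_split)
qed

lemma rough_path_variation:
  assumes p: "1 \<le> p" and T: "0 \<le> T" and X: "rough_path d p T X"
  shows "variation (\<lambda>s t. group_norm d p (X s t) powr p) T"
proof
  fix t assume t: "0 \<le> t" "t \<le> T"
  have "level_norm d i (X t t) = 0" if i: "i \<in> {1..int_part p}" for i
  proof -
    have "X t t v = 0" if "v \<in> words d i" for v
      using i that by (intro rough_path_refl[OF X t]) (auto simp: words_def)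
    thus ?thesis by (simp add: level_norm_def L2_set_def)
  qed
  hence "(\<lambda>i. (beta_p p * gfact (real i / p) * level_norm d i (X t t)) powr (1 / real i)) ` {1..int_part p} = {0}"
    using int_part_bounds(3)[OF p] by (auto simp: image_iff)
  thus "group_norm d p (X t t) powr p = 0" by (simp add: group_norm_def)
next
  have Xc: "continuous_on (time_simplex T) (\<lambda>(s, t). X s t v)" for v
    using X by (auto simp: rough_path_def continuous_tensor_path_def)
  have level: "continuous_on (time_simplex T) (\<lambda>x. level_norm d i (X (fst x) (snd x)))" for i
    using Xc unfolding level_norm_def L2_set_def case_prod_unfold by (intro continuous_intros) auto
  have "continuous_on (time_simplex T) (\<lambda>x. group_norm d p (X (fst x) (snd x)))"
    unfolding group_norm_def
  proof (rule continuous_on_Max_family)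
    fix i assume i: "i \<in> {1..int_part p}"
    have "gfact (real i / p) > 0" using p by (intro gfact_pos) (auto simp: less_le_trans[of _ 0])
    hence c: "beta_p p * gfact (real i / p) \<ge> 0" using beta_p_pos[OF p] by simp
    show "continuous_on (time_simplex T)
      (\<lambda>x. (beta_p p * gfact (real i / p) * level_norm d i (X (fst x) (snd x))) powr (1 / real i))"
      using i c by (intro continuous_on_powr' continuous_intros level) auto
  qed (use int_part_bounds(3)[OF p] in auto)
  hence "continuous_on (time_simplex T) (\<lambda>x. group_norm d p (X (fst x) (snd x)) powr p)"
    using p group_norm_nonneg[OF p] by (intro continuous_on_powr' continuous_intros) auto
  thus "continuous_on (time_simplex T) (\<lambda>(s, t). group_norm d p (X s t) powr p)"
    by (simp add: case_prod_unfold)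
next
  show "bdd_above (partition_sums (\<lambda>s t. group_norm d p (X s t) powr p) 0 T)"
    using X by (simp add: rough_path_def)
qed auto

lemma omega_p_eq_var:
  assumes "1 \<le> p" "0 \<le> T" "rough_path d p T X"
  shows "omega_p d p X = variation.var (\<lambda>s t. group_norm d p (X s t) powr p)"
  unfolding omega_p_def variation.var_def[OF rough_path_variation[OF assms]] ..

lemma rough_path_lyons_setup:
  assumes p: "1 \<le> p" and T: "0 \<le> T" and X: "rough_path d p T X"
  shows "lyons_setup (omega_p d p X) T d p X"
proof -
  interpret V: variation "\<lambda>s t. group_norm d p (X s t) powr p" T
    using rough_path_variation[OF assms] .
  note eq = omega_p_eq_var[OF assms]
  interpret control "omega_p d p X" T unfolding eq by (rule V.control_var)
  have g: "X s t \<in> free_nilpotent_group d (int_part p)" if "(s, t) \<in> time_simplex T" for s t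
    using X that unfolding rough_path_def by fast
  show ?thesis
  proof
    show "1 \<le> p" "0 \<le> T" by fact+
    show "X s t [] = 1" "X s t \<in> tensor_series d" if "(s, t) \<in> time_simplex T" for s t
      using free_nilpotent_group_props[OF g[OF that]] by auto
    show "continuous_tensor_path T X" using X by (simp add: rough_path_def)
    show "tensor_mult (X s u) (X u t) v = X s t v"
      if su: "0 \<le> s" "s \<le> u" "u \<le> t" "t \<le> T" and v: "length v \<le> int_part p" for s u t v
    proof -
      have "trunc_mult (int_part p) (X s u) (X u t) = X s t" using X su unfolding rough_path_def by blast
      thus ?thesis using v by (metis trunc_mult_def tensor_truncate_def)
    qed
    show "level_norm d n (X s t) \<le> level_const p n * omega_p d p X s t powr (real n / p)"
      if st: "(s, t) \<in> time_simplex T" and n: "1 \<le> n" "n \<le> int_part p" for s t n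
    proof -
      have "(group_norm d p (X s t) powr p) powr (real n / p) \<le> omega_p d p X s t powr (real n / p)"
        unfolding eq using V.f_le_var[of s t] st p by (intro powr_mono2) (auto simp: time_simplex_def)
      hence "level_const p n * (group_norm d p (X s t) powr p) powr (real n / p)
          \<le> level_const p n * omega_p d p X s t powr (real n / p)"
        using level_const_pos[OF p, of n] by (intro mult_left_mono) auto
      thus ?thesis using level_norm_le_group_norm[OF p n, of d "X s t"] by linarith
    qed
  qed
qed

lemma (in control) partition_sum_le:
  assumes u: "is_partition 0 T k u"
  shows "(\<Sum>i<k. w (u i) (u (Suc i))) \<le> w 0 T"
proof -
  have "(\<Sum>i<j. w (u i) (u (Suc i))) \<le> w 0 (u j)" if "j \<le> k" for j
    using that
  proof (induction j)
    case 0
    thus ?case using u by (simp add: is_partition_def diag)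
  next
    case (Suc j)
    have "w 0 (u j) + w (u j) (u (Suc j)) \<le> w 0 (u (Suc j))"
      using is_partition_range[OF u, of j] is_partition_range[OF u, of "Suc j"]
        is_partition_le[OF u, of j "Suc j"] Suc.prems by (intro superadditive) auto
    thus ?case using Suc by simp
  qed
  from this[of k] show ?thesis using u by (simp add: is_partition_def)
qed

lemma (in lyons_setup) signature_exists:
  assumes S: "\<And>m. multiplicative_upto m S" and S0: "\<And>s t. (s, t) \<notin> time_simplex T \<Longrightarrow> S s t = (\<lambda>v. 0)"
  shows "lyons_extension d p T X S"
  unfolding lyons_extension_def
proof (intro conjI allI impI ballI)
  show "case x of (s, t) \<Rightarrow> S s t \<in> tensor_series d" if "x \<in> time_simplex T" for x
    using multiplicative_uptoD(1)[OF S] that by auto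
  show "case x of (s, t) \<Rightarrow> \<forall>v. length v \<le> int_part p \<longrightarrow> S s t v = X s t v" if "x \<in> time_simplex T" for x
    using multiplicative_uptoD(3)[OF S] that by auto
  show "continuous_tensor_path T S"
    unfolding continuous_tensor_path_def using multiplicative_uptoD(4)[OF S] by blast
  show "tensor_mult (S s u) (S u t) = S s t" if "0 \<le> s \<and> s \<le> u \<and> u \<le> t \<and> t \<le> T" for s u t
  proof
    fix v show "tensor_mult (S s u) (S u t) v = S s t v"
      using multiplicative_uptoD(5)[OF S[of "length v"], of s u t v] that by simp
  qed
  show "S s t = (\<lambda>v. 0)" if "(s, t) \<notin> time_simplex T" for s t using S0[OF that] .
  fix n :: nat assume n: "1 \<le> n"
  define c where "c = level_const p n powr (p / real n)"
  show "bdd_above (partition_sums (\<lambda>u v. level_norm d n (S u v) powr (p / real n)) 0 T)"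
  proof (rule bdd_aboveI)
    fix x assume "x \<in> partition_sums (\<lambda>u v. level_norm d n (S u v) powr (p / real n)) 0 T"
    then obtain k u where u: "is_partition 0 T k u"
      "x = (\<Sum>i<k. level_norm d n (S (u i) (u (Suc i))) powr (p / real n))" by (rule partition_sumsE)
    have "x \<le> (\<Sum>i<k. c * w (u i) (u (Suc i)))"
      unfolding u(2)
    proof (rule sum_mono)
      fix i assume i: "i \<in> {..<k}"
      have st: "(u i, u (Suc i)) \<in> time_simplex T"
        using is_partition_range[OF u(1), of i] is_partition_range[OF u(1), of "Suc i"]
          is_partition_le[OF u(1), of i "Suc i"] i by (auto simp: time_simplex_def)
      have w0: "w (u i) (u (Suc i)) \<ge> 0" using nonneg simplexD[OF st] by blast
      have "level_norm d n (S (u i) (u (Suc i))) powr (p / real n)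
          \<le> (level_const p n * w (u i) (u (Suc i)) powr (real n / p)) powr (p / real n)"
        using factorial_decay[OF S n st] p by (intro powr_mono2) auto
      also have "\<dots> = c * (w (u i) (u (Suc i)) powr (real n / p)) powr (p / real n)"
        unfolding c_def by (rule powr_mult)
      also have "(w (u i) (u (Suc i)) powr (real n / p)) powr (p / real n) = w (u i) (u (Suc i))"
        using w0 n p by (simp add: powr_powr)
      finally show "level_norm d n (S (u i) (u (Suc i))) powr (p / real n) \<le> c * w (u i) (u (Suc i))" .
    qed
    also have "\<dots> \<le> c * w 0 T"
      unfolding sum_distrib_left[symmetric] using partition_sum_le[OF u(1)] by (intro mult_left_mono) (auto simp: c_def)
    finally show "x \<le> c * w 0 T" .
  qed
qed

theorem path_signature_properties:
  assumes p: "1 \<le> p" and T: "0 \<le> T" and X: "rough_path d p T X"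
  shows "\<And>s t. (s, t) \<in> time_simplex T \<Longrightarrow> path_signature d p T X s t [] = 1"
    and "\<And>s u t. 0 \<le> s \<Longrightarrow> s \<le> u \<Longrightarrow> u \<le> t \<Longrightarrow> t \<le> T \<Longrightarrow>
      tensor_mult (path_signature d p T X s u) (path_signature d p T X u t) = path_signature d p T X s t"
    and "\<And>s t n. (s, t) \<in> time_simplex T \<Longrightarrow> 1 \<le> n \<Longrightarrow>
      level_norm d n (path_signature d p T X s t) \<le> level_const p n * omega_p d p X s t powr (real n / p)"
proof -
  interpret lyons_setup "omega_p d p X" T d p X using rough_path_lyons_setup[OF assms] .
  obtain S where S: "\<And>m. multiplicative_upto m S" "\<And>s t. (s, t) \<notin> time_simplex T \<Longrightarrow> S s t = (\<lambda>v. 0)"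
    using multiplicative_extension by blast
  have L: "lyons_extension d p T X S" using signature_exists[OF S] .
  have "path_signature d p T X = S"
    unfolding path_signature_def
  proof (rule the_equality)
    show "lyons_extension d p T X S" by (rule L)
    fix S' assume "lyons_extension d p T X S'"
    thus "S' = S" by (rule lyons_extension_unique[OF p _ L X_Nil])
  qed
  note eq = this
  show "path_signature d p T X s t [] = 1" if "(s, t) \<in> time_simplex T" for s t
    unfolding eq using multiplicative_uptoD(2)[OF S(1) that] .
  show "tensor_mult (path_signature d p T X s u) (path_signature d p T X u t) = path_signature d p T X s t"
    if "0 \<le> s" "s \<le> u" "u \<le> t" "t \<le> T" for s u t
    using L that unfolding eq lyons_extension_def by blast
  show "level_norm d n (path_signature d p T X s t) \<le> level_const p n * omega_p d p X s t powr (real n / p)"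
    if "(s, t) \<in> time_simplex T" "1 \<le> n" for s t n
    unfolding eq using factorial_decay[OF S(1) that(2,1)] .
qed

section \<open>Matrices of the linear equation\<close>

text \<open>The matrix of \<open>A(x\<^sub>n) ... A(x\<^sub>1)\<close> for the word \<open>x\<^sub>1 ... x\<^sub>n\<close>, as a function of row and column index below \<open>e\<close>.\<close>
fun word_matrix :: "nat \<Rightarrow> (nat \<Rightarrow> real mat) \<Rightarrow> nat list \<Rightarrow> nat \<Rightarrow> nat \<Rightarrow> real" where
  "word_matrix e A [] a b = (if a = b then 1 else 0)"
| "word_matrix e A (i # v) a b = (\<Sum>c<e. word_matrix e A v a c * A i $$ (c, b))"

text \<open>Vectors and matrices of size \<open>e\<close> are functions of indices of which only the values below \<open>e\<close> matter;
\<open>vnorm\<close> is the Euclidean and \<open>mnorm\<close> the Frobenius norm.\<close>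
definition apply_matrix :: "nat \<Rightarrow> (nat \<Rightarrow> nat \<Rightarrow> real) \<Rightarrow> (nat \<Rightarrow> real) \<Rightarrow> nat \<Rightarrow> real" where
  "apply_matrix e M v a = (\<Sum>b<e. M a b * v b)"

definition vnorm :: "nat \<Rightarrow> (nat \<Rightarrow> real) \<Rightarrow> real" where
  "vnorm e v = L2_set v {..<e}"

definition mnorm :: "nat \<Rightarrow> (nat \<Rightarrow> nat \<Rightarrow> real) \<Rightarrow> real" where
  "mnorm e M = L2_set (\<lambda>(a, b). M a b) ({..<e} \<times> {..<e})"

lemma vnorm_nonneg [simp]: "0 \<le> vnorm e v"
  by (simp add: vnorm_def L2_set_nonneg)

lemma mnorm_nonneg [simp]: "0 \<le> mnorm e M"
  by (simp add: mnorm_def L2_set_nonneg)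

lemma vnorm_cong: "(\<And>a. a < e \<Longrightarrow> v a = v' a) \<Longrightarrow> vnorm e v = vnorm e v'"
  unfolding vnorm_def by (intro L2_set_cong) auto

lemma vnorm_triangle: "vnorm e (\<lambda>a. v a + v' a) \<le> vnorm e v + vnorm e v'"
  unfolding vnorm_def by (rule L2_set_triangle_ineq)

lemma apply_matrix_cong:
  "(\<And>b. b < e \<Longrightarrow> M a b = M' a b) \<Longrightarrow> (\<And>b. b < e \<Longrightarrow> v b = v' b) \<Longrightarrow> apply_matrix e M v a = apply_matrix e M' v' a"
  unfolding apply_matrix_def by (intro sum.cong arg_cong2[where f = times]) auto

lemma sum_mult_square_le:
  fixes f g :: "'a \<Rightarrow> real"
  shows "(\<Sum>i\<in>I. f i * g i)\<^sup>2 \<le> (\<Sum>i\<in>I. (f i)\<^sup>2) * (\<Sum>i\<in>I. (g i)\<^sup>2)"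
proof -
  have "\<bar>\<Sum>i\<in>I. f i * g i\<bar> \<le> (\<Sum>i\<in>I. \<bar>f i\<bar> * \<bar>g i\<bar>)" by (simp add: sum_abs[THEN order_trans] abs_mult)
  also have "\<dots> \<le> L2_set f I * L2_set g I" by (rule L2_set_mult_ineq)
  finally have "(\<Sum>i\<in>I. f i * g i)\<^sup>2 \<le> (L2_set f I * L2_set g I)\<^sup>2"
    by (simp add: abs_le_square_iff[symmetric] L2_set_nonneg)
  also have "\<dots> = (\<Sum>i\<in>I. (f i)\<^sup>2) * (\<Sum>i\<in>I. (g i)\<^sup>2)"
    by (simp add: power_mult_distrib L2_set_def sum_nonneg)
  finally show ?thesis .
qed

lemma mnorm_square: "(mnorm e M)\<^sup>2 = (\<Sum>a<e. \<Sum>b<e. (M a b)\<^sup>2)"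
  by (simp add: mnorm_def L2_set_def sum_nonneg sum.cartesian_product case_prod_unfold)

lemma vnorm_square: "(vnorm e v)\<^sup>2 = (\<Sum>a<e. (v a)\<^sup>2)"
  by (simp add: vnorm_def L2_set_def sum_nonneg)

lemma vnorm_apply_matrix_le: "vnorm e (apply_matrix e M v) \<le> mnorm e M * vnorm e v"
proof (rule power2_le_imp_le)
  have "(vnorm e (apply_matrix e M v))\<^sup>2 \<le> (\<Sum>a<e. (\<Sum>b<e. (M a b)\<^sup>2) * (\<Sum>b<e. (v b)\<^sup>2))"
    unfolding vnorm_square apply_matrix_def by (intro sum_mono sum_mult_square_le)
  also have "\<dots> = (mnorm e M * vnorm e v)\<^sup>2"
    by (simp add: power_mult_distrib mnorm_square vnorm_square sum_distrib_right)
  finally show "(vnorm e (apply_matrix e M v))\<^sup>2 \<le> (mnorm e M * vnorm e v)\<^sup>2" .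
qed simp

lemma mnorm_mult_square_le:
  "(mnorm e (\<lambda>a b. \<Sum>c<e. M a c * N c b))\<^sup>2 \<le> (mnorm e M)\<^sup>2 * (mnorm e N)\<^sup>2"
proof -
  have "(mnorm e (\<lambda>a b. \<Sum>c<e. M a c * N c b))\<^sup>2
      \<le> (\<Sum>a<e. \<Sum>b<e. (\<Sum>c<e. (M a c)\<^sup>2) * (\<Sum>c<e. (N c b)\<^sup>2))"
    unfolding mnorm_square by (intro sum_mono sum_mult_square_le)
  also have "\<dots> = (mnorm e M)\<^sup>2 * (\<Sum>b<e. \<Sum>c<e. (N c b)\<^sup>2)"
    by (simp add: mnorm_square sum_product)
  also have "(\<Sum>b<e. \<Sum>c<e. (N c b)\<^sup>2) = (mnorm e N)\<^sup>2"
    unfolding mnorm_square by (rule sum.swap)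
  finally show ?thesis .
qed

lemma words_Suc_sum:
  "(\<Sum>v\<in>words d (Suc n). f v) = (\<Sum>i<d. \<Sum>v\<in>words d n. f (i # v))"
proof -
  have "(\<Sum>v\<in>words d (Suc n). f v) = (\<Sum>(i, v)\<in>{..<d} \<times> words d n. f (i # v))"
    by (rule sum.reindex_bij_witness[of _ "\<lambda>(i, v). i # v" "\<lambda>v. (hd v, tl v)"])
       (auto simp: words_def length_Suc_conv)
  thus ?thesis by (simp add: sum.cartesian_product)
qed

lemma words_0: "words d 0 = {[]}"
  by (auto simp: words_def)

lemma word_matrix_single: "a < e \<Longrightarrow> word_matrix e A [i] a b = A i $$ (a, b)"
  by (simp add: if_distrib[where f = "\<lambda>x. x * _"] cong: if_cong)

lemma word_matrix_append:
  assumes "b < e"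
  shows "word_matrix e A (u @ v) a b = (\<Sum>c<e. word_matrix e A v a c * word_matrix e A u c b)"
  using assms
proof (induction u arbitrary: b)
  case Nil
  thus ?case by (simp add: if_distrib[where f = "\<lambda>x. _ * x"] cong: if_cong)
next
  case (Cons i u)
  have "word_matrix e A ((i # u) @ v) a b = (\<Sum>c<e. word_matrix e A (u @ v) a c * A i $$ (c, b))" by simp
  also have "\<dots> = (\<Sum>c<e. (\<Sum>c'<e. word_matrix e A v a c' * word_matrix e A u c' c) * A i $$ (c, b))"
    by (intro sum.cong) (auto simp: Cons.IH)
  also have "\<dots> = (\<Sum>c<e. \<Sum>c'<e. word_matrix e A v a c' * (word_matrix e A u c' c * A i $$ (c, b)))"
    by (simp add: sum_distrib_right mult.assoc)
  also have "\<dots> = (\<Sum>c'<e. \<Sum>c<e. word_matrix e A v a c' * (word_matrix e A u c' c * A i $$ (c, b)))"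
    by (rule sum.swap)
  also have "\<dots> = (\<Sum>c'<e. word_matrix e A v a c' * word_matrix e A (i # u) c' b)"
    by (simp add: sum_distrib_left)
  finally show ?case .
qed

lemma word_action_eq:
  assumes A: "A \<in> linear_fields d e" and v: "set v \<subseteq> {..<d}" and y: "y \<in> carrier_vec e"
  shows "word_action A v y \<in> carrier_vec e \<and>
    (\<forall>a<e. vec_index (word_action A v y) a = apply_matrix e (word_matrix e A v) (vec_index y) a)"
  using v y
proof (induction v arbitrary: y)
  case Nil
  thus ?case by (simp add: word_action_def apply_matrix_def if_distrib[where f = "\<lambda>x. x * _"] cong: if_cong)
next
  case (Cons i v)
  have Ai: "A i \<in> carrier_mat e e" using A Cons.prems by (auto simp: linear_fields_def)
  define y' where "y' = mult_mat_vec (A i) y"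
  have y': "y' \<in> carrier_vec e" using Ai Cons.prems by (auto simp: y'_def)
  have yi: "vec_index y' c = (\<Sum>b<e. A i $$ (c, b) * vec_index y b)" if "c < e" for c
    using that Ai Cons.prems by (auto simp: y'_def scalar_prod_def atLeast0LessThan intro!: sum.cong)
  have eq: "word_action A (i # v) y = word_action A v y'" by (simp add: word_action_def y'_def)
  have IH: "word_action A v y' \<in> carrier_vec e"
    "\<And>a. a < e \<Longrightarrow> vec_index (word_action A v y') a = apply_matrix e (word_matrix e A v) (vec_index y') a"
    using Cons.IH[of y'] Cons.prems y' by auto
  have "vec_index (word_action A v y') a = apply_matrix e (word_matrix e A (i # v)) (vec_index y) a" if "a < e" for a
  proof -
    have "vec_index (word_action A v y') a = (\<Sum>c<e. word_matrix e A v a c * (\<Sum>b<e. A i $$ (c, b) * vec_index y b))"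
      unfolding IH(2)[OF that] apply_matrix_def by (intro sum.cong) (auto simp: yi)
    also have "\<dots> = (\<Sum>c<e. \<Sum>b<e. word_matrix e A v a c * A i $$ (c, b) * vec_index y b)"
      by (simp add: sum_distrib_left mult.assoc)
    also have "\<dots> = (\<Sum>b<e. \<Sum>c<e. word_matrix e A v a c * A i $$ (c, b) * vec_index y b)"
      by (rule sum.swap)
    finally show ?thesis by (simp add: apply_matrix_def sum_distrib_right)
  qed
  thus ?case unfolding eq using IH(1) by blast
qed

text \<open>The matrix of \<open>y \<mapsto> A^{\<otimes>n} y S\<close>.\<close>
definition level_matrix :: "nat \<Rightarrow> nat \<Rightarrow> (nat \<Rightarrow> real mat) \<Rightarrow> nat \<Rightarrow> tensor \<Rightarrow> nat \<Rightarrow> nat \<Rightarrow> real" where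
  "level_matrix d e A n S a b = (\<Sum>v\<in>words d n. S v * word_matrix e A v a b)"

lemma tensor_action_eq:
  assumes A: "A \<in> linear_fields d e" and y: "y \<in> carrier_vec e" and a: "a < e"
  shows "vec_index (tensor_action d e A n y S) a = apply_matrix e (level_matrix d e A n S) (vec_index y) a"
proof -
  have "vec_index (tensor_action d e A n y S) a
      = (\<Sum>v\<in>words d n. S v * apply_matrix e (word_matrix e A v) (vec_index y) a)"
    using a word_action_eq[OF A _ y] by (auto simp: tensor_action_def words_def intro!: sum.cong)
  also have "\<dots> = (\<Sum>v\<in>words d n. \<Sum>b<e. S v * word_matrix e A v a b * vec_index y b)"
    by (simp add: apply_matrix_def sum_distrib_left mult.assoc)
  also have "\<dots> = (\<Sum>b<e. \<Sum>v\<in>words d n. S v * word_matrix e A v a b * vec_index y b)"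
    by (rule sum.swap)
  finally show ?thesis by (simp add: apply_matrix_def level_matrix_def sum_distrib_right)
qed

lemma level_matrix_0: "level_matrix d e A 0 S a b = S [] * (if a = b then 1 else 0)"
  by (simp add: level_matrix_def words_0)

lemma level_matrix_tensor_mult:
  assumes "b < e"
  shows "level_matrix d e A n (tensor_mult S S') a b
    = (\<Sum>c<e. \<Sum>k\<le>n. level_matrix d e A k S c b * level_matrix d e A (n - k) S' a c)"
proof -
  have split: "(\<Sum>v\<in>words d n. f (take k v) (drop k v)) = (\<Sum>u\<in>words d k. \<Sum>v\<in>words d (n - k). f u v)"
    if "k \<le> n" for k and f :: "nat list \<Rightarrow> nat list \<Rightarrow> real"
  proof -
    have "(\<Sum>v\<in>words d n. f (take k v) (drop k v)) = (\<Sum>(u, v)\<in>words d k \<times> words d (n - k). f u v)"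
    proof (rule sum.reindex_bij_witness[of _ "\<lambda>(u, v). u @ v" "\<lambda>v. (take k v, drop k v)"])
      fix v assume v: "v \<in> words d n"
      show "(take k v, drop k v) \<in> words d k \<times> words d (n - k)"
        using v that set_take_subset[of k v] set_drop_subset[of k v] by (auto simp: words_def)
    qed (use that in \<open>auto simp: words_def\<close>)
    thus ?thesis by (simp add: sum.cartesian_product)
  qed
  have "level_matrix d e A n (tensor_mult S S') a b
      = (\<Sum>v\<in>words d n. \<Sum>k\<le>n. S (take k v) * S' (drop k v) * word_matrix e A (take k v @ drop k v) a b)"
    unfolding level_matrix_def tensor_mult_def sum_distrib_right by (intro sum.cong) (auto simp: words_def)
  also have "\<dots> = (\<Sum>k\<le>n. \<Sum>v\<in>words d n. S (take k v) * S' (drop k v) * word_matrix e A (take k v @ drop k v) a b)"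
    by (rule sum.swap)
  also have "\<dots> = (\<Sum>k\<le>n. \<Sum>u\<in>words d k. \<Sum>v\<in>words d (n - k). S u * S' v * word_matrix e A (u @ v) a b)"
    by (intro sum.cong split) auto
  also have "\<dots> = (\<Sum>k\<le>n. \<Sum>c<e. level_matrix d e A k S c b * level_matrix d e A (n - k) S' a c)"
  proof (intro sum.cong refl)
    fix k
    have "(\<Sum>u\<in>words d k. \<Sum>v\<in>words d (n - k). S u * S' v * word_matrix e A (u @ v) a b)
       = (\<Sum>u\<in>words d k. \<Sum>v\<in>words d (n - k). \<Sum>c<e. (S u * word_matrix e A u c b) * (S' v * word_matrix e A v a c))"
      by (simp add: word_matrix_append[OF assms] sum_distrib_left mult_ac)
    also have "\<dots> = (\<Sum>u\<in>words d k. \<Sum>c<e. \<Sum>v\<in>words d (n - k). (S u * word_matrix e A u c b) * (S' v * word_matrix e A v a c))"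
      by (intro sum.cong refl sum.swap)
    also have "\<dots> = (\<Sum>c<e. \<Sum>u\<in>words d k. \<Sum>v\<in>words d (n - k). (S u * word_matrix e A u c b) * (S' v * word_matrix e A v a c))"
      by (rule sum.swap)
    finally show "(\<Sum>u\<in>words d k. \<Sum>v\<in>words d (n - k). S u * S' v * word_matrix e A (u @ v) a b)
       = (\<Sum>c<e. level_matrix d e A k S c b * level_matrix d e A (n - k) S' a c)"
      by (simp add: level_matrix_def sum_product)
  qed
  also have "\<dots> = (\<Sum>c<e. \<Sum>k\<le>n. level_matrix d e A k S c b * level_matrix d e A (n - k) S' a c)"
    by (rule sum.swap)
  finally show ?thesis .
qed

text \<open>Level zero is excluded, since the Frobenius norm of the identity depends on the dimension.\<close>
lemma sum_mnorm_word_matrix_le: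
  "(\<Sum>v\<in>words d (Suc n). (mnorm e (word_matrix e A v))\<^sup>2) \<le> ((frobenius_norm d e A)\<^sup>2) ^ Suc n"
proof (induction n)
  have frob: "(\<Sum>i<d. (mnorm e (\<lambda>a b. A i $$ (a, b)))\<^sup>2) = (frobenius_norm d e A)\<^sup>2"
    by (simp add: mnorm_square frobenius_norm_def L2_set_def sum_nonneg sum.cartesian_product case_prod_unfold)
  {
    case 0
    have "mnorm e (word_matrix e A [i]) = mnorm e (\<lambda>a b. A i $$ (a, b))" for i
      unfolding mnorm_def
    proof (rule L2_set_cong[OF refl])
      fix x assume "x \<in> {..<e} \<times> {..<e}"
      thus "(case x of (a, b) \<Rightarrow> word_matrix e A [i] a b) = (case x of (a, b) \<Rightarrow> A i $$ (a, b))"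
        by (auto simp: word_matrix_single simp del: word_matrix.simps)
    qed
    thus ?case by (simp add: words_Suc_sum words_0 frob del: word_matrix.simps)
  next
    case (Suc n)
    have "(\<Sum>v\<in>words d (Suc (Suc n)). (mnorm e (word_matrix e A v))\<^sup>2)
        = (\<Sum>i<d. \<Sum>v\<in>words d (Suc n). (mnorm e (\<lambda>a b. \<Sum>c<e. word_matrix e A v a c * A i $$ (c, b)))\<^sup>2)"
    proof -
      have "word_matrix e A (i # v) = (\<lambda>a b. \<Sum>c<e. word_matrix e A v a c * A i $$ (c, b))" for i v
        by (intro ext) simp
      thus ?thesis unfolding words_Suc_sum[where n = "Suc n"] by simp
    qed
    also have "\<dots> \<le> (\<Sum>i<d. \<Sum>v\<in>words d (Suc n). (mnorm e (word_matrix e A v))\<^sup>2 * (mnorm e (\<lambda>a b. A i $$ (a, b)))\<^sup>2)"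
      by (intro sum_mono mnorm_mult_square_le)
    also have "\<dots> = (\<Sum>v\<in>words d (Suc n). (mnorm e (word_matrix e A v))\<^sup>2) * (frobenius_norm d e A)\<^sup>2"
      unfolding frob[symmetric] by (subst sum.swap) (simp add: sum_product)
    also have "\<dots> \<le> ((frobenius_norm d e A)\<^sup>2) ^ Suc n * (frobenius_norm d e A)\<^sup>2"
      by (intro mult_right_mono Suc) simp
    finally show ?case by (simp add: mult_ac)
  }
qed

lemma mnorm_level_matrix_le:
  assumes n: "n \<ge> 1" and A: "frobenius_norm d e A \<le> r"
  shows "mnorm e (level_matrix d e A n S) \<le> level_norm d n S * r ^ n"
proof -
  define F where "F = frobenius_norm d e A"
  have F: "0 \<le> F" "F \<le> r" using A by (auto simp: F_def frobenius_norm_def L2_set_nonneg)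
  obtain k where k: "n = Suc k" using n by (cases n) auto
  have "(mnorm e (level_matrix d e A n S))\<^sup>2
      \<le> (\<Sum>a<e. \<Sum>b<e. (\<Sum>v\<in>words d n. (S v)\<^sup>2) * (\<Sum>v\<in>words d n. (word_matrix e A v a b)\<^sup>2))"
    unfolding mnorm_square level_matrix_def by (intro sum_mono sum_mult_square_le)
  also have "\<dots> = (level_norm d n S)\<^sup>2 * (\<Sum>a<e. \<Sum>b<e. \<Sum>v\<in>words d n. (word_matrix e A v a b)\<^sup>2)"
    by (simp add: level_norm_def L2_set_def sum_nonneg sum_distrib_left)
  also have "(\<Sum>a<e. \<Sum>b<e. \<Sum>v\<in>words d n. (word_matrix e A v a b)\<^sup>2)
      = (\<Sum>a<e. \<Sum>v\<in>words d n. \<Sum>b<e. (word_matrix e A v a b)\<^sup>2)"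
    by (intro sum.cong refl sum.swap)
  also have "\<dots> = (\<Sum>v\<in>words d n. (mnorm e (word_matrix e A v))\<^sup>2)"
    unfolding mnorm_square by (rule sum.swap)
  also have "(level_norm d n S)\<^sup>2 * \<dots> \<le> (level_norm d n S)\<^sup>2 * (F\<^sup>2) ^ n"
    unfolding k F_def by (intro mult_left_mono sum_mnorm_word_matrix_le) auto
  also have "\<dots> = (level_norm d n S * F ^ n)\<^sup>2" by (simp add: power_mult_distrib power_mult[symmetric] mult.commute)
  finally have "mnorm e (level_matrix d e A n S) \<le> level_norm d n S * F ^ n"
    by (rule power2_le_imp_le) (use F in simp)
  also have "\<dots> \<le> level_norm d n S * r ^ n" using F by (intro mult_left_mono power_mono) auto
  finally show ?thesis .
qed

lemma abs_le_mnorm: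
  assumes "a < e" "b < e"
  shows "\<bar>M a b\<bar> \<le> mnorm e M"
proof -
  have "L2_set (\<lambda>(a, b). M a b) {(a, b)} \<le> mnorm e M"
    unfolding mnorm_def L2_set_def using assms by (intro real_sqrt_le_mono sum_mono2) auto
  thus ?thesis by simp
qed

lemma mnorm_suminf_le:
  assumes f: "\<And>n. mnorm e (f n) \<le> g n" and g: "summable g"
  shows "mnorm e (\<lambda>a b. \<Sum>n. f n a b) \<le> (\<Sum>n. g n)"
proof -
  have sf: "(\<lambda>n. f n a b) sums (\<Sum>n. f n a b)" if "a < e" "b < e" for a b
    by (intro summable_sums summable_comparison_test[OF _ g] exI[of _ 0] allI impI)
       (use order_trans[OF abs_le_mnorm[OF that] f] in auto)
  have partial: "mnorm e (\<lambda>a b. \<Sum>i<n. f i a b) \<le> (\<Sum>i<n. g i)" for n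
  proof (induction n)
    case (Suc n)
    have "mnorm e (\<lambda>a b. \<Sum>i<Suc n. f i a b) = L2_set (\<lambda>x. (case x of (a, b) \<Rightarrow> \<Sum>i<n. f i a b) + (case x of (a, b) \<Rightarrow> f n a b)) ({..<e} \<times> {..<e})"
      unfolding mnorm_def by (intro L2_set_cong) auto
    also have "\<dots> \<le> mnorm e (\<lambda>a b. \<Sum>i<n. f i a b) + mnorm e (f n)"
      unfolding mnorm_def by (rule L2_set_triangle_ineq)
    finally show ?case using Suc f[of n] by simp
  qed (simp add: mnorm_def L2_set_def)
  have "(\<lambda>n. mnorm e (\<lambda>a b. \<Sum>i<n. f i a b)) \<longlonglongrightarrow> mnorm e (\<lambda>a b. \<Sum>n. f n a b)"
    unfolding mnorm_def L2_set_def
  proof (intro tendsto_real_sqrt tendsto_sum)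
    fix x assume "x \<in> {..<e} \<times> {..<e}"
    then obtain a b where x: "x = (a, b)" "a < e" "b < e" by auto
    have "(\<lambda>n. \<Sum>i<n. f i a b) \<longlonglongrightarrow> (\<Sum>n. f n a b)" using sf[OF x(2,3)] by (simp add: sums_def)
    thus "(\<lambda>n. (case x of (a, b) \<Rightarrow> \<Sum>i<n. f i a b)\<^sup>2) \<longlonglongrightarrow> (case x of (a, b) \<Rightarrow> \<Sum>n. f n a b)\<^sup>2"
      unfolding x(1) prod.case by (intro tendsto_power)
  qed
  moreover have "(\<lambda>n. \<Sum>i<n. g i) \<longlonglongrightarrow> (\<Sum>n. g n)" using g by (rule summable_LIMSEQ)
  ultimately show ?thesis using partial by (intro LIMSEQ_le) auto
qed

section \<open>Solution flow and Euler scheme\<close>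

text \<open>A multiplicative functional \<open>S\<close> with the bound \<open>c n * w s t powr (n / p)\<close> on level \<open>n\<close>, and a linear vector
field of norm at most \<open>r\<close>.\<close>
locale linear_equation = control w T for w :: "real \<Rightarrow> real \<Rightarrow> real" and T :: real +
  fixes d e :: nat and A :: "nat \<Rightarrow> real mat" and r p :: real and S :: tensor_path and c :: "nat \<Rightarrow> real"
  assumes p: "1 \<le> p" and r: "0 \<le> r" and T: "0 \<le> T"
    and A: "frobenius_norm d e A \<le> r"
    and S_Nil: "\<And>s t. (s, t) \<in> time_simplex T \<Longrightarrow> S s t [] = 1"
    and S_chen: "\<And>s u t. 0 \<le> s \<Longrightarrow> s \<le> u \<Longrightarrow> u \<le> t \<Longrightarrow> t \<le> T \<Longrightarrow> tensor_mult (S s u) (S u t) = S s t"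
    and S_bound: "\<And>s t n. (s, t) \<in> time_simplex T \<Longrightarrow> 1 \<le> n \<Longrightarrow>
      level_norm d n (S s t) \<le> c n * w s t powr (real n / p)"
    and c: "\<And>n. 0 \<le> c n" "\<And>x. 0 \<le> x \<Longrightarrow> summable (\<lambda>n. c n * x ^ n)"
begin

text \<open>\<open>size s t\<close> is the argument of the power series that dominates the solution on \<open>[s, t]\<close>, \<open>flow s t\<close> and
\<open>step N s t\<close> are the matrices of the solution map and of one Euler step, and \<open>tail N\<close> bounds their
difference; \<open>1 + tail 0\<close> bounds the solution map itself.\<close>
definition size :: "real \<Rightarrow> real \<Rightarrow> real" where
  "size s t = r * w s t powr (1 / p)"

definition level :: "nat \<Rightarrow> real \<Rightarrow> real \<Rightarrow> nat \<Rightarrow> nat \<Rightarrow> real" where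
  "level n s t = level_matrix d e A n (S s t)"

definition flow :: "real \<Rightarrow> real \<Rightarrow> nat \<Rightarrow> nat \<Rightarrow> real" where
  "flow s t a b = (\<Sum>n. level n s t a b)"

definition step :: "nat \<Rightarrow> real \<Rightarrow> real \<Rightarrow> nat \<Rightarrow> nat \<Rightarrow> real" where
  "step N s t a b = (\<Sum>n\<le>N. level n s t a b)"

definition tail :: "nat \<Rightarrow> real \<Rightarrow> real" where
  "tail N x = (\<Sum>n. c (n + Suc N) * x ^ (n + Suc N))"

lemma size_nonneg: "0 \<le> size s t"
  using r by (simp add: size_def)

lemma size_mono:
  assumes "0 \<le> s" "s \<le> s'" "s' \<le> t'" "t' \<le> t" "t \<le> T"
  shows "size s' t' \<le> size s t"
  unfolding size_def using assms mono[OF assms] nonneg[of s' t'] p r by (intro mult_left_mono powr_mono2) auto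

lemma mnorm_level_le:
  assumes "(s, t) \<in> time_simplex T" "1 \<le> n"
  shows "mnorm e (level n s t) \<le> c n * size s t ^ n"
proof -
  have w0: "0 \<le> w s t" using assms nonneg by (auto simp: time_simplex_def)
  have "mnorm e (level n s t) \<le> level_norm d n (S s t) * r ^ n"
    unfolding level_def by (rule mnorm_level_matrix_le[OF assms(2) A])
  also have "\<dots> \<le> (c n * w s t powr (real n / p)) * r ^ n"
    using S_bound[OF assms] r by (intro mult_right_mono) auto
  also have "w s t powr (real n / p) = (w s t powr (1 / p)) ^ n"
  proof (cases "w s t = 0")
    case False
    hence "(w s t powr (1 / p)) ^ n = (w s t powr (1 / p)) powr real n" using w0 by (simp add: powr_realpow)
    thus ?thesis by (simp add: powr_powr)
  qed (use assms(2) p in auto)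
  finally show ?thesis by (simp add: size_def power_mult_distrib mult_ac)
qed

lemma summable_tail: "0 \<le> x \<Longrightarrow> summable (\<lambda>n. c (n + k) * x ^ (n + k))"
  using summable_iff_shift[of "\<lambda>n. c n * x ^ n" k] c(2) by simp

lemma tail_nonneg: "0 \<le> x \<Longrightarrow> 0 \<le> tail N x"
  unfolding tail_def using summable_tail[of x "Suc N"] c by (intro suminf_nonneg) auto

lemma tail_mono:
  assumes "0 \<le> x" "x \<le> y"
  shows "tail N x \<le> tail N y"
  unfolding tail_def using summable_tail[of x "Suc N"] summable_tail[of y "Suc N"] assms c
  by (intro suminf_le mult_left_mono power_mono) auto

lemma summable_level:
  assumes "(s, t) \<in> time_simplex T" "a < e" "b < e"
  shows "summable (\<lambda>n. \<bar>level n s t a b\<bar>)"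
proof (rule summable_comparison_test)
  show "summable (\<lambda>n. c n * size s t ^ n)" by (intro c size_nonneg)
  show "\<exists>N. \<forall>n\<ge>N. norm \<bar>level n s t a b\<bar> \<le> c n * size s t ^ n"
    using order_trans[OF abs_le_mnorm[OF assms(2,3)] mnorm_level_le[OF assms(1)]]
    by (intro exI[of _ 1]) auto
qed

text \<open>The flow property, by Chen's identity and the Cauchy product of absolutely convergent series.\<close>
lemma flow_compose:
  assumes su: "0 \<le> s" "s \<le> u" "u \<le> t" "t \<le> T" and ab: "a < e" "b < e"
  shows "flow s t a b = (\<Sum>k<e. flow u t a k * flow s u k b)"
proof -
  have st: "(s, u) \<in> time_simplex T" "(u, t) \<in> time_simplex T" using su by (auto simp: time_simplex_def)
  have "(\<lambda>n. \<Sum>k<e. \<Sum>i\<le>n. level i s u k b * level (n - i) u t a k) sums (\<Sum>k<e. flow s u k b * flow u t a k)"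
    unfolding flow_def using summable_level[OF st(1) _ ab(2)] summable_level[OF st(2) ab(1)]
    by (intro sums_sum Cauchy_product_sums) auto
  moreover have "(\<Sum>k<e. \<Sum>i\<le>n. level i s u k b * level (n - i) u t a k) = level n s t a b" for n
    unfolding level_def S_chen[OF su, symmetric] level_matrix_tensor_mult[OF ab(2)] ..
  ultimately show ?thesis by (simp add: flow_def sums_iff mult.commute)
qed

lemma apply_flow_compose:
  assumes su: "0 \<le> s" "s \<le> u" "u \<le> t" "t \<le> T" and a: "a < e"
  shows "apply_matrix e (flow s t) v a = apply_matrix e (flow u t) (apply_matrix e (flow s u) v) a"
proof -
  have "apply_matrix e (flow s t) v a = (\<Sum>b<e. \<Sum>k<e. flow u t a k * (flow s u k b * v b))"
    unfolding apply_matrix_def by (intro sum.cong) (auto simp: flow_compose[OF su a] sum_distrib_right mult.assoc)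
  also have "\<dots> = (\<Sum>k<e. \<Sum>b<e. flow u t a k * (flow s u k b * v b))" by (rule sum.swap)
  finally show ?thesis by (simp add: apply_matrix_def sum_distrib_left)
qed

lemma flow_minus_step:
  assumes st: "(s, t) \<in> time_simplex T" and ab: "a < e" "b < e"
  shows "flow s t a b = step N s t a b + (\<Sum>n. level (n + Suc N) s t a b)"
proof -
  have "summable (\<lambda>n. level n s t a b)" using summable_level[OF st ab] by (rule summable_rabs_cancel)
  from suminf_split_initial_segment[OF this, of "Suc N"]
  show ?thesis by (simp add: flow_def step_def lessThan_Suc_atMost)
qed

lemma remainder_le:
  assumes st: "(s, t) \<in> time_simplex T"
  shows "mnorm e (\<lambda>a b. \<Sum>n. level (n + Suc N) s t a b) \<le> tail N (size s t)"
  unfolding tail_def by (intro mnorm_suminf_le mnorm_level_le summable_tail size_nonneg st) auto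

lemma apply_flow_minus_step:
  assumes st: "(s, t) \<in> time_simplex T" and a: "a < e"
  shows "apply_matrix e (flow s t) v a
    = apply_matrix e (step N s t) v a + apply_matrix e (\<lambda>a b. \<Sum>n. level (n + Suc N) s t a b) v a"
proof -
  have "apply_matrix e (flow s t) v a = apply_matrix e (\<lambda>a b. step N s t a b + (\<Sum>n. level (n + Suc N) s t a b)) v a"
    by (rule apply_matrix_cong) (use flow_minus_step[OF st a] in auto)
  thus ?thesis by (simp add: apply_matrix_def sum.distrib distrib_right)
qed

lemma vnorm_flow_le:
  assumes st: "(s, t) \<in> time_simplex T"
  shows "vnorm e (apply_matrix e (flow s t) v) \<le> (1 + tail 0 (size s t)) * vnorm e v"
proof -
  define R where "R = (\<lambda>a b. \<Sum>n. level (n + Suc 0) s t a b)"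
  have step0: "apply_matrix e (step 0 s t) v a = v a" if "a < e" for a
  proof -
    have "step 0 s t a b = (if a = b then 1 else 0)" for b
      using S_Nil[OF st] by (simp add: step_def level_def level_matrix_0)
    thus ?thesis using that by (simp add: apply_matrix_def if_distrib[where f = "\<lambda>x. x * _"] cong: if_cong)
  qed
  have "vnorm e (apply_matrix e (flow s t) v) = vnorm e (\<lambda>a. v a + apply_matrix e R v a)"
    by (rule vnorm_cong) (use apply_flow_minus_step[OF st, of _ v 0] step0 in \<open>simp add: R_def\<close>)
  also have "\<dots> \<le> vnorm e v + vnorm e (apply_matrix e R v)" by (rule vnorm_triangle)
  also have "vnorm e (apply_matrix e R v) \<le> mnorm e R * vnorm e v" by (rule vnorm_apply_matrix_le)
  also have "\<dots> \<le> tail 0 (size s t) * vnorm e v"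
    unfolding R_def by (intro mult_right_mono remainder_le st) auto
  finally show ?thesis by (simp add: algebra_simps)
qed

lemma apply_flow_refl:
  assumes t: "0 \<le> t" "t \<le> T" and a: "a < e"
  shows "apply_matrix e (flow t t) v a = v a"
proof -
  have tt: "(t, t) \<in> time_simplex T" using t by (simp add: time_simplex_def)
  have "flow t t a b = (if a = b then 1 else 0)" if "b < e" for b
  proof -
    have "level (n + Suc 0) t t a b = 0" for n
      using order_trans[OF abs_le_mnorm[OF a that] mnorm_level_le[OF tt, of "n + Suc 0"]] p
      by (simp add: size_def diag)
    thus ?thesis using flow_minus_step[OF tt a that, of 0] S_Nil[OF tt]
      by (simp add: step_def level_def level_matrix_0)
  qed
  hence "apply_matrix e (flow t t) v a = (\<Sum>b<e. (if a = b then 1 else 0) * v b)"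
    unfolding apply_matrix_def by (intro sum.cong) auto
  thus ?thesis using a by (simp add: if_distrib[where f = "\<lambda>x. x * _"] cong: if_cong)
qed

text \<open>The vector reached from \<open>v\<close> after \<open>k\<close> Euler steps along the points \<open>u\<close>.\<close>
fun scheme :: "nat \<Rightarrow> (nat \<Rightarrow> real) \<Rightarrow> (nat \<Rightarrow> real) \<Rightarrow> nat \<Rightarrow> nat \<Rightarrow> real" where
  "scheme N u v 0 = v"
| "scheme N u v (Suc k) = apply_matrix e (step N (u k) (u (Suc k))) (scheme N u v k)"

context
  fixes N m :: nat and u :: "nat \<Rightarrow> real" and v :: "nat \<Rightarrow> real" and M l :: real
  assumes u: "is_partition 0 T m u"
    and M: "1 + tail 0 (size 0 T) \<le> M"
    and l: "\<And>k. k < m \<Longrightarrow> tail N (size (u k) (u (Suc k))) \<le> l"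
begin

text \<open>In the remainder of this context \<open>M\<close> bounds the solution map on all subintervals and \<open>l\<close> bounds the local errors.\<close>
lemma u_simplex: "i \<le> j \<Longrightarrow> j \<le> m \<Longrightarrow> (u i, u j) \<in> time_simplex T"
  using is_partition_range[OF u, of i] is_partition_range[OF u, of j] is_partition_le[OF u, of i j]
  by (simp add: time_simplex_def)

lemma M_ge_1: "1 \<le> M"
  using M tail_nonneg[OF size_nonneg, of 0 0 T] by linarith

lemma flow_le_M:
  assumes "(s, t) \<in> time_simplex T"
  shows "vnorm e (apply_matrix e (flow s t) v') \<le> M * vnorm e v'"
proof -
  have "tail 0 (size s t) \<le> tail 0 (size 0 T)"
    using assms by (intro tail_mono size_nonneg size_mono) (auto simp: time_simplex_def)
  hence "(1 + tail 0 (size s t)) * vnorm e v' \<le> M * vnorm e v'" using M by (intro mult_right_mono) auto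
  thus ?thesis using vnorm_flow_le[OF assms, of v'] by linarith
qed

text \<open>One Euler step followed by the exact flow is compared with the exact flow; each comparison costs a local
error \<open>l\<close> and one factor \<open>M\<close> for the flow up to time \<open>t\<close>.\<close>
lemma scheme_error_telescope:
  assumes "k \<le> m" "u k \<le> t" "t \<le> T"
  shows "vnorm e (\<lambda>a. apply_matrix e (flow 0 t) v a - apply_matrix e (flow (u k) t) (scheme N u v k) a)
    \<le> M * l * (\<Sum>i<k. vnorm e (scheme N u v i))"
  using assms
proof (induction k)
  case 0
  have "u 0 = 0" using u by (simp add: is_partition_def)
  thus ?case by (simp add: vnorm_def L2_set_def)
next
  case (Suc k)
  have st: "(u k, u (Suc k)) \<in> time_simplex T" using Suc.prems by (intro u_simplex) auto
  have ut: "(u (Suc k), t) \<in> time_simplex T" using Suc.prems st by (auto simp: time_simplex_def)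
  have le: "0 \<le> u k" "u k \<le> u (Suc k)" "u (Suc k) \<le> t" "t \<le> T" using st ut by (auto simp: time_simplex_def)
  define x where "x = scheme N u v k"
  define R where "R = (\<lambda>a b. \<Sum>n. level (n + Suc N) (u k) (u (Suc k)) a b)"
  have split: "apply_matrix e (flow (u k) t) x a - apply_matrix e (flow (u (Suc k)) t) (scheme N u v (Suc k)) a
      = apply_matrix e (flow (u (Suc k)) t) (apply_matrix e R x) a" if a: "a < e" for a
  proof -
    have "apply_matrix e (flow (u k) t) x a = apply_matrix e (flow (u (Suc k)) t) (apply_matrix e (flow (u k) (u (Suc k))) x) a"
      by (rule apply_flow_compose[OF le a])
    also have "\<dots> = apply_matrix e (flow (u (Suc k)) t)
        (\<lambda>b. scheme N u v (Suc k) b + apply_matrix e R x b) a"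
      by (rule apply_matrix_cong) (use apply_flow_minus_step[OF st, of _ x N] in \<open>auto simp: x_def R_def\<close>)
    finally show ?thesis by (simp add: apply_matrix_def[of e "flow (u (Suc k)) t"] sum.distrib distrib_left)
  qed
  have "vnorm e (\<lambda>a. apply_matrix e (flow 0 t) v a - apply_matrix e (flow (u (Suc k)) t) (scheme N u v (Suc k)) a)
      = vnorm e (\<lambda>a. (apply_matrix e (flow 0 t) v a - apply_matrix e (flow (u k) t) x a)
          + apply_matrix e (flow (u (Suc k)) t) (apply_matrix e R x) a)"
    by (rule vnorm_cong) (simp add: split[symmetric])
  also have "\<dots> \<le> vnorm e (\<lambda>a. apply_matrix e (flow 0 t) v a - apply_matrix e (flow (u k) t) x a)
      + vnorm e (apply_matrix e (flow (u (Suc k)) t) (apply_matrix e R x))" by (rule vnorm_triangle)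
  also have "vnorm e (apply_matrix e (flow (u (Suc k)) t) (apply_matrix e R x)) \<le> M * vnorm e (apply_matrix e R x)"
    by (rule flow_le_M[OF ut])
  also have "\<dots> \<le> M * (mnorm e R * vnorm e x)"
    using M_ge_1 by (intro mult_left_mono vnorm_apply_matrix_le) auto
  also have "\<dots> \<le> M * (l * vnorm e x)"
    unfolding R_def using M_ge_1 order_trans[OF remainder_le[OF st] l[of k]] Suc.prems
    by (intro mult_left_mono mult_right_mono) auto
  also have "vnorm e (\<lambda>a. apply_matrix e (flow 0 t) v a - apply_matrix e (flow (u k) t) x a)
      \<le> M * l * (\<Sum>i<k. vnorm e (scheme N u v i))"
    unfolding x_def using Suc.prems le by (intro Suc.IH) auto
  finally show ?case by (simp add: x_def algebra_simps)
qed

lemma scheme_error: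
  assumes k: "k \<le> m"
  shows "vnorm e (\<lambda>a. apply_matrix e (flow 0 (u k)) v a - scheme N u v k a)
    \<le> M * l * (\<Sum>i<k. vnorm e (scheme N u v i))"
proof -
  have r: "0 \<le> u k" "u k \<le> T" using is_partition_range[OF u k] by auto
  have "vnorm e (\<lambda>a. apply_matrix e (flow 0 (u k)) v a - scheme N u v k a)
      = vnorm e (\<lambda>a. apply_matrix e (flow 0 (u k)) v a - apply_matrix e (flow (u k) (u k)) (scheme N u v k) a)"
    by (rule vnorm_cong) (simp add: apply_flow_refl[OF r])
  also have "\<dots> \<le> M * l * (\<Sum>i<k. vnorm e (scheme N u v i))"
    by (rule scheme_error_telescope[OF k order_refl r(2)])
  finally show ?thesis .
qed

lemma geometric_sum_identity: "M * l * (\<Sum>i<k. M * (1 + M * l) ^ i * y) = M * (1 + M * l) ^ k * y - M * y"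
  by (induction k) (simp_all add: algebra_simps)

text \<open>A discrete Gronwall argument: \<open>scheme\<close> differs from the exact flow by the error just estimated,
which involves only earlier steps of the scheme.\<close>
lemma scheme_growth:
  assumes l0: "0 \<le> l" and k: "k \<le> m"
  shows "vnorm e (scheme N u v k) \<le> M * (1 + M * l) ^ k * vnorm e v"
  using k
proof (induction k rule: less_induct)
  case (less k)
  have r: "(0, u k) \<in> time_simplex T" using is_partition_range[OF u less.prems] by (simp add: time_simplex_def)
  have "vnorm e (scheme N u v k) = vnorm e (\<lambda>a. apply_matrix e (flow 0 (u k)) v a
      + - (apply_matrix e (flow 0 (u k)) v a - scheme N u v k a))" by simp
  also have "\<dots> \<le> vnorm e (apply_matrix e (flow 0 (u k)) v)
      + vnorm e (\<lambda>a. - (apply_matrix e (flow 0 (u k)) v a - scheme N u v k a))" by (rule vnorm_triangle)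
  also have "vnorm e (\<lambda>a. - (apply_matrix e (flow 0 (u k)) v a - scheme N u v k a))
      = vnorm e (\<lambda>a. apply_matrix e (flow 0 (u k)) v a - scheme N u v k a)"
    by (simp add: vnorm_def L2_set_def power2_commute)
  also have "\<dots> \<le> M * l * (\<Sum>i<k. vnorm e (scheme N u v i))" by (rule scheme_error[OF less.prems])
  also have "\<dots> \<le> M * l * (\<Sum>i<k. M * (1 + M * l) ^ i * vnorm e v)"
    using M_ge_1 l0 less by (intro mult_left_mono sum_mono less.IH) auto
  also have "\<dots> = M * (1 + M * l) ^ k * vnorm e v - M * vnorm e v" by (rule geometric_sum_identity)
  also have "vnorm e (apply_matrix e (flow 0 (u k)) v) \<le> M * vnorm e v" by (rule flow_le_M[OF r])
  finally show ?case by simp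
qed

theorem global_error:
  assumes l0: "0 \<le> l"
  shows "vnorm e (\<lambda>a. apply_matrix e (flow 0 T) v a - scheme N u v m a)
    \<le> M\<^sup>2 * (real m * l) * exp (M * (real m * l)) * vnorm e v"
proof -
  have um: "u m = T" using u by (simp add: is_partition_def)
  have q: "0 \<le> M * l" using M_ge_1 l0 by simp
  have "vnorm e (scheme N u v i) \<le> M * exp (M * (real m * l)) * vnorm e v" if i: "i < m" for i
  proof -
    have "(1 + M * l) ^ i \<le> (1 + M * l) ^ m" using q i by (intro power_increasing) auto
    also have "\<dots> \<le> exp (M * l) ^ m" using q exp_ge_add_one_self[of "M * l"] by (intro power_mono) auto
    also have "\<dots> = exp (M * (real m * l))" by (simp add: exp_of_nat_mult[symmetric] mult_ac)
    finally have "M * (1 + M * l) ^ i * vnorm e v \<le> M * exp (M * (real m * l)) * vnorm e v"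
      using M_ge_1 by (intro mult_right_mono mult_left_mono) auto
    thus ?thesis using scheme_growth[OF l0, of i] i by simp
  qed
  hence "(\<Sum>i<m. vnorm e (scheme N u v i)) \<le> (\<Sum>i<m. M * exp (M * (real m * l)) * vnorm e v)"
    by (intro sum_mono) auto
  hence "M * l * (\<Sum>i<m. vnorm e (scheme N u v i)) \<le> M * l * (\<Sum>i<m. M * exp (M * (real m * l)) * vnorm e v)"
    using q by (rule mult_left_mono)
  also have "\<dots> = M\<^sup>2 * (real m * l) * exp (M * (real m * l)) * vnorm e v"
    by (simp add: power2_eq_square mult_ac)
  finally show ?thesis using scheme_error[of m] by (simp add: um)
qed

end

end

section \<open>The constants of the error bound\<close>

text \<open>The slope of \<open>ln Gamma\<close> on \<open>[a, a + 1]\<close> is \<open>ln a\<close>; by convexity the slopes to the right of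
\<open>a + 1\<close> are at least as large.\<close>
lemma gfact_add_ge:
  assumes a: "a > 0" and y: "y \<ge> 0"
  shows "gfact a * a powr y \<le> gfact (a + y)"
proof -
  have pos: "Gamma a > 0" "Gamma (a + 1) > 0" "Gamma (a + y + 1) > 0" using a y by auto
  have "(ln \<circ> Gamma) ((1 - 1 / (1 + y)) *\<^sub>R a + (1 / (1 + y)) *\<^sub>R (a + y + 1))
      \<le> (1 - 1 / (1 + y)) * (ln \<circ> Gamma) a + (1 / (1 + y)) * (ln \<circ> Gamma) (a + y + 1)"
    using a y by (intro convex_onD[OF log_convex_Gamma_real]) auto
  moreover have "(1 - 1 / (1 + y)) *\<^sub>R a + (1 / (1 + y)) *\<^sub>R (a + y + 1) = a + 1"
  proof -
    have "(1 - u) * a + u * (a + y + 1) = a + u * (1 + y)" for u :: real by (simp add: algebra_simps)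
    from this[of "1 / (1 + y)"] show ?thesis using y by simp
  qed
  ultimately have "ln (Gamma (a + 1)) \<le> (1 - 1 / (1 + y)) * ln (Gamma a) + (1 / (1 + y)) * ln (Gamma (a + y + 1))"
    by simp
  hence "(1 + y) * ln (Gamma (a + 1))
      \<le> (1 + y) * ((1 - 1 / (1 + y)) * ln (Gamma a) + (1 / (1 + y)) * ln (Gamma (a + y + 1)))"
    using y by (intro mult_left_mono) auto
  also have "\<dots> = y * ln (Gamma a) + ln (Gamma (a + y + 1))"
  proof -
    have "(1 + y) * ((1 - u) * A + u * B) = (1 + y) * A + (u * (1 + y)) * (B - A)" for u A B :: real
      by (simp add: algebra_simps)
    moreover have "1 / (1 + y) * (1 + y) = 1" using y by simp
    ultimately show ?thesis by (simp only: mult_1_left) (simp add: algebra_simps)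
  qed
  also have "ln (Gamma a) = ln (Gamma (a + 1)) - ln a"
    using Gamma_plus_one_real[OF a] a pos(1)[THEN less_imp_neq] by (simp add: ln_mult)
  finally have "ln (Gamma (a + 1)) + y * ln a \<le> ln (Gamma (a + y + 1))" by (simp add: algebra_simps)
  hence "exp (ln (Gamma (a + 1)) + y * ln a) \<le> exp (ln (Gamma (a + y + 1)))" by simp
  thus ?thesis using pos a by (simp add: gfact_def powr_def exp_add)
qed

lemma gfact_frac_pos: "1 \<le> p \<Longrightarrow> gfact (real n / p) > 0"
  by (intro gfact_pos) (auto simp: less_le_trans[of "-1" 0])

lemma gfact_ratio_le:
  assumes p: "1 \<le> p" and n: "n \<ge> 1" and x: "x \<ge> 0"
  shows "x ^ k * (gfact (real n / p) / gfact (real (n + k) / p)) \<le> (x / (real n / p) powr (1 / p)) ^ k"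
proof -
  define a where "a = real n / p"
  have a: "a > 0" using n p by (simp add: a_def)
  have "gfact a * a powr (real k / p) \<le> gfact (a + real k / p)" using a p by (intro gfact_add_ge) auto
  moreover have "a powr (real k / p) = (a powr (1 / p)) ^ k"
    using a by (simp add: powr_realpow[symmetric] powr_powr)
  moreover have "a + real k / p = real (n + k) / p" by (simp add: a_def add_divide_distrib)
  ultimately have "gfact a / gfact (real (n + k) / p) \<le> 1 / (a powr (1 / p)) ^ k"
    using gfact_frac_pos[OF p, of "n + k"] a by (simp add: field_simps)
  hence "x ^ k * (gfact a / gfact (real (n + k) / p)) \<le> x ^ k * (1 / (a powr (1 / p)) ^ k)"
    using x by (intro mult_left_mono) auto
  thus ?thesis by (simp add: a_def power_divide)
qed

lemma summable_power_div_gfact: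
  assumes p: "1 \<le> p" and x: "x \<ge> 0"
  shows "summable (\<lambda>n. x ^ n / gfact (real n / p))"
proof -
  obtain N :: nat where N: "real N > p * (2 * x + 1) powr p" using reals_Archimedean2 by blast
  have "(2 * x + 1) powr p > 0" using x by simp
  hence "p * (2 * x + 1) powr p > 0" using p by simp
  hence N1: "N \<ge> 1" using N by (cases N) auto
  define b where "b = (real N / p) powr (1 / p)"
  have "2 * x + 1 = ((2 * x + 1) powr p) powr (1 / p)" using p x by (simp add: powr_powr)
  also have "\<dots> \<le> b" unfolding b_def using N p by (intro powr_mono2) (auto simp: field_simps)
  finally have b: "2 * x + 1 \<le> b" .
  have xb: "0 \<le> x / b" "x / b \<le> 1 / 2" using b x by (auto simp: field_simps)
  have "summable (\<lambda>n. x ^ (n + N) / gfact (real (n + N) / p))"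
  proof (rule summable_comparison_test)
    show "summable (\<lambda>n. x ^ N / gfact (real N / p) * (1 / 2) ^ n)" by (intro summable_mult summable_geometric) auto
    show "\<exists>M. \<forall>n\<ge>M. norm (x ^ (n + N) / gfact (real (n + N) / p)) \<le> x ^ N / gfact (real N / p) * (1 / 2) ^ n"
    proof (intro exI[of _ 0] allI impI)
      fix n
      have g: "gfact (real N / p) > 0" "gfact (real (N + n) / p) > 0"
        by (rule gfact_frac_pos[OF p])+
      have "x ^ (n + N) / gfact (real (n + N) / p)
          = x ^ N / gfact (real N / p) * (x ^ n * (gfact (real N / p) / gfact (real (N + n) / p)))"
        using g by (simp add: power_add add.commute)
      also have "\<dots> \<le> x ^ N / gfact (real N / p) * (x / b) ^ n"
        unfolding b_def using g x by (intro mult_left_mono gfact_ratio_le p N1) auto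
      also have "\<dots> \<le> x ^ N / gfact (real N / p) * (1 / 2) ^ n"
        using g x xb by (intro mult_left_mono power_mono) auto
      finally show "norm (x ^ (n + N) / gfact (real (n + N) / p)) \<le> x ^ N / gfact (real N / p) * (1 / 2) ^ n"
        using x gfact_frac_pos[OF p, of "n + N"] by simp
    qed
  qed
  thus ?thesis by (subst (asm) summable_iff_shift)
qed

lemma summable_level_const:
  assumes p: "1 \<le> p" and x: "0 \<le> x"
  shows "summable (\<lambda>n. level_const p n * x ^ n)"
proof (rule summable_comparison_test)
  show "summable (\<lambda>n. 3 / (2 * beta_p p) * (x ^ n / gfact (real n / p)))"
    by (intro summable_mult summable_power_div_gfact assms)
  show "\<exists>N. \<forall>n\<ge>N. norm (level_const p n * x ^ n) \<le> 3 / (2 * beta_p p) * (x ^ n / gfact (real n / p))"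
  proof (intro exI[of _ 0] allI impI)
    fix n
    have "level_const p n * x ^ n \<le> 3 / (2 * beta_p p) / gfact (real n / p) * x ^ n"
      using x by (intro mult_right_mono level_const_le_inverse_gfact p) auto
    thus "norm (level_const p n * x ^ n) \<le> 3 / (2 * beta_p p) * (x ^ n / gfact (real n / p))"
      using x level_const_pos[OF p, of n] by simp
  qed
qed

text \<open>The tail of the series of \<open>x ^ n / gfact (n / p)\<close> after the index \<open>N\<close>, divided by its first term.\<close>
definition tail_ratio :: "real \<Rightarrow> nat \<Rightarrow> real \<Rightarrow> real" where
  "tail_ratio p N x = (\<Sum>n. x ^ n * (gfact (real (Suc N) / p) / gfact (real (Suc N + n) / p)))"

lemma summable_tail_ratio:
  assumes p: "1 \<le> p" and x: "0 \<le> x"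
  shows "summable (\<lambda>n. x ^ n * (gfact (real (Suc N) / p) / gfact (real (Suc N + n) / p)))"
proof (cases "x = 0")
  case True
  thus ?thesis by (intro summable_finite[of "{0}"]) (auto simp: power_0_left)
next
  case False
  have "summable (\<lambda>n. x ^ (n + Suc N) / gfact (real (n + Suc N) / p))"
    using summable_power_div_gfact[OF assms] by (subst summable_iff_shift)
  hence "summable (\<lambda>n. gfact (real (Suc N) / p) / x ^ Suc N * (x ^ (n + Suc N) / gfact (real (n + Suc N) / p)))"
    by (rule summable_mult)
  moreover have "gfact (real (Suc N) / p) / x ^ Suc N * (x ^ (n + Suc N) / gfact (real (n + Suc N) / p))
      = x ^ n * (gfact (real (Suc N) / p) / gfact (real (Suc N + n) / p))" for n
    using False by (simp add: power_add add.commute)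
  ultimately show ?thesis by simp
qed

lemma tail_ratio_ge_1:
  assumes p: "1 \<le> p" and x: "0 \<le> x"
  shows "1 \<le> tail_ratio p N x"
proof -
  have "(\<Sum>n<1. x ^ n * (gfact (real (Suc N) / p) / gfact (real (Suc N + n) / p))) \<le> tail_ratio p N x"
    unfolding tail_ratio_def using summable_tail_ratio[OF assms] x gfact_frac_pos[OF p]
    by (intro sum_le_suminf) (auto intro!: mult_nonneg_nonneg divide_nonneg_nonneg simp: less_imp_le simp del: of_nat_Suc of_nat_add)
  thus ?thesis using gfact_frac_pos[OF p, of "Suc N"] by simp
qed

lemma tail_ratio_le:
  assumes p: "1 \<le> p" and x: "0 \<le> x" and q: "x / (real (Suc N) / p) powr (1 / p) < 1"
  shows "tail_ratio p N x \<le> 1 / (1 - x / (real (Suc N) / p) powr (1 / p))"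
proof -
  define q where "q = x / (real (Suc N) / p) powr (1 / p)"
  have q1: "0 \<le> q" "q < 1" using x q by (auto simp: q_def)
  have "tail_ratio p N x \<le> (\<Sum>n. q ^ n)"
    unfolding tail_ratio_def q_def
    using gfact_ratio_le[OF p _ x, of "Suc N"] summable_tail_ratio[OF p x] q1
    by (intro suminf_le) (auto simp: q_def intro!: summable_geometric)
  also have "\<dots> = 1 / (1 - q)" using q1 by (intro suminf_geometric) auto
  finally show ?thesis by (simp add: q_def)
qed

lemma tendsto_tail_ratio:
  assumes p: "1 \<le> p" and x: "\<And>i. 0 \<le> x i"
    and q: "((\<lambda>i. x i / (real (Suc (N i)) / p) powr (1 / p)) \<longlongrightarrow> 0) F"
  shows "((\<lambda>i. tail_ratio p (N i) (x i)) \<longlongrightarrow> 1) F"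
proof (rule tendsto_sandwich)
  show "\<forall>\<^sub>F i in F. 1 \<le> tail_ratio p (N i) (x i)" using tail_ratio_ge_1[OF p x] by simp
  have "\<forall>\<^sub>F i in F. x i / (real (Suc (N i)) / p) powr (1 / p) < 1" using q by (rule order_tendstoD) simp
  thus "\<forall>\<^sub>F i in F. tail_ratio p (N i) (x i) \<le> 1 / (1 - x i / (real (Suc (N i)) / p) powr (1 / p))"
    by eventually_elim (rule tail_ratio_le[OF p x])
  have "((\<lambda>i. 1 / (1 - x i / (real (Suc (N i)) / p) powr (1 / p))) \<longlongrightarrow> 1 / (1 - 0)) F"
    using q by (intro tendsto_divide tendsto_diff tendsto_const) auto
  thus "((\<lambda>i. 1 / (1 - x i / (real (Suc (N i)) / p) powr (1 / p))) \<longlongrightarrow> 1) F" by simp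
qed simp

lemma level_const_tail_le:
  assumes p: "1 \<le> p" and x: "0 \<le> x"
  shows "(\<Sum>n. level_const p (n + Suc N) * x ^ (n + Suc N))
    \<le> 3 / (2 * beta_p p) * (x ^ Suc N / gfact (real (Suc N) / p)) * tail_ratio p N x"
proof -
  define g where "g = gfact (real (Suc N) / p)"
  have g: "g > 0" using gfact_frac_pos[OF p, of "Suc N"] by (simp add: g_def)
  have "(\<Sum>n. level_const p (n + Suc N) * x ^ (n + Suc N))
      \<le> (\<Sum>n. 3 / (2 * beta_p p) * (x ^ Suc N / g) * (x ^ n * (g / gfact (real (Suc N + n) / p))))"
  proof (intro suminf_le)
    fix n
    have "level_const p (n + Suc N) * x ^ (n + Suc N)
        \<le> 3 / (2 * beta_p p) / gfact (real (n + Suc N) / p) * x ^ (n + Suc N)"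
      using x by (intro mult_right_mono level_const_le_inverse_gfact p) auto
    also have "\<dots> = 3 / (2 * beta_p p) * (x ^ Suc N / g) * (x ^ n * (g / gfact (real (Suc N + n) / p)))"
      using g by (simp add: power_add add.commute mult_ac)
    finally show "level_const p (n + Suc N) * x ^ (n + Suc N)
        \<le> 3 / (2 * beta_p p) * (x ^ Suc N / g) * (x ^ n * (g / gfact (real (Suc N + n) / p)))" .
  next
    show "summable (\<lambda>n. level_const p (n + Suc N) * x ^ (n + Suc N))"
      using summable_level_const[OF assms] by (subst summable_iff_shift)
    show "summable (\<lambda>n. 3 / (2 * beta_p p) * (x ^ Suc N / g) * (x ^ n * (g / gfact (real (Suc N + n) / p))))"
      unfolding g_def by (intro summable_mult summable_tail_ratio assms)
  qed
  also have "\<dots> = 3 / (2 * beta_p p) * (x ^ Suc N / g) * tail_ratio p N x"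
    unfolding tail_ratio_def g_def by (intro suminf_mult summable_tail_ratio assms)
  finally show ?thesis by (simp add: g_def)
qed

text \<open>Comparison with the exponential series in \<open>y = x powr p\<close>: here the weight \<open>1 / (2 + n / p)\<close> makes
\<open>y ^ Suc k / fact (Suc k)\<close> appear in place of \<open>y ^ Suc k / fact k\<close>, which would not sum to a multiple of \<open>exp y\<close>.\<close>
lemma level_const_term_le:
  assumes p: "1 \<le> p" and x: "0 \<le> x" and n: "n \<ge> 1"
  defines "k \<equiv> nat \<lfloor>real n / p\<rfloor>" and "y \<equiv> x powr p"
  shows "level_const p n * x ^ n \<le> 3 / beta_p p * (y ^ k / fact k + y ^ Suc k / fact (Suc k))"
proof -
  define s where "s = real n / p"
  have s: "s > 0" using n p by (simp add: s_def)
  have ks: "real k \<le> s" "s \<le> real k + 1"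
    using s unfolding k_def s_def[symmetric] by linarith+
  have y: "y \<ge> 0" by (simp add: y_def)
  have num: "x ^ n \<le> y ^ k + y ^ Suc k"
  proof (cases "x = 0")
    case True
    thus ?thesis using n y by (simp add: power_0_left)
  next
    case False
    hence x0: "x > 0" "y > 0" using x by (auto simp: y_def)
    have "x ^ n = y powr s" using x0 p by (simp add: y_def s_def powr_powr powr_realpow)
    also have "\<dots> \<le> y ^ k + y ^ Suc k"
    proof (cases "y \<ge> 1")
      case True
      have "y powr s \<le> y powr (real (Suc k))" using ks True by (intro powr_mono) auto
      also have "\<dots> = y ^ Suc k" using x0 by (simp only: powr_realpow)
      finally show ?thesis using y by (simp add: add_increasing)
    next
      case False
      have "y powr s \<le> y powr (real k)" using ks False x0 by (intro powr_mono') auto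
      also have "\<dots> = y ^ k" using x0 by (simp only: powr_realpow)
      finally show ?thesis using y by (simp add: add_increasing2)
    qed
    finally show ?thesis .
  qed
  have "fact (Suc k) = Gamma (real k + 2)"
    using Gamma_fact[of "Suc k", where 'a = real] by (simp add: add.commute)
  also have "\<dots> \<le> Gamma (s + 2)" using ks by (intro Gamma_mono_real) auto
  also have "\<dots> = (s + 1) * Gamma (s + 1)" using Gamma_plus_one_real[of "s + 1"] s by (simp add: add.commute add.left_commute)
  also have "\<dots> \<le> (2 + s) * gfact s" using s unfolding gfact_def by (intro mult_right_mono) auto
  finally have den: "fact (Suc k) \<le> (2 + s) * gfact s" .
  have "level_const p n * x ^ n = 3 / beta_p p * (x ^ n / ((2 + s) * gfact s))"
    by (simp add: level_const_def s_def)
  also have "\<dots> \<le> 3 / beta_p p * ((y ^ k + y ^ Suc k) / fact (Suc k))"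
    using num den y beta_p_pos[OF p] x by (intro mult_left_mono frac_le) auto
  also have "\<dots> \<le> 3 / beta_p p * (y ^ k / fact k + y ^ Suc k / fact (Suc k))"
  proof -
    have "y ^ k / fact (Suc k) \<le> y ^ k / fact k" using y by (intro divide_left_mono fact_mono) auto
    thus ?thesis using beta_p_pos[OF p] by (intro mult_left_mono) (auto simp: add_divide_distrib)
  qed
  finally show ?thesis .
qed

lemma card_floor_fibre_le:
  assumes p: "1 \<le> p" and I: "finite I"
  shows "real (card {n \<in> I. nat \<lfloor>real n / p\<rfloor> = k}) \<le> p + 1"
proof -
  define a b where "a = \<lceil>real k * p\<rceil>" and "b = \<lceil>real k * p + p\<rceil>"
  have "{n \<in> I. nat \<lfloor>real n / p\<rfloor> = k} \<subseteq> {nat a..<nat b}"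
  proof
    fix n assume "n \<in> {n \<in> I. nat \<lfloor>real n / p\<rfloor> = k}"
    hence "\<lfloor>real n / p\<rfloor> = int k" using p by (auto simp: nat_eq_iff)
    hence "real k \<le> real n / p" "real n / p < real k + 1" by linarith+
    hence "real k * p \<le> real n" "real n < real k * p + p" using p by (auto simp: field_simps)
    thus "n \<in> {nat a..<nat b}" unfolding a_def b_def by (simp add: ceiling_le_iff less_ceiling_iff nat_le_iff zless_nat_eq_int_zless)
  qed
  hence "card {n \<in> I. nat \<lfloor>real n / p\<rfloor> = k} \<le> nat b - nat a"
    using card_mono[of "{nat a..<nat b}"] by simp
  moreover have "0 \<le> real k * p" using p by simp
  hence "0 \<le> a" "a \<le> b" using p unfolding a_def b_def by linarith+
  hence "real (nat b - nat a) = of_int b - of_int a" by (simp add: of_nat_diff nat_diff_distrib[symmetric])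
  moreover have "of_int b - of_int a \<le> p + 1" unfolding a_def b_def by linarith
  ultimately show ?thesis by linarith
qed

lemma level_const_series_le_exp:
  assumes p: "1 \<le> p" and x: "0 \<le> x"
  shows "(\<Sum>n. level_const p (n + Suc 0) * x ^ (n + Suc 0)) \<le> 6 * (p + 1) / beta_p p * exp (x powr p)"
proof -
  define y where "y = x powr p"
  have y: "y \<ge> 0" by (simp add: y_def)
  define F where "F = (\<lambda>k. y ^ k / fact k + y ^ Suc k / fact (Suc k))"
  have F0: "F k \<ge> 0" for k using y by (simp add: F_def)
  define \<kappa> where "\<kappa> = (\<lambda>n. nat \<lfloor>real n / p\<rfloor>)"
  have es: "summable (\<lambda>k. y ^ k / fact k)" "(\<Sum>k. y ^ k / fact k) = exp y"
    using summable_exp[of y] by (simp_all add: exp_def divide_inverse mult.commute)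
  have sumF: "(\<Sum>k\<in>K. F k) \<le> 2 * exp y" if K: "finite K" for K
  proof -
    have "(\<Sum>k\<in>K. y ^ k / fact k) \<le> exp y"
      using sum_le_suminf[OF es(1) K] y es(2) by simp
    moreover have "(\<Sum>k\<in>Suc ` K. y ^ k / fact k) \<le> exp y"
      using sum_le_suminf[OF es(1), of "Suc ` K"] K y es(2) by simp
    ultimately show ?thesis by (simp add: F_def sum.distrib sum.reindex)
  qed
  have "(\<Sum>n<N. level_const p (n + Suc 0) * x ^ (n + Suc 0)) \<le> 6 * (p + 1) / beta_p p * exp y" for N
  proof -
    have "(\<Sum>n<N. level_const p (n + Suc 0) * x ^ (n + Suc 0)) = (\<Sum>n\<in>{1..N}. level_const p n * x ^ n)"
      by (rule sum.reindex_bij_witness[of _ "\<lambda>n. n - 1" Suc]) auto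
    also have "\<dots> \<le> (\<Sum>n\<in>{1..N}. 3 / beta_p p * F (\<kappa> n))"
      unfolding F_def \<kappa>_def y_def by (intro sum_mono level_const_term_le p x) auto
    also have "\<dots> = 3 / beta_p p * (\<Sum>n\<in>{1..N}. F (\<kappa> n))" by (simp add: sum_distrib_left)
    also have "(\<Sum>n\<in>{1..N}. F (\<kappa> n)) = (\<Sum>k\<in>\<kappa> ` {1..N}. \<Sum>n\<in>{n \<in> {1..N}. \<kappa> n = k}. F (\<kappa> n))"
      by (rule sum.image_gen) simp
    also have "\<dots> = (\<Sum>k\<in>\<kappa> ` {1..N}. real (card {n \<in> {1..N}. \<kappa> n = k}) * F k)"
      by (intro sum.cong refl) simp
    also have "\<dots> \<le> (\<Sum>k\<in>\<kappa> ` {1..N}. (p + 1) * F k)"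
      unfolding \<kappa>_def using F0 by (intro sum_mono mult_right_mono card_floor_fibre_le p) auto
    also have "\<dots> = (p + 1) * (\<Sum>k\<in>\<kappa> ` {1..N}. F k)" by (simp add: sum_distrib_left)
    also have "\<dots> \<le> (p + 1) * (2 * exp y)" using p by (intro mult_left_mono sumF) auto
    finally have "(\<Sum>n<N. level_const p (n + Suc 0) * x ^ (n + Suc 0)) \<le> 3 / beta_p p * ((p + 1) * (2 * exp y))"
      using beta_p_pos[OF p] by (simp add: mult_left_mono divide_right_mono)
    also have "\<dots> = 6 * (p + 1) / beta_p p * exp y" by (simp add: field_simps)
    finally show ?thesis .
  qed
  moreover have "summable (\<lambda>n. level_const p (n + Suc 0) * x ^ (n + Suc 0))"
    using summable_level_const[OF assms] by (subst summable_iff_shift)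
  ultimately show ?thesis unfolding y_def by (intro suminf_le_const) auto
qed

text \<open>\<open>growth_const p * exp (r powr p * W)\<close> bounds the solution map on an interval with control \<open>W\<close>.\<close>
definition growth_const :: "real \<Rightarrow> real" where
  "growth_const p = 1 + 6 * (p + 1) / beta_p p"

text \<open>The largest value of \<open>size\<close> on one of \<open>m\<close> intervals with control at most \<open>W / m\<close>.\<close>
definition step_size :: "real \<Rightarrow> real \<Rightarrow> real \<Rightarrow> nat \<Rightarrow> real" where
  "step_size p r W m = r * (W / real m) powr (1 / p)"

text \<open>\<open>m\<close> times the bound for the local error of one step; it tends to zero for \<open>N \<rightarrow> \<infinity>\<close> and,
if \<open>p < N + 1\<close>, for \<open>m \<rightarrow> \<infinity>\<close>.\<close>
definition total_local_error :: "real \<Rightarrow> real \<Rightarrow> real \<Rightarrow> nat \<Rightarrow> nat \<Rightarrow> real" where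
  "total_local_error p r W N m = 3 / (2 * beta_p p) * ((r * W powr (1 / p)) ^ (N + 1) /
     (gfact (real (N + 1) / p) * real m powr (real (N + 1) / p - 1))) * tail_ratio p N (step_size p r W m)"

text \<open>The quantity \<open>C\<^sub>p(r,w;N,m)\<close>. The exponential factor comes from the Gronwall argument.\<close>
definition error_const :: "real \<Rightarrow> real \<Rightarrow> real \<Rightarrow> nat \<Rightarrow> nat \<Rightarrow> real" where
  "error_const p r W N m = 3 / (2 * beta_p p) * (growth_const p)\<^sup>2 * tail_ratio p N (step_size p r W m)
     * exp (growth_const p * exp (r powr p * W) * total_local_error p r W N m)"

lemma step_size_nonneg: "0 \<le> r \<Longrightarrow> 0 \<le> step_size p r W m"
  by (simp add: step_size_def)

lemma step_size_power:
  assumes p: "1 \<le> p" and W: "0 \<le> W" and m: "m \<ge> 1"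
  shows "real m * step_size p r W m ^ (N + 1) = (r * W powr (1 / p)) ^ (N + 1) / real m powr (real (N + 1) / p - 1)"
proof -
  have "step_size p r W m = r * W powr (1 / p) / real m powr (1 / p)"
    using W by (simp add: step_size_def powr_divide)
  moreover have "(real m powr (1 / p)) ^ (N + 1) = real m powr (real (N + 1) / p)"
  proof -
    have "(real m powr (1 / p)) ^ (N + 1) = (real m powr (1 / p)) powr (real (N + 1))"
      using m by (intro powr_realpow[symmetric]) auto
    thus ?thesis by (simp only: powr_powr) simp
  qed
  moreover have "real m powr (real (N + 1) / p - 1) = real m powr (real (N + 1) / p) / real m"
    using m by (simp add: powr_diff)
  ultimately show ?thesis using m by (simp only: power_divide) (simp add: field_simps)
qed

lemma total_local_error_eq:
  assumes "1 \<le> p" "0 \<le> W" "m \<ge> 1"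
  shows "total_local_error p r W N m
    = real m * (3 / (2 * beta_p p) * (step_size p r W m ^ Suc N / gfact (real (Suc N) / p)) * tail_ratio p N (step_size p r W m))"
proof -
  have "total_local_error p r W N m = 3 / (2 * beta_p p) * ((real m * step_size p r W m ^ (N + 1)) /
     gfact (real (N + 1) / p)) * tail_ratio p N (step_size p r W m)"
    unfolding step_size_power[OF assms] total_local_error_def by (simp only: divide_divide_eq_left mult.commute)
  thus ?thesis by (simp add: mult_ac)
qed

lemma error_const_pos:
  assumes p: "1 \<le> p" and r: "0 < r"
  shows "0 < error_const p r W N m"
proof -
  have "0 < growth_const p" using beta_p_pos[OF p] p by (simp add: growth_const_def add_pos_nonneg)
  thus ?thesis unfolding error_const_def
    using beta_p_pos[OF p] tail_ratio_ge_1[OF p step_size_nonneg[of r p W m], of N] r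
    by (intro mult_pos_pos) auto
qed

lemma error_const_tendsto:
  assumes p: "1 \<le> p" and "((\<lambda>i. tail_ratio p (N i) (step_size p r W (m i))) \<longlongrightarrow> 1) F"
    and "((\<lambda>i. total_local_error p r W (N i) (m i)) \<longlongrightarrow> 0) F"
  shows "((\<lambda>i. error_const p r W (N i) (m i)) \<longlongrightarrow> 3 / (2 * beta_p p) * (growth_const p)\<^sup>2) F"
proof -
  have "((\<lambda>i. error_const p r W (N i) (m i)) \<longlongrightarrow>
      3 / (2 * beta_p p) * (growth_const p)\<^sup>2 * 1 * exp (growth_const p * exp (r powr p * W) * 0)) F"
    unfolding error_const_def by (intro tendsto_mult tendsto_exp tendsto_const assms)
  thus ?thesis by simp
qed

lemma error_const_tendsto_N:
  assumes p: "1 \<le> p" and r: "0 < r" and W: "0 \<le> W" and m: "m \<ge> 1"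
  shows "(\<lambda>N. error_const p r W N m) \<longlonglongrightarrow> 3 / (2 * beta_p p) * (growth_const p)\<^sup>2"
proof (rule error_const_tendsto[OF p])
  define z where "z = step_size p r W m"
  have z: "0 \<le> z" using r by (simp add: z_def step_size_nonneg)
  have "filterlim (\<lambda>N. real (Suc N) / p) at_top sequentially"
  proof -
    have "filterlim (\<lambda>N. 1 / p * real (Suc N)) at_top sequentially"
      using p by (intro filterlim_tendsto_pos_mult_at_top[OF tendsto_const]
          filterlim_compose[OF filterlim_real_sequentially filterlim_Suc]) auto
    thus ?thesis by (simp only: times_divide_eq_left mult_1_left)
  qed
  hence "(\<lambda>N. (real (Suc N) / p) powr (- (1 / p))) \<longlonglongrightarrow> 0"
    using p by (intro tendsto_neg_powr) auto
  hence "(\<lambda>N. z * (real (Suc N) / p) powr (- (1 / p))) \<longlonglongrightarrow> z * 0"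
    by (intro tendsto_mult tendsto_const)
  hence "(\<lambda>N. z / (real (Suc N) / p) powr (1 / p)) \<longlonglongrightarrow> 0"
    by (simp only: powr_minus divide_inverse mult_zero_right)
  thus 1: "(\<lambda>N. tail_ratio p N (step_size p r W m)) \<longlonglongrightarrow> 1"
    unfolding z_def[symmetric] using z by (intro tendsto_tail_ratio p) auto
  have "(\<lambda>n. z ^ n / gfact (real n / p)) \<longlonglongrightarrow> 0"
    by (intro summable_LIMSEQ_zero summable_power_div_gfact p z)
  hence "(\<lambda>N. z ^ Suc N / gfact (real (Suc N) / p)) \<longlonglongrightarrow> 0" by (rule LIMSEQ_Suc)
  hence "(\<lambda>N. real m * (3 / (2 * beta_p p) * (z ^ Suc N / gfact (real (Suc N) / p)) * tail_ratio p N z))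
      \<longlonglongrightarrow> real m * (3 / (2 * beta_p p) * 0 * 1)"
    using 1 unfolding z_def[symmetric] by (intro tendsto_mult tendsto_const)
  thus "(\<lambda>N. total_local_error p r W N m) \<longlonglongrightarrow> 0"
    unfolding total_local_error_eq[OF p W m] z_def by simp
qed

lemma error_const_tendsto_m:
  assumes p: "1 \<le> p" and r: "0 < r" and W: "0 \<le> W" and N: "p < real N + 1"
  shows "(\<lambda>m. error_const p r W N m) \<longlonglongrightarrow> 3 / (2 * beta_p p) * (growth_const p)\<^sup>2"
proof (rule error_const_tendsto[OF p])
  have "(\<lambda>m. W / real m) \<longlonglongrightarrow> 0" by (rule lim_const_over_n)
  hence "(\<lambda>m. (W / real m) powr (1 / p)) \<longlonglongrightarrow> 0 powr (1 / p)"
    using p W by (intro tendsto_powr') (auto intro!: always_eventually)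
  hence "(\<lambda>m. r * (W / real m) powr (1 / p) / (real (Suc N) / p) powr (1 / p))
      \<longlonglongrightarrow> r * 0 powr (1 / p) / (real (Suc N) / p) powr (1 / p)"
    using p by (intro tendsto_divide tendsto_mult tendsto_const) auto
  hence "(\<lambda>m. step_size p r W m / (real (Suc N) / p) powr (1 / p)) \<longlonglongrightarrow> 0" by (simp add: step_size_def)
  thus 1: "(\<lambda>m. tail_ratio p N (step_size p r W m)) \<longlonglongrightarrow> 1"
    using r by (intro tendsto_tail_ratio p step_size_nonneg) auto
  have "(\<lambda>m. real m powr (- (real (N + 1) / p - 1))) \<longlonglongrightarrow> 0"
    using N p by (intro tendsto_neg_powr filterlim_real_sequentially) (auto simp: field_simps)
  hence lim: "(\<lambda>m. 3 / (2 * beta_p p) * ((r * W powr (1 / p)) ^ (N + 1) / gfact (real (N + 1) / p)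
        * real m powr (- (real (N + 1) / p - 1))) * tail_ratio p N (step_size p r W m))
     \<longlonglongrightarrow> 3 / (2 * beta_p p) * ((r * W powr (1 / p)) ^ (N + 1) / gfact (real (N + 1) / p) * 0) * 1"
    using 1 by (intro tendsto_mult tendsto_const)
  have eq: "(r * W powr (1 / p)) ^ (N + 1) / gfact (real (N + 1) / p) * real m powr (- (real (N + 1) / p - 1))
      = (r * W powr (1 / p)) ^ (N + 1) / (gfact (real (N + 1) / p) * real m powr (real (N + 1) / p - 1))" for m
    by (simp only: powr_minus divide_inverse inverse_mult_distrib mult.assoc)
  show "(\<lambda>m. total_local_error p r W N m) \<longlonglongrightarrow> 0"
    unfolding total_local_error_def eq[symmetric] using lim by (simp only: mult_zero_left mult_zero_right)
qed

section \<open>The error of the Euler scheme\<close>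

lemma euclid_norm_eq_vnorm: "dim_vec v = e \<Longrightarrow> euclid_norm v = vnorm e (vec_index v)"
  by (simp add: euclid_norm_def vnorm_def)

lemma operator_norm_le:
  assumes "\<And>y. y \<in> carrier_vec e \<Longrightarrow> euclid_norm y \<le> 1 \<Longrightarrow> euclid_norm (L y) \<le> B"
  shows "operator_norm e L \<le> B"
  unfolding operator_norm_def
proof (rule cSUP_least)
  have "euclid_norm (zero_vec e) = 0" by (simp add: euclid_norm_def L2_set_def)
  hence "zero_vec e \<in> {y \<in> carrier_vec e. euclid_norm y \<le> 1}" by simp
  thus "{y \<in> carrier_vec e. euclid_norm y \<le> 1} \<noteq> {}" by blast
qed (use assms in auto)

theorem euler_error_bound:
  assumes p: "1 \<le> p" and T: "0 < T" and X: "rough_path d p T X" and m: "m \<ge> 1"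
    and u: "is_partition 0 T m u"
    and equi: "\<And>i j. i < j \<Longrightarrow> j \<le> m \<Longrightarrow>
      omega_p d p X (u i) (u j) \<le> real (j - i) / real m * omega_p d p X 0 T"
    and r: "r > 0" and fields: "A \<in> linear_fields d e" and A_le: "frobenius_norm d e A \<le> r"
  shows "operator_norm e (\<lambda>y. solution_map d e p T X A 0 T y - euler_scheme d e p T X A N m u y)
    \<le> error_const p r (omega_p d p X 0 T) N m * exp (2 * r powr p * omega_p d p X 0 T) *
       ((r * omega_p d p X 0 T powr (1 / p)) ^ (N + 1) /
        (gfact (real (N + 1) / p) * real m powr (real (N + 1) / p - 1)))"
proof (rule operator_norm_le)
  fix y assume y: "y \<in> carrier_vec e" "euclid_norm y \<le> 1"
  define S where "S = path_signature d p T X"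
  note sig = path_signature_properties[OF p less_imp_le[OF T] X, folded S_def]
  interpret LS: lyons_setup "omega_p d p X" T d p X
    using rough_path_lyons_setup[OF p less_imp_le[OF T] X] .
  interpret linear_equation "omega_p d p X" T d e A r p S "level_const p"
    using p r T A_le sig level_const_pos[OF p] summable_level_const[OF p]
    by unfold_locales (auto intro: less_imp_le)
  define W where "W = omega_p d p X 0 T"
  have W: "W \<ge> 0" unfolding W_def using T by (intro LS.nonneg) auto
  define v where "v = vec_index y"
  have yv: "vnorm e v \<le> 1" using y euclid_norm_eq_vnorm[of y e] by (simp add: v_def)
  have solution: "vec_index (solution_map d e p T X A 0 T y) a = apply_matrix e (flow 0 T) v a" if a: "a < e" for a
  proof -
    have st: "(0, T) \<in> time_simplex T" using T by (simp add: time_simplex_def)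
    have "summable (\<lambda>n. level n 0 T a b * v b)" if "b < e" for b
      using summable_level[OF st a that] by (intro summable_mult2) (rule summable_rabs_cancel)
    hence "(\<lambda>n. \<Sum>b<e. level n 0 T a b * v b) sums (\<Sum>b<e. \<Sum>n. level n 0 T a b * v b)"
      by (intro sums_sum summable_sums) auto
    moreover have "(\<Sum>n. level n 0 T a b * v b) = flow 0 T a b * v b" if "b < e" for b
      unfolding flow_def using summable_level[OF st a that]
      by (intro suminf_mult2[symmetric]) (rule summable_rabs_cancel)
    moreover have "vec_index (tensor_action d e A n y (S 0 T)) a = (\<Sum>b<e. level n 0 T a b * v b)" for n
      using tensor_action_eq[OF fields y(1) a] by (simp add: apply_matrix_def level_def v_def)
    ultimately show ?thesis
      using a by (simp add: solution_map_def S_def[symmetric] sums_iff apply_matrix_def)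
  qed
  have scheme: "euler_scheme d e p T X A N k u y \<in> carrier_vec e \<and>
      (\<forall>a<e. vec_index (euler_scheme d e p T X A N k u y) a = scheme N u v k a)" for k
  proof (induction k)
    case 0
    thus ?case using y by (simp add: euler_scheme_def v_def)
  next
    case (Suc k)
    define z where "z = euler_scheme d e p T X A N k u y"
    have z: "z \<in> carrier_vec e" "\<And>a. a < e \<Longrightarrow> vec_index z a = scheme N u v k a" using Suc by (auto simp: z_def)
    have eq: "euler_scheme d e p T X A N (Suc k) u y = euler_step d e p T X A N (u k) (u (Suc k)) z"
      by (simp add: euler_scheme_def z_def)
    have "vec_index (euler_step d e p T X A N (u k) (u (Suc k)) z) a = scheme N u v (Suc k) a" if a: "a < e" for a
    proof -
      have "vec_index (euler_step d e p T X A N (u k) (u (Suc k)) z) a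
          = (\<Sum>n\<le>N. apply_matrix e (level n (u k) (u (Suc k))) (vec_index z) a)"
        using a tensor_action_eq[OF fields z(1) a] by (simp add: euler_step_def S_def[symmetric] level_def)
      also have "\<dots> = (\<Sum>b<e. \<Sum>n\<le>N. level n (u k) (u (Suc k)) a b * vec_index z b)"
        unfolding apply_matrix_def by (rule sum.swap)
      also have "\<dots> = apply_matrix e (step N (u k) (u (Suc k))) (vec_index z) a"
        by (simp add: apply_matrix_def step_def sum_distrib_right)
      also have "\<dots> = scheme N u v (Suc k) a" using z(2) by (simp add: apply_matrix_def)
      finally show ?thesis .
    qed
    moreover have "euler_step d e p T X A N (u k) (u (Suc k)) z \<in> carrier_vec e" by (simp add: euler_step_def)
    ultimately show ?case unfolding eq by blast
  qed
  define M where "M = growth_const p * exp (r powr p * W)"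
  have M0: "0 \<le> M" using beta_p_pos[OF p] p by (simp add: M_def growth_const_def)
  have M: "1 + tail 0 (size 0 T) \<le> M"
  proof -
    have "size 0 T powr p = r powr p * W"
      using p r W by (simp add: size_def W_def[symmetric] powr_mult powr_powr)
    hence "tail 0 (size 0 T) \<le> 6 * (p + 1) / beta_p p * exp (r powr p * W)"
      using level_const_series_le_exp[OF p size_nonneg, of 0 T] by (simp add: tail_def)
    moreover have "1 \<le> exp (r powr p * W)" using W by simp
    moreover have "M = exp (r powr p * W) + 6 * (p + 1) / beta_p p * exp (r powr p * W)"
      by (simp only: M_def growth_const_def distrib_right mult_1_left)
    ultimately show ?thesis by linarith
  qed
  define z where "z = step_size p r W m"
  have z: "0 \<le> z" using r by (simp add: z_def step_size_nonneg)
  define l where "l = 3 / (2 * beta_p p) * (z ^ Suc N / gfact (real (Suc N) / p)) * tail_ratio p N z"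
  have l0: "0 \<le> l"
    unfolding l_def using z beta_p_pos[OF p] gfact_frac_pos[OF p, of "Suc N"] tail_ratio_ge_1[OF p z, of N]
    by (intro mult_nonneg_nonneg divide_nonneg_nonneg) auto
  have l: "tail N (size (u k) (u (Suc k))) \<le> l" if k: "k < m" for k
  proof -
    have "(u k, u (Suc k)) \<in> time_simplex T"
      using is_partition_range[OF u, of k] is_partition_range[OF u, of "Suc k"]
        is_partition_le[OF u, of k "Suc k"] k by (simp add: time_simplex_def)
    hence "0 \<le> omega_p d p X (u k) (u (Suc k))" by (intro LS.nonneg) (auto simp: time_simplex_def)
    moreover have "omega_p d p X (u k) (u (Suc k)) \<le> W / real m"
      using equi[of k "Suc k"] k by (simp add: W_def)
    ultimately have "size (u k) (u (Suc k)) \<le> z"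
      unfolding size_def z_def step_size_def using r p by (intro mult_left_mono powr_mono2) auto
    hence "tail N (size (u k) (u (Suc k))) \<le> tail N z" by (intro tail_mono size_nonneg)
    also have "\<dots> \<le> l" unfolding tail_def l_def by (rule level_const_tail_le[OF p z])
    finally show ?thesis .
  qed
  have ml: "real m * l = total_local_error p r W N m"
    unfolding l_def z_def by (rule total_local_error_eq[OF p W m, symmetric])
  have "euclid_norm (solution_map d e p T X A 0 T y - euler_scheme d e p T X A N m u y)
      = vnorm e (vec_index (solution_map d e p T X A 0 T y - euler_scheme d e p T X A N m u y))"
    using scheme[of m] by (intro euclid_norm_eq_vnorm) auto
  also have "\<dots> = vnorm e (\<lambda>a. apply_matrix e (flow 0 T) v a - scheme N u v m a)"
    using scheme[of m] solution by (intro vnorm_cong) auto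
  also have "\<dots> \<le> M\<^sup>2 * (real m * l) * exp (M * (real m * l)) * vnorm e v"
    using global_error[OF u M l l0] .
  also have "\<dots> \<le> M\<^sup>2 * (real m * l) * exp (M * (real m * l)) * 1"
    using yv l0 by (intro mult_left_mono) auto
  also have "\<dots> = M\<^sup>2 * total_local_error p r W N m * exp (M * total_local_error p r W N m)"
    unfolding ml by simp
  also have "M\<^sup>2 = (growth_const p)\<^sup>2 * exp (2 * r powr p * W)"
    by (simp add: M_def power_mult_distrib exp_double[symmetric] mult.assoc)
  also have "(growth_const p)\<^sup>2 * exp (2 * r powr p * W) * total_local_error p r W N m * exp (M * total_local_error p r W N m)
      = error_const p r W N m * exp (2 * r powr p * W) *
        ((r * W powr (1 / p)) ^ (N + 1) / (gfact (real (N + 1) / p) * real m powr (real (N + 1) / p - 1)))"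
  proof -
    define Q where "Q = (r * W powr (1 / p)) ^ (N + 1) / (gfact (real (N + 1) / p) * real m powr (real (N + 1) / p - 1))"
    define \<epsilon> where "\<epsilon> = exp (M * total_local_error p r W N m)"
    have "total_local_error p r W N m = 3 / (2 * beta_p p) * Q * tail_ratio p N (step_size p r W m)"
      unfolding total_local_error_def Q_def ..
    moreover have "error_const p r W N m = 3 / (2 * beta_p p) * (growth_const p)\<^sup>2 * tail_ratio p N (step_size p r W m) * \<epsilon>"
      unfolding error_const_def \<epsilon>_def M_def ..
    ultimately show ?thesis unfolding Q_def[symmetric] \<epsilon>_def[symmetric] by (simp only: mult_ac)
  qed
  finally show "euclid_norm (solution_map d e p T X A 0 T y - euler_scheme d e p T X A N m u y)
    \<le> error_const p r (omega_p d p X 0 T) N m * exp (2 * r powr p * omega_p d p X 0 T) *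
       ((r * omega_p d p X 0 T powr (1 / p)) ^ (N + 1) /
        (gfact (real (N + 1) / p) * real m powr (real (N + 1) / p - 1)))"
    unfolding W_def .
qed

theorem theorem2p8:
  fixes p :: real
  assumes "1 \<le> p"
  shows "\<exists>(Cp :: real) (C :: real \<Rightarrow> real \<Rightarrow> nat \<Rightarrow> nat \<Rightarrow> real).
    Cp > 0 \<and>
    (\<forall>r w N m. r > 0 \<and> w \<ge> 0 \<and> N \<ge> 1 \<and> m \<ge> 1 \<and> p < real N + 1 \<longrightarrow> C r w N m > 0) \<and>
    (\<forall>r w m. r > 0 \<and> w \<ge> 0 \<and> m \<ge> 1 \<longrightarrow> (\<lambda>N. C r w N m) \<longlonglongrightarrow> Cp) \<and>
    (\<forall>r w N. r > 0 \<and> w \<ge> 0 \<and> N \<ge> 1 \<and> p < real N + 1 \<longrightarrow> (\<lambda>m. C r w N m) \<longlonglongrightarrow> Cp) \<and>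
    (\<forall>(d :: nat) (e :: nat) (T :: real) (X :: real \<Rightarrow> real \<Rightarrow> nat list \<Rightarrow> real) (m :: nat).
       d \<ge> 2 \<and> e \<ge> 1 \<and> T > 0 \<and> rough_path d p T X \<and> m \<ge> 1 \<longrightarrow>
       (\<exists>u :: nat \<Rightarrow> real.
          is_partition 0 T m u \<and>
          (\<forall>i j. i < j \<and> j \<le> m \<longrightarrow>
             omega_p d p X (u i) (u j) \<le> real (j - i) / real m * omega_p d p X 0 T) \<and>
          (\<forall>(r :: real) (A :: nat \<Rightarrow> real mat) (N :: nat).
             r > 0 \<and> A \<in> linear_fields d e \<and> frobenius_norm d e A \<le> r \<and> N \<ge> 1 \<and> p < real N + 1 \<longrightarrow>
             operator_norm e
               (\<lambda>y. solution_map d e p T X A 0 T y - euler_scheme d e p T X A N m u y)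
             \<le> C r (omega_p d p X 0 T) N m * exp (2 * r powr p * omega_p d p X 0 T) *
                 ((r * omega_p d p X 0 T powr (1 / p)) ^ (N + 1) /
                  (gfact (real (N + 1) / p) * real m powr (real (N + 1) / p - 1))))))"
proof (intro exI[of _ "3 / (2 * beta_p p) * (growth_const p)\<^sup>2"] exI[of _ "error_const p"] conjI allI impI)
  have "0 < growth_const p" using beta_p_pos[OF assms] assms by (simp add: growth_const_def add_pos_nonneg)
  thus "0 < 3 / (2 * beta_p p) * (growth_const p)\<^sup>2" using beta_p_pos[OF assms] by simp
next
  fix r w :: real and N m :: nat assume "0 < r \<and> 0 \<le> w \<and> 1 \<le> N \<and> 1 \<le> m \<and> p < real N + 1"
  thus "0 < error_const p r w N m" using error_const_pos[OF assms] by blast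
next
  fix r w :: real and m :: nat assume "0 < r \<and> 0 \<le> w \<and> 1 \<le> m"
  thus "(\<lambda>N. error_const p r w N m) \<longlonglongrightarrow> 3 / (2 * beta_p p) * (growth_const p)\<^sup>2"
    using error_const_tendsto_N[OF assms] by blast
next
  fix r w :: real and N :: nat assume "0 < r \<and> 0 \<le> w \<and> 1 \<le> N \<and> p < real N + 1"
  thus "(\<lambda>m. error_const p r w N m) \<longlonglongrightarrow> 3 / (2 * beta_p p) * (growth_const p)\<^sup>2"
    using error_const_tendsto_m[OF assms] by blast
next
  fix d e :: nat and T :: real and X :: tensor_path and m :: nat
  assume H: "2 \<le> d \<and> 1 \<le> e \<and> 0 < T \<and> rough_path d p T X \<and> 1 \<le> m"
  interpret LS: lyons_setup "omega_p d p X" T d p X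
    using rough_path_lyons_setup[OF assms, of T d X] H by simp
  obtain u where u: "is_partition 0 T m u"
    "\<And>i j. i < j \<Longrightarrow> j \<le> m \<Longrightarrow> omega_p d p X (u i) (u j) \<le> real (j - i) / real m * omega_p d p X 0 T"
    using LS.equipartition[of 0 T m] H by blast
  have "operator_norm e (\<lambda>y. solution_map d e p T X A 0 T y - euler_scheme d e p T X A N m u y)
    \<le> error_const p r (omega_p d p X 0 T) N m * exp (2 * r powr p * omega_p d p X 0 T) *
       ((r * omega_p d p X 0 T powr (1 / p)) ^ (N + 1) /
        (gfact (real (N + 1) / p) * real m powr (real (N + 1) / p - 1)))"
    if "r > 0" "A \<in> linear_fields d e" "frobenius_norm d e A \<le> r" for r A N
    using H that by (intro euler_error_bound[OF assms _ _ _ u]) auto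
  thus "\<exists>u. is_partition 0 T m u \<and>
          (\<forall>i j. i < j \<and> j \<le> m \<longrightarrow>
             omega_p d p X (u i) (u j) \<le> real (j - i) / real m * omega_p d p X 0 T) \<and>
          (\<forall>(r :: real) (A :: nat \<Rightarrow> real mat) (N :: nat).
             r > 0 \<and> A \<in> linear_fields d e \<and> frobenius_norm d e A \<le> r \<and> N \<ge> 1 \<and> p < real N + 1 \<longrightarrow>
             operator_norm e
               (\<lambda>y. solution_map d e p T X A 0 T y - euler_scheme d e p T X A N m u y)
             \<le> error_const p r (omega_p d p X 0 T) N m * exp (2 * r powr p * omega_p d p X 0 T) *
                 ((r * omega_p d p X 0 T powr (1 / p)) ^ (N + 1) /
                  (gfact (real (N + 1) / p) * real m powr (real (N + 1) / p - 1))))"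
    using u by blast
qed

end
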